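(* Let $f$ be a Hecke cusp form of weight $k$ for $\mathrm{SL}_2(\mathbb Z)$, normalized so that $\iint_{\mathcal F}y^k|f(z)|^2\frac{dx\,dy}{y^2}=1$. Let $B>1$ and $\mathcal R\subset\{z\in\mathcal F:\mathrm{Im}(z)\le B\}$. Let $h(k)>\frac{\log k}{k}$ and let $\phi$ be a smooth function compactly supported in $\mathcal R$ such that $\Delta\phi\ll h(k)^{-A}$ for some $A\ge 0$. Suppose that for every $z_0\in\mathcal R$ and $k\ge K(B)$ there exists a point $z_1=x_1+iy_1\in D_{h(k)}(z_0)$ satisfying $$y_1^k|f(z_1)|^2\gg e^{-k h(k)}.$$ Then $$\sum_{\varrho_f}\phi(\varrho_f) = \frac{k}{12}\cdot\frac{3}{\pi}\iint_{\mathcal F}\phi(z)\frac{dx\,dy}{y^2} + O_B\!\left(k\, h(k)^2\right) + O_{A,B}\!\left(k\, h(k)\log(1/h(k))\iint_{\mathcal F}|\Delta\phi(z)|\frac{dx\,dy}{y^2}\right),$$ where the sum runs over the zeros $\varrho_f$ of $f$ in $\mathcal F$, counted with multiplicity.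
   Context: $z=x+iy\in\mathbb H$, $\mathcal F=\{z\in\mathbb H: -1/2\le \mathrm{Re}(z)<1/2,\ |z|\ge 1\}$. $D_r(z)$ denotes the (Euclidean) disk of radius $r$ centered at $z$. $\Delta=-y^2\left(\frac{\partial^2}{\partial x^2}+\frac{\partial^2}{\partial y^2}\right)$ is the hyperbolic Laplacian. $K(B)$ is some threshold depending on $B$. *)

theory Defs
  imports "HOL-Complex_Analysis.Complex_Analysis"
begin

definition upper_half :: "complex set" where
  "upper_half = {z. Im z > 0}"

definition fund_domain :: "complex set" where
  "fund_domain = {z \<in> upper_half. -1/2 \<le> Re z \<and> Re z < 1/2 \<and> norm z \<ge> 1}"

text \<open>
  The integral of \<open>g\<close> over \<open>S\<close> against \<open>dx dy / y\<^sup>2\<close>; the measure \<^const>\<open>lborel\<close> on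
  \<^typ>\<open>complex\<close> is \<open>dx dy\<close>.
\<close>

definition hyp_integral ::
    "complex set \<Rightarrow> (complex \<Rightarrow> 'a::{banach, second_countable_topology}) \<Rightarrow> 'a" where
  "hyp_integral S g = (LINT z:S|lborel. (1 / (Im z)\<^sup>2) *\<^sub>R g z)"

text \<open>
  Derivative of \<open>\<phi>\<close> in the real direction \<open>v\<close>, so that \<open>v = 1\<close> gives \<open>\<partial>/\<partial>x\<close> and
  \<open>v = \<i>\<close> gives \<open>\<partial>/\<partial>y\<close>.
\<close>

definition dir_deriv :: "complex \<Rightarrow> (complex \<Rightarrow> complex) \<Rightarrow> complex \<Rightarrow> complex" where
  "dir_deriv v \<phi> z = vector_derivative (\<lambda>t::real. \<phi> (z + t *\<^sub>R v)) (at 0)"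

text \<open>
  Smoothness in the real sense on an open set: every iterated partial derivative is (real Frechet)
  differentiable, hence every iterated partial derivative exists and is continuous.
\<close>

definition real_smooth_on :: "complex set \<Rightarrow> (complex \<Rightarrow> complex) \<Rightarrow> bool" where
  "real_smooth_on U \<phi> \<longleftrightarrow>
     (\<forall>vs \<in> lists {1, \<i>}. foldr dir_deriv vs \<phi> differentiable_on U)"

definition hyp_laplacian :: "(complex \<Rightarrow> complex) \<Rightarrow> complex \<Rightarrow> complex" where
  "hyp_laplacian \<phi> z =
     - of_real ((Im z)\<^sup>2) * (dir_deriv 1 (dir_deriv 1 \<phi>) z + dir_deriv \<i> (dir_deriv \<i> \<phi>) z)"

text \<open>
  \<open>\<phi>\<close> is only considered as a function on the upper half plane; its support is a compact subset
  of \<open>R\<close>.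
\<close>

definition compactly_supported_in :: "complex set \<Rightarrow> (complex \<Rightarrow> complex) \<Rightarrow> bool" where
  "compactly_supported_in R \<phi> \<longleftrightarrow>
     compact (closure (support_on upper_half \<phi>)) \<and> closure (support_on upper_half \<phi>) \<subseteq> R"

text \<open>
  Holomorphic cusp forms for the full modular group: the Fourier expansion at the cusp has no
  constant term.
\<close>

definition cusp_form :: "nat \<Rightarrow> (complex \<Rightarrow> complex) \<Rightarrow> bool" where
  "cusp_form k f \<longleftrightarrow>
     f holomorphic_on upper_half \<and>
     (\<forall>a b c d :: int. a * d - b * c = 1 \<longrightarrow>
        (\<forall>z \<in> upper_half.
           f ((of_int a * z + of_int b) / (of_int c * z + of_int d)) =
             (of_int c * z + of_int d) ^ k * f z)) \<and>
     (\<exists>q :: nat \<Rightarrow> complex. \<forall>z \<in> upper_half.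
        (\<lambda>n. q (Suc n) * exp (2 * of_real pi * \<i> * of_nat (Suc n) * z)) sums f z)"

text \<open>
  \<open>T\<^sub>n f (z) = n\<^bsup>k-1\<^esup> \<Sum> d\<^bsup>-k\<^esup> f ((az + b)/d)\<close>, summed over \<open>ad = n\<close> and \<open>0 \<le> b < d\<close>.
\<close>

definition hecke_op :: "nat \<Rightarrow> nat \<Rightarrow> (complex \<Rightarrow> complex) \<Rightarrow> complex \<Rightarrow> complex" where
  "hecke_op k n f z =
     of_nat n powi (int k - 1) *
     (\<Sum>d | d dvd n. \<Sum>b<d. f ((of_nat (n div d) * z + of_nat b) / of_nat d) / of_nat d ^ k)"

definition hecke_cusp_form :: "nat \<Rightarrow> (complex \<Rightarrow> complex) \<Rightarrow> bool" where
  "hecke_cusp_form k f \<longleftrightarrow>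
     cusp_form k f \<and> (\<exists>z \<in> upper_half. f z \<noteq> 0) \<and>
     (\<forall>n\<ge>1. \<exists>ev. \<forall>z \<in> upper_half. hecke_op k n f z = ev * f z)"

text \<open>
  The sum of \<open>\<phi>\<close> over the zeros of \<open>f\<close> in the fundamental domain, with multiplicity. A nonzero
  cusp form has only finitely many of these, so the sum is never the default value of an infinite
  \<^const>\<open>sum\<close>.
\<close>

definition zero_sum :: "(complex \<Rightarrow> complex) \<Rightarrow> (complex \<Rightarrow> complex) \<Rightarrow> complex" where
  "zero_sum f \<phi> = (\<Sum>w \<in> {w \<in> fund_domain. f w = 0}. of_int (zorder f w) * \<phi> w)"

end

(*
  The function u(z) = log(y^(k/2) |f(z)|) has distributional Laplacian 2 pi sum_rho delta_rho - k/(2 y^2),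
  so the left hand side minus the main term is (1/2 pi) times the integral of u against the Euclidean
  Laplacian of phi, and the task is to bound |u| on average.  The normalization gives u <= O(k h),
  because the maximum of y^k |f|^2 is at most O(k^2) and log k < k h.  On a disc of radius about h, the
  point z1 bounds u from below by -O(k h); dividing by Blaschke factors and applying Harnack's
  inequality to the nonvanishing quotient gives
      |u(z)| <= O(k h) + sum_a w_a log(8h / |z - a|),  with weights w_a >= 0 of total mass O(k h).
  The singularities are integrated against |Laplacian phi| by splitting at distance s h, where
  s = h^(A+1) makes the part near the zeros negligible against the bound h^(-A).  Summing over a grid
  of squares of side h gives the estimate for small h.  When h is bounded below, or k is small and the
  lower bound hypothesis is void, the same argument on one large disc, started from a modular
  transform of the point where |f| is maximal on Im z >= 1/2, costs k in place of k h.
*)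
theory Submission
  imports Defs "HOL-Real_Asymp.Real_Asymp"
begin

section \<open>Green's identity for compactly supported test functions\<close>

text \<open>Uniformity shapes the final case distinction. The coefficient of k h^2 is fixed before
  A, and the other error term carries log(1/h), which vanishes at h = 1. So for h bounded below, the
  logarithmic term can pay only when h^(-A) is large: h^(-A) > 2 means A log(1/h) > log 2, and then
  constants are absorbed. If h^(-A) <= 2, the Laplacian of phi is bounded independently of A and the
  whole error goes into k h^2.

  Since log y is not harmonic, on each small disc it is replaced by its linearization, the real part
  of a holomorphic function; up to O(k h), u becomes log|g| with g holomorphic.

  Zeros are never counted separately. The total weight of the logarithms comes from the Blaschke
  factors at the single point z1: their logarithms sum to at most the gap between the upper and the
  lower bound, and each of them is comparable to 1 - |a|^2 throughout a smaller disc.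

  Each logarithm is paid for twice: away from its pole by the L^1 norm of the Laplacian, which is
  the quantity in the theorem, and near the pole by its sup norm, which is only known to be
  O(h^(-A)) and therefore forces a cutoff depending on A.\<close>

lemma integrable_continuous_compact_support:
  fixes W :: "complex \<Rightarrow> 'b :: {banach, second_countable_topology}"
  assumes "continuous_on UNIV W" "compact K" "\<And>z. z \<notin> K \<Longrightarrow> W z = 0"
  shows "integrable lborel W"
proof -
  have "integrable lborel (\<lambda>x. indicator K x *\<^sub>R W x)"
    using assms by (intro borel_integrable_compact) (auto intro: continuous_on_subset)
  also have "(\<lambda>x. indicator K x *\<^sub>R W x) = W"
    using assms(3) by (auto simp: indicator_def fun_eq_iff)
  finally show ?thesis .
qed

lemma lborel_integral_translate:
  fixes f :: "complex \<Rightarrow> 'b :: {banach, second_countable_topology}"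
  assumes "f \<in> borel_measurable borel"
  shows "(LBINT z. f (z + c)) = integral\<^sup>L lborel f"
proof -
  have "integral\<^sup>L lborel f = integral\<^sup>L (distr lborel borel ((+) c)) f"
    by (simp add: lborel_distr_plus)
  also have "\<dots> = (LBINT z. f (c + z))"
    using assms by (subst integral_distr) auto
  finally show ?thesis by (simp add: add.commute)
qed

text \<open>By translation invariance, the difference quotients of \<open>V\<close> have integral \<open>0\<close>.\<close>

lemma integral_directional_derivative_eq_0:
  fixes V W :: "complex \<Rightarrow> complex"
  assumes cV: "continuous_on UNIV V" and cW: "continuous_on UNIV W" and K: "compact K"
    and V0: "\<And>z. z \<notin> K \<Longrightarrow> V z = 0" and W0: "\<And>z. z \<notin> K \<Longrightarrow> W z = 0"
    and der: "\<And>z. ((\<lambda>t. V (z + t *\<^sub>R v)) has_vector_derivative W z) (at 0)"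
  shows "integral\<^sup>L lborel W = 0"
proof -
  have "compact (W ` K)"
    using K cW by (intro compact_continuous_image) (auto intro: continuous_on_subset)
  then obtain B where B: "\<And>z. z \<in> K \<Longrightarrow> norm (W z) \<le> B"
    by (metis bounded_iff compact_imp_bounded image_eqI)
  define B' where "B' = max B 0"
  have B': "norm (W z) \<le> B'" for z
    using B[of z] W0[of z] by (cases "z \<in> K") (auto simp: B'_def)
  obtain r where r: "K \<subseteq> cball 0 r"
    using compact_imp_bounded[OF K] unfolding bounded_iff by (auto simp: subset_iff)
  have mv: "norm (V (z + t *\<^sub>R v) - V z) \<le> B' * t" if "t \<ge> 0" for z t
  proof -
    have der': "((\<lambda>t. V (z + t *\<^sub>R v)) has_vector_derivative W (z + s *\<^sub>R v)) (at s)" for s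
    proof -
      have *: "((\<lambda>t. V (z + s *\<^sub>R v + t *\<^sub>R v)) has_vector_derivative W (z + s *\<^sub>R v)) (at (s - s))"
        using der[of "z + s *\<^sub>R v"] by simp
      have "((\<lambda>t. t - s) has_vector_derivative 1) (at s)"
        by (auto intro!: derivative_eq_intros)
      from vector_diff_chain_at[OF this *]
      show ?thesis by (simp add: o_def algebra_simps)
    qed
    have "norm (V (z + t *\<^sub>R v) - V (z + 0 *\<^sub>R v)) \<le> B' * norm (t - 0)"
    proof (rule differentiable_bound[of "{0..t}" _ "\<lambda>s h. h *\<^sub>R W (z + s *\<^sub>R v)"])
      fix s assume "s \<in> {0..t}"
      show "((\<lambda>t. V (z + t *\<^sub>R v)) has_derivative (\<lambda>h. h *\<^sub>R W (z + s *\<^sub>R v))) (at s within {0..t})"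
        using der'[of s] has_derivative_at_withinI by (auto simp: has_vector_derivative_def)
      show "onorm (\<lambda>h. h *\<^sub>R W (z + s *\<^sub>R v)) \<le> B'"
        by (rule onorm_le) (use B'[of "z + s *\<^sub>R v"] in \<open>auto simp: mult.commute[of _ "\<bar>_\<bar>"] intro: mult_left_mono\<close>)
    qed (use that in auto)
    then show ?thesis using that by simp
  qed
  have iV: "integrable lborel V" by (rule integrable_continuous_compact_support[OF cV K V0])
  have [measurable]: "V \<in> borel_measurable borel" "W \<in> borel_measurable borel"
    using cV cW by (auto intro: borel_measurable_continuous_onI)
  define s where "s = (\<lambda>n z. of_nat (Suc n) * (V (z + (1 / real (Suc n)) *\<^sub>R v) - V z))"
  have "(\<lambda>n. integral\<^sup>L lborel (s n)) \<longlonglongrightarrow> integral\<^sup>L lborel W"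
  \<comment> \<open>By \<open>mv\<close> all quotients are bounded by \<open>B'\<close>. Every step
    length \<open>1 / Suc n\<close> is at most 1, so they vanish outside the disc of radius
    \<open>r + norm v\<close>.\<close>
  proof (rule integral_dominated_convergence[where w = "\<lambda>z. B' * indicator (cball 0 (r + norm v)) z"])
    have "emeasure lborel (cball (0::complex) (r + norm v)) < \<infinity>"
      by (rule emeasure_bounded_finite) auto
    then have "integrable lborel (indicator (cball 0 (r + norm v)) :: complex \<Rightarrow> real)"
      by (intro integrable_real_indicator) (auto simp: top.not_eq_extremum)
    then show "integrable lborel (\<lambda>z::complex. B' * indicator (cball 0 (r + norm v)) z)"
      by (rule integrable_mult_right)
    show "AE z in lborel. (\<lambda>n. s n z) \<longlonglongrightarrow> W z"
    proof (rule AE_I2)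
      fix z
      have "((\<lambda>h. norm (V (z + (0 + h) *\<^sub>R v) - V (z + 0 *\<^sub>R v) - h *\<^sub>R W z) / norm h) \<longlongrightarrow> 0) (at 0)"
        using der[of z] unfolding has_vector_derivative_def has_derivative_at by simp
      moreover have "filterlim (\<lambda>n. 1 / real (Suc n)) (at 0) sequentially"
        unfolding filterlim_at using LIMSEQ_inverse_real_of_nat by (auto simp: divide_inverse)
      ultimately have "(\<lambda>n. norm (V (z + (0 + 1 / real (Suc n)) *\<^sub>R v) - V (z + 0 *\<^sub>R v) - (1 / real (Suc n)) *\<^sub>R W z) / norm (1 / real (Suc n))) \<longlonglongrightarrow> 0"
        by (rule filterlim_compose)
      moreover have "norm (V (z + (0 + 1 / real (Suc n)) *\<^sub>R v) - V (z + 0 *\<^sub>R v) - (1 / real (Suc n)) *\<^sub>R W z) / norm (1 / real (Suc n)) = norm (s n z - W z)" for n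
      proof -
        have "s n z - W z = of_nat (Suc n) * (V (z + (1 / real (Suc n)) *\<^sub>R v) - V z - (1 / real (Suc n)) *\<^sub>R W z)"
          by (simp add: s_def scaleR_conv_of_real right_diff_distrib del: of_nat_Suc)
        then show ?thesis by (simp add: norm_mult del: of_nat_Suc)
      qed
      ultimately have "(\<lambda>n. s n z - W z) \<longlonglongrightarrow> 0"
        by (simp add: tendsto_norm_zero_iff)
      then show "(\<lambda>n. s n z) \<longlonglongrightarrow> W z" by (simp add: LIM_zero_iff)
    qed
    fix n
    show "AE z in lborel. norm (s n z) \<le> B' * indicator (cball 0 (r + norm v)) z"
    proof (rule AE_I2)
      fix z
      show "norm (s n z) \<le> B' * indicator (cball 0 (r + norm v)) z"
      proof (cases "z \<in> cball 0 (r + norm v)")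
        case True
        have "norm (s n z) \<le> real (Suc n) * (B' * (1 / real (Suc n)))"
          unfolding s_def norm_mult using mv[of "1 / real (Suc n)" z]
          by (intro mult_mono) (auto simp del: of_nat_Suc)
        then show ?thesis using True by simp
      next
        case False
        have "norm (z + (1 / real (Suc n)) *\<^sub>R v) \<ge> norm z - (1 / real (Suc n)) * norm v"
          using norm_triangle_ineq2[of z "- ((1 / real (Suc n)) *\<^sub>R v)"] by (simp add: norm_minus_commute)
        moreover have "(1 / real (Suc n)) * norm v \<le> 1 * norm v"
          by (rule mult_right_mono) auto
        ultimately have "z + (1 / real (Suc n)) *\<^sub>R v \<notin> cball 0 r" "z \<notin> cball 0 r"
          using False norm_ge_zero[of v] by (auto simp del: norm_ge_zero)
        then have "V (z + (1 / real (Suc n)) *\<^sub>R v) = 0" "V z = 0"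
          using V0 r by blast+
        then show ?thesis by (simp add: s_def B'_def)
      qed
    qed
  qed (simp_all add: s_def)
  moreover have "integral\<^sup>L lborel (s n) = 0" for n
  proof -
    have "integrable lborel (\<lambda>z. V (z + (1 / real (Suc n)) *\<^sub>R v))"
      using iV lborel_integrable_real_affine
      by (subst (asm) lborel_distr_plus[of "(1 / real (Suc n)) *\<^sub>R v", symmetric])
         (simp add: integrable_distr_eq add.commute)
    then show ?thesis
      unfolding s_def using iV by (simp add: lborel_integral_translate del: of_nat_Suc)
  qed
  ultimately show ?thesis using LIMSEQ_unique[OF tendsto_const] by fastforce
qed

text \<open>The Laplacian splits into the directions \<open>1\<close> and \<open>\<i>\<close>, so
  derivatives along one line suffice. Here \<open>g\<close> is the second derivative; the first one
  is existential because it enters only through the field that Green's identity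
  differentiates.\<close>

definition dir_test :: "complex set \<Rightarrow> complex \<Rightarrow> (complex \<Rightarrow> complex) \<Rightarrow> (complex \<Rightarrow> complex) \<Rightarrow> bool" where
  "dir_test K v \<phi> g \<longleftrightarrow> continuous_on UNIV \<phi> \<and> continuous_on UNIV g \<and>
     (\<forall>z. z \<notin> K \<longrightarrow> \<phi> z = 0 \<and> g z = 0) \<and>
     (\<exists>p. continuous_on UNIV p \<and> (\<forall>z. z \<notin> K \<longrightarrow> p z = 0) \<and>
        (\<forall>z. ((\<lambda>t. \<phi> (z + t *\<^sub>R v)) has_vector_derivative p z) (at 0)) \<and>
        (\<forall>z. ((\<lambda>t. p (z + t *\<^sub>R v)) has_vector_derivative g z) (at 0)))"

definition dir_C2 :: "complex set \<Rightarrow> complex \<Rightarrow> (complex \<Rightarrow> real) \<Rightarrow> (complex \<Rightarrow> real) \<Rightarrow> bool" where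
  "dir_C2 U v u g \<longleftrightarrow> continuous_on U u \<and> continuous_on U g \<and>
     (\<exists>p. continuous_on U p \<and>
        (\<forall>z\<in>U. ((\<lambda>t. u (z + t *\<^sub>R v)) has_real_derivative p z) (at 0)) \<and>
        (\<forall>z\<in>U. ((\<lambda>t. p (z + t *\<^sub>R v)) has_real_derivative g z) (at 0)))"

lemma continuous_on_zero_outside:
  fixes F :: "complex \<Rightarrow> complex"
  assumes "continuous_on U F" "open U" "compact K" "K \<subseteq> U" "\<And>z. z \<notin> K \<Longrightarrow> F z = 0"
  shows "continuous_on UNIV F"
proof -
  have "continuous_on (- K) F"
    using assms(5) by (subst continuous_on_cong[OF refl, of _ _ "\<lambda>_. 0"]) auto
  then have "continuous_on (U \<union> - K) F"
    using assms by (intro continuous_on_open_Un) (auto simp: compact_imp_closed open_Compl)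
  moreover have "U \<union> - K = UNIV" using assms by auto
  ultimately show ?thesis by simp
qed

text \<open>The integrand \<open>u g - u2 \<phi>\<close> is the directional derivative of
  \<open>u p - u1 \<phi>\<close>, where \<open>p\<close> and \<open>u1\<close> are the first
  derivatives; the mixed terms cancel and the field has compact support.\<close>

lemma green_directional:
  assumes U: "open U" "compact K" "K \<subseteq> U" and t: "dir_test K v \<phi> g" and u: "dir_C2 U v u u2"
  shows "(LBINT z. u z *\<^sub>R g z) = (LBINT z. u2 z *\<^sub>R \<phi> z)"
    and "integrable lborel (\<lambda>z. u z *\<^sub>R g z)" "integrable lborel (\<lambda>z. u2 z *\<^sub>R \<phi> z)"
proof -
  from t obtain p where p: "continuous_on UNIV p" "\<And>z. z \<notin> K \<Longrightarrow> p z = 0"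
     "\<And>z. ((\<lambda>t. \<phi> (z + t *\<^sub>R v)) has_vector_derivative p z) (at 0)"
     "\<And>z. ((\<lambda>t. p (z + t *\<^sub>R v)) has_vector_derivative g z) (at 0)"
    and t: "continuous_on UNIV \<phi>" "continuous_on UNIV g" "\<And>z. z \<notin> K \<Longrightarrow> \<phi> z = 0" "\<And>z. z \<notin> K \<Longrightarrow> g z = 0"
    unfolding dir_test_def by blast
  from u obtain u1 where u1: "continuous_on U u1"
     "\<And>z. z \<in> U \<Longrightarrow> ((\<lambda>t. u (z + t *\<^sub>R v)) has_real_derivative u1 z) (at 0)"
     "\<And>z. z \<in> U \<Longrightarrow> ((\<lambda>t. u1 (z + t *\<^sub>R v)) has_real_derivative u2 z) (at 0)"
    and u: "continuous_on U u" "continuous_on U u2"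
    unfolding dir_C2_def by blast
  note ct = continuous_on_subset[OF _ subset_UNIV]
  have c1: "continuous_on UNIV (\<lambda>z. u z *\<^sub>R g z)"
    by (rule continuous_on_zero_outside[OF _ U]) (auto intro!: continuous_intros u ct[OF t(2)] simp: t(4))
  have c2: "continuous_on UNIV (\<lambda>z. u2 z *\<^sub>R \<phi> z)"
    by (rule continuous_on_zero_outside[OF _ U]) (auto intro!: continuous_intros u ct[OF t(1)] simp: t(3))
  have c3: "continuous_on UNIV (\<lambda>z. u z *\<^sub>R p z - u1 z *\<^sub>R \<phi> z)"
    by (rule continuous_on_zero_outside[OF _ U])
       (auto intro!: continuous_intros u u1 ct[OF t(1)] ct[OF p(1)] simp: t(3) p(2))
  show i1: "integrable lborel (\<lambda>z. u z *\<^sub>R g z)"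
    by (rule integrable_continuous_compact_support[OF c1 U(2)]) (simp add: t(4))
  show i2: "integrable lborel (\<lambda>z. u2 z *\<^sub>R \<phi> z)"
    by (rule integrable_continuous_compact_support[OF c2 U(2)]) (simp add: t(3))
  have "(LBINT z. u z *\<^sub>R g z - u2 z *\<^sub>R \<phi> z) = 0"
  proof (rule integral_directional_derivative_eq_0[OF c3 _ U(2)])
    show "continuous_on UNIV (\<lambda>z. u z *\<^sub>R g z - u2 z *\<^sub>R \<phi> z)"
      by (intro continuous_intros c1 c2)
    fix z
    show "((\<lambda>t. u (z + t *\<^sub>R v) *\<^sub>R p (z + t *\<^sub>R v) - u1 (z + t *\<^sub>R v) *\<^sub>R \<phi> (z + t *\<^sub>R v))
       has_vector_derivative u z *\<^sub>R g z - u2 z *\<^sub>R \<phi> z) (at 0)"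
    proof (cases "z \<in> U")
      case True
      show ?thesis
        by (rule derivative_eq_intros u1(2)[OF True] u1(3)[OF True] p(3,4) refl)+ simp
    next
      case False
      \<comment> \<open>Off \<open>U\<close> nothing is known about \<open>u\<close>, but the test
        function vanishes on the open set \<open>- K\<close>, so the field is identically 0 along
        the line near \<open>z\<close>.\<close>
      then have zK: "z \<in> - K" using U by auto
      have "open (- K)" using U by (auto simp: compact_imp_closed open_Compl)
      moreover have "((\<lambda>t. z + t *\<^sub>R v) \<longlongrightarrow> z) (at (0::real))"
        by (auto intro!: tendsto_eq_intros)
      ultimately have "\<forall>\<^sub>F t in at (0::real). z + t *\<^sub>R v \<in> - K"
        using zK by (metis topological_tendstoD)
      then have ev: "\<forall>\<^sub>F t in nhds (0::real). z + t *\<^sub>R v \<in> - K"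
        using zK by (simp add: eventually_at_filter eventually_mono) (smt (verit) eventually_mono scaleR_zero_left add.right_neutral)
      have "((\<lambda>t::real. 0 :: complex) has_vector_derivative 0) (at 0)"
        by (rule has_vector_derivative_const)
      then show ?thesis
        using zK ev
        by (subst has_vector_derivative_cong_ev[where g = "\<lambda>_. 0"])
           (auto simp: t(3,4) p(2) elim!: eventually_mono)
    qed
  qed (auto simp: t(3,4) p(2))
  then show "(LBINT z. u z *\<^sub>R g z) = (LBINT z. u2 z *\<^sub>R \<phi> z)"
    using i1 i2 by simp
qed

text \<open>\<open>L\<close> is the Euclidean Laplacian of \<open>\<phi>\<close>. Keeping it as a
  parameter frees the potential theory from the particular notion of derivative in which
  \<open>\<phi>\<close> is given.\<close>

definition C2_test :: "complex set \<Rightarrow> (complex \<Rightarrow> complex) \<Rightarrow> (complex \<Rightarrow> complex) \<Rightarrow> bool" where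
  "C2_test K \<phi> L \<longleftrightarrow> compact K \<and>
     (\<exists>g1 g2. dir_test K 1 \<phi> g1 \<and> dir_test K \<i> \<phi> g2 \<and> L = (\<lambda>z. g1 z + g2 z))"

lemma C2_testD:
  assumes "C2_test K \<phi> L"
  shows "compact K" "continuous_on UNIV \<phi>" "continuous_on UNIV L"
    "\<And>z. z \<notin> K \<Longrightarrow> \<phi> z = 0" "\<And>z. z \<notin> K \<Longrightarrow> L z = 0"
  using assms unfolding C2_test_def dir_test_def by (auto intro!: continuous_intros)

lemma green:
  assumes U: "open U" "K \<subseteq> U" and t: "C2_test K \<phi> L"
    and u: "dir_C2 U 1 u u1" "dir_C2 U \<i> u u2" and G: "\<And>z. z \<in> U \<Longrightarrow> u1 z + u2 z = G z"
  shows "(LBINT z. u z *\<^sub>R L z) = (LBINT z. G z *\<^sub>R \<phi> z)"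
    and "integrable lborel (\<lambda>z. u z *\<^sub>R L z)" "integrable lborel (\<lambda>z. G z *\<^sub>R \<phi> z)"
proof -
  obtain g1 g2 where g: "dir_test K 1 \<phi> g1" "dir_test K \<i> \<phi> g2" and L: "L = (\<lambda>z. g1 z + g2 z)"
    using t unfolding C2_test_def by blast
  note K = C2_testD(1)[OF t]
  note * = green_directional[OF U(1) K U(2) g(1) u(1)] green_directional[OF U(1) K U(2) g(2) u(2)]
  have e: "(\<lambda>z. G z *\<^sub>R \<phi> z) = (\<lambda>z. u1 z *\<^sub>R \<phi> z + u2 z *\<^sub>R \<phi> z)"
    using G U(2) C2_testD(4)[OF t] by (force simp: fun_eq_iff simp flip: scaleR_add_left)
  show "(LBINT z. u z *\<^sub>R L z) = (LBINT z. G z *\<^sub>R \<phi> z)"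
    unfolding e unfolding L scaleR_add_right using * by simp
  show "integrable lborel (\<lambda>z. u z *\<^sub>R L z)" "integrable lborel (\<lambda>z. G z *\<^sub>R \<phi> z)"
    unfolding e unfolding L scaleR_add_right using * by simp_all
qed

section \<open>The logarithmic kernel in the plane\<close>

lemma nn_integral_FTC_UNIV:
  fixes f F :: "real \<Rightarrow> real"
  assumes "\<And>x. DERIV F x :> f x" "continuous_on UNIV f" "\<And>x. f x \<ge> 0"
    and "(F \<longlongrightarrow> S) at_bot" "(F \<longlongrightarrow> T) at_top"
  shows "(\<integral>\<^sup>+x. ennreal (f x) \<partial>lborel) = ennreal (T - S)"
proof -
  have *: "set_integrable lborel (einterval (-\<infinity>) \<infinity>) f" "(LBINT x=-\<infinity>..\<infinity>. f x) = T - S"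
    using assms
    by (intro interval_integral_FTC_nonneg[where F = F];
        auto simp: continuous_on_eq_continuous_at ereal_tendsto_simps1)+
  then have "integrable lborel f" "integral\<^sup>L lborel f = T - S"
    by (simp_all add: set_integrable_def interval_lebesgue_integral_def set_lebesgue_integral_def)
  then show ?thesis using assms(3) by (subst nn_integral_eq_integral) auto
qed

lemma measurable_Complex: "(\<lambda>(x, y). Complex x y) \<in> (lborel \<Otimes>\<^sub>M lborel) \<rightarrow>\<^sub>M borel"
proof -
  have "continuous_on UNIV (\<lambda>(x, y). Complex x y)"
    unfolding case_prod_beta Complex_eq by (intro continuous_intros)
  from borel_measurable_continuous_onI[OF this] show ?thesis unfolding lborel_prod by simp
qed

lemma lborel_complex:
  "(lborel :: complex measure) = distr (lborel \<Otimes>\<^sub>M lborel) borel (\<lambda>(x, y). Complex x y)"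
proof (rule lborel_eqI)
  fix l u :: complex
  assume le: "\<And>b. b \<in> Basis \<Longrightarrow> l \<bullet> b \<le> u \<bullet> b"
  have le': "Re l \<le> Re u" "Im l \<le> Im u"
    using le[of 1] le[of \<i>] by (auto simp: Basis_complex_def inner_complex_def)
  have "(\<lambda>(x, y). Complex x y) -` box l u = {Re l<..<Re u} \<times> {Im l<..<Im u}"
    by (auto simp: box_def Basis_complex_def inner_complex_def)
  then show "emeasure (distr (lborel \<Otimes>\<^sub>M lborel) borel (\<lambda>(x, y). Complex x y)) (box l u) = (\<Prod>b\<in>Basis. (u - l) \<bullet> b)"
    using le' measurable_Complex
    by (simp add: emeasure_distr space_pair_measure lborel.emeasure_pair_measure_Times
          Basis_complex_def inner_complex_def ennreal_mult)
qed auto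

section \<open>The integral of the Fubini-Study density\<close>

lemma nn_integral_inverse_square_shift:
  fixes s :: real
  assumes "s > 0"
  shows "(\<integral>\<^sup>+y. ennreal (1 / (s + y\<^sup>2)\<^sup>2) \<partial>lborel) = ennreal (pi / 2 * (1 / (s * sqrt s)))"
proof -
  let ?F = "\<lambda>y. y / (2 * s * (s + y\<^sup>2)) + arctan (y / sqrt s) / (2 * s * sqrt s)"
  have pos: "s + y\<^sup>2 > 0" for y using assms by (simp add: add_pos_nonneg)
  have "(\<integral>\<^sup>+y. ennreal (1 / (s + y\<^sup>2)\<^sup>2) \<partial>lborel) = ennreal (pi / (4 * s * sqrt s) - (- pi / (4 * s * sqrt s)))"
  proof (rule nn_integral_FTC_UNIV[where F = ?F])
    fix y
    define R where "R = 1 / (1 + (y / sqrt s)\<^sup>2)"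
    have "R = s / (s + y\<^sup>2)" using assms pos[of y] by (simp add: R_def power_divide field_simps)
    moreover have "sqrt s * sqrt s = s" using assms by simp
    ultimately have 1: "1 / (2 * s * (s + y\<^sup>2)) = 1 / sqrt s * R / (2 * s * sqrt s)"
      using assms by (simp add: mult.assoc)
    have "DERIV ?F y :> (1 * (2 * s * (s + y\<^sup>2)) - y * (2 * s * (2 * y))) / (2 * s * (s + y\<^sup>2))\<^sup>2
       + 1 / sqrt s * R / (2 * s * sqrt s)"
    proof (rule DERIV_add)
      have nz: "2 * s * (s + y\<^sup>2) \<noteq> 0" using pos[of y] assms by simp
      have "DERIV (\<lambda>y. 2 * s * (s + y\<^sup>2)) y :> 2 * s * (2 * y)"
        by (auto intro!: derivative_eq_intros)
      from DERIV_divide[OF DERIV_ident this nz]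
      show "DERIV (\<lambda>y. y / (2 * s * (s + y\<^sup>2))) y :> (1 * (2 * s * (s + y\<^sup>2)) - y * (2 * s * (2 * y))) / (2 * s * (s + y\<^sup>2))\<^sup>2"
        by (simp only: power2_eq_square)
      have "DERIV (\<lambda>y. y / sqrt s) y :> 1 / sqrt s"
        by (rule DERIV_cdivide[OF DERIV_ident])
      from DERIV_chain2[OF DERIV_arctan this]
      have "DERIV (\<lambda>y. arctan (y / sqrt s)) y :> 1 / sqrt s * R"
        by (simp only: R_def mult.commute inverse_eq_divide)
      then show "DERIV (\<lambda>y. arctan (y / sqrt s) / (2 * s * sqrt s)) y :> 1 / sqrt s * R / (2 * s * sqrt s)"
        by (rule DERIV_cdivide)
    qed
    also have "(1 * (2 * s * (s + y\<^sup>2)) - y * (2 * s * (2 * y))) / (2 * s * (s + y\<^sup>2))\<^sup>2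
       + 1 / sqrt s * R / (2 * s * sqrt s) = 1 / (s + y\<^sup>2)\<^sup>2"
      unfolding 1[symmetric] using pos[of y] assms by (simp add: divide_simps) (simp add: power2_eq_square algebra_simps)
    finally show "DERIV ?F y :> 1 / (s + y\<^sup>2)\<^sup>2" .
  next
    show "continuous_on UNIV (\<lambda>y. 1 / (s + y\<^sup>2)\<^sup>2)"
      using pos by (auto intro!: continuous_intros simp: less_imp_neq[OF pos, symmetric])
    have a: "filterlim (\<lambda>y. y / sqrt s) at_top at_top" "filterlim (\<lambda>y. y / sqrt s) at_bot at_bot"
      using assms by real_asymp+
    have b: "((\<lambda>y. y / (2 * s * (s + y\<^sup>2))) \<longlongrightarrow> 0) at_top" "((\<lambda>y. y / (2 * s * (s + y\<^sup>2))) \<longlongrightarrow> 0) at_bot"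
      using assms by real_asymp+
    have "(?F \<longlongrightarrow> 0 + (pi / 2) / (2 * s * sqrt s)) at_top"
      by (intro tendsto_intros b filterlim_compose[OF tendsto_arctan_at_top a(1)]) (use assms in auto)
    then show "(?F \<longlongrightarrow> pi / (4 * s * sqrt s)) at_top" by (simp add: field_simps)
    have "(?F \<longlongrightarrow> 0 + (- (pi / 2)) / (2 * s * sqrt s)) at_bot"
      by (intro tendsto_intros b filterlim_compose[OF tendsto_arctan_at_bot a(2)]) (use assms in auto)
    then show "(?F \<longlongrightarrow> - pi / (4 * s * sqrt s)) at_bot" by (simp add: field_simps)
  qed auto
  also have "pi / (4 * s * sqrt s) - (- pi / (4 * s * sqrt s)) = pi / 2 * (1 / (s * sqrt s))"
    using assms by (simp add: field_simps)
  finally show ?thesis .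
qed

text \<open>Twice this density is the Laplacian of \<open>ln (|z|^2 + 1) / 2\<close>. Its total mass
  \<open>pi\<close> is what produces the factor \<open>2 * pi\<close> in the Laplacian of
  \<open>ln |z|\<close>. The inner integral is the preceding one at
  \<open>s = 1 + x^2\<close>.\<close>

lemma nn_integral_fubini_study: "(\<integral>\<^sup>+z. ennreal (1 / (1 + (cmod z)\<^sup>2)\<^sup>2) \<partial>lborel) = ennreal pi"
proof -
  have "(\<integral>\<^sup>+z. ennreal (1 / (1 + (cmod z)\<^sup>2)\<^sup>2) \<partial>lborel) =
     (\<integral>\<^sup>+(x, y). ennreal (1 / (1 + (cmod (Complex x y))\<^sup>2)\<^sup>2) \<partial>(lborel \<Otimes>\<^sub>M lborel))"
    by (subst lborel_complex, subst nn_integral_distr[OF measurable_Complex]) (auto simp: case_prod_unfold)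
  also have "\<dots> = (\<integral>\<^sup>+x. \<integral>\<^sup>+y. ennreal (1 / (1 + (cmod (Complex x y))\<^sup>2)\<^sup>2) \<partial>lborel \<partial>lborel)"
    by (subst lborel.nn_integral_fst[symmetric]) (auto simp: case_prod_beta cmod_def)
  also have "\<dots> = (\<integral>\<^sup>+x. \<integral>\<^sup>+y. ennreal (1 / ((1 + x\<^sup>2) + y\<^sup>2)\<^sup>2) \<partial>lborel \<partial>lborel)"
    by (simp add: cmod_power2 add.assoc)
  also have "\<dots> = (\<integral>\<^sup>+x. ennreal (pi / 2 * (1 / ((1 + x\<^sup>2) * sqrt (1 + x\<^sup>2)))) \<partial>lborel)"
    by (subst nn_integral_inverse_square_shift) (auto simp: add_pos_nonneg)
  also have "\<dots> = ennreal (pi / 2 - (- pi / 2))"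
  proof (rule nn_integral_FTC_UNIV[where F = "\<lambda>x. pi / 2 * (x / sqrt (1 + x\<^sup>2))"])
    fix x :: real
    have pos: "1 + x\<^sup>2 > 0" by (simp add: add_pos_nonneg)
    have "DERIV (\<lambda>x. x / sqrt (1 + x\<^sup>2)) x :> (1 * sqrt (1 + x\<^sup>2) - x * (2 * x * (inverse (sqrt (1 + x\<^sup>2)) / 2))) / (sqrt (1 + x\<^sup>2) * sqrt (1 + x\<^sup>2))"
      using pos by (auto intro!: derivative_eq_intros simp: mult_ac)
    also have "(1 * sqrt (1 + x\<^sup>2) - x * (2 * x * (inverse (sqrt (1 + x\<^sup>2)) / 2))) / (sqrt (1 + x\<^sup>2) * sqrt (1 + x\<^sup>2))
       = 1 / ((1 + x\<^sup>2) * sqrt (1 + x\<^sup>2))"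
    proof -
      have "sqrt (1 + x\<^sup>2) > 0" "sqrt (1 + x\<^sup>2) * sqrt (1 + x\<^sup>2) = 1 + x\<^sup>2" using pos by auto
      then show ?thesis by (auto simp: field_simps power2_eq_square)
    qed
    finally have "DERIV (\<lambda>x. x / sqrt (1 + x\<^sup>2)) x :> 1 / ((1 + x\<^sup>2) * sqrt (1 + x\<^sup>2))" .
    from DERIV_cmult[OF this, of "pi/2"]
    show "DERIV (\<lambda>x. pi / 2 * (x / sqrt (1 + x\<^sup>2))) x :> pi / 2 * (1 / ((1 + x\<^sup>2) * sqrt (1 + x\<^sup>2)))" .
  next
    have "1 + x\<^sup>2 \<noteq> (0::real)" for x
      using zero_le_power2[of x] by linarith
    then show "continuous_on UNIV (\<lambda>x::real. pi / 2 * (1 / ((1 + x\<^sup>2) * sqrt (1 + x\<^sup>2))))"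
      by (auto intro!: continuous_intros)
    have "((\<lambda>x::real. x / sqrt (1 + x\<^sup>2)) \<longlongrightarrow> 1) at_top" by real_asymp
    from tendsto_mult[OF tendsto_const this, of "pi/2"]
    show "((\<lambda>x::real. pi / 2 * (x / sqrt (1 + x\<^sup>2))) \<longlongrightarrow> pi / 2) at_top" by simp
    have "((\<lambda>x::real. x / sqrt (1 + x\<^sup>2)) \<longlongrightarrow> -1) at_bot" by real_asymp
    from tendsto_mult[OF tendsto_const this, of "pi/2"]
    show "((\<lambda>x::real. pi / 2 * (x / sqrt (1 + x\<^sup>2))) \<longlongrightarrow> - pi / 2) at_bot" by simp
  qed auto
  finally show ?thesis by simp
qed

lemma integral_fubini_study:
  "integrable lborel (\<lambda>z. 1 / (1 + (cmod z)\<^sup>2)\<^sup>2)"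
  "(LBINT z. 1 / (1 + (cmod z)\<^sup>2)\<^sup>2) = pi"
proof -
  show "integrable lborel (\<lambda>z. 1 / (1 + (cmod z)\<^sup>2)\<^sup>2)"
    using nn_integral_fubini_study by (intro integrableI_nonneg) auto
  show "(LBINT z. 1 / (1 + (cmod z)\<^sup>2)\<^sup>2) = pi"
    using nn_integral_fubini_study by (subst integral_eq_nn_integral) auto
qed

section \<open>Integrability of logarithmic singularities\<close>

lemma emeasure_cball_complex: "r \<ge> 0 \<Longrightarrow> emeasure lborel (cball (c::complex) r) = ennreal (pi * r\<^sup>2)"
  by (simp add: emeasure_cball unit_ball_vol_2)

text \<open>The logarithm is at most the number of discs of radius \<open>s / 2^j\<close> about
  \<open>a\<close> that contain \<open>z\<close>, because \<open>2 <= exp 1\<close>. The areas of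
  these discs form a geometric series with sum \<open>4/3 * pi * s^2\<close>.\<close>

lemma nn_integral_log_singularity:
  assumes "s > 0"
  shows "(\<integral>\<^sup>+z. ennreal (indicator (ball a s) z * ln (s / cmod (z - a))) \<partial>lborel) \<le> ennreal (6 * s\<^sup>2)"
proof -
  have "(\<integral>\<^sup>+z. ennreal (indicator (ball a s) z * ln (s / cmod (z - a))) \<partial>lborel)
      \<le> (\<integral>\<^sup>+z. (\<Sum>j. indicator (cball a (s / 2 ^ j)) z) \<partial>lborel)"
  proof (rule nn_integral_mono)
    fix z
    show "ennreal (indicator (ball a s) z * ln (s / cmod (z - a))) \<le> (\<Sum>j. indicator (cball a (s / 2 ^ j)) z)"
    proof (cases "z \<in> ball a s \<and> z \<noteq> a")
      case True
      define t where "t = ln (s / cmod (z - a))"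
      have d: "cmod (z - a) > 0" "cmod (z - a) < s" using True by (auto simp: dist_norm norm_minus_commute)
      have t0: "t \<ge> 0" using d by (simp add: t_def)
      define N where "N = nat \<lfloor>t\<rfloor>"
      have N: "real N \<le> t" "t \<le> real (Suc N)" using t0 by (auto simp: N_def) linarith
      have "z \<in> cball a (s / 2 ^ j)" if "j \<le> N" for j
      proof -
        have "2 ^ j \<le> exp (1::real) ^ j" using exp_ge_add_one_self[of 1] by (intro power_mono) auto
        also have "\<dots> = exp (real j)" by (simp add: exp_of_nat_mult[symmetric])
        also have "\<dots> \<le> exp t" using that N by simp
        also have "\<dots> = s / cmod (z - a)" using d assms by (simp add: t_def)
        finally show ?thesis using d by (simp add: dist_norm norm_minus_commute field_simps)
      qed
      then have "ennreal (real (Suc N)) = (\<Sum>j\<in>{..N}. indicator (cball a (s / 2 ^ j)) z)"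
        by (simp add: ennreal_of_nat_eq_real_of_nat)
      also have "\<dots> \<le> (\<Sum>j. indicator (cball a (s / 2 ^ j)) z)"
        by (intro sum_le_suminf) auto
      finally show ?thesis using True N by (auto simp: t_def[symmetric] intro: order_trans ennreal_leI)
    qed (auto simp: indicator_def)
  qed
  also have "\<dots> = (\<Sum>j. emeasure lborel (cball a (s / 2 ^ j)))"
    by (subst nn_integral_suminf) (auto intro!: borel_measurable_indicator)
  also have "\<dots> = (\<Sum>j. ennreal (pi * s\<^sup>2 * (1/4) ^ j))"
    using assms by (intro suminf_cong, subst emeasure_cball_complex)
      (auto simp: power_divide power_mult[symmetric] mult.commute[of _ 2] power_mult)
  also have "\<dots> = ennreal (\<Sum>j. pi * s\<^sup>2 * (1/4) ^ j)"
    by (intro suminf_ennreal2) (auto intro!: summable_mult summable_geometric)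
  also have "(\<Sum>j. pi * s\<^sup>2 * (1/4) ^ j) = pi * s\<^sup>2 * (4 / 3)"
    by (subst suminf_mult) (auto simp: suminf_geometric intro!: summable_geometric)
  also have "ennreal (pi * s\<^sup>2 * (4 / 3)) \<le> ennreal (6 * s\<^sup>2)"
  proof (rule ennreal_leI)
    have "(pi * (4 / 3)) * s\<^sup>2 \<le> 6 * s\<^sup>2" using pi_less_4 by (intro mult_right_mono) auto
    then show "pi * s\<^sup>2 * (4 / 3) \<le> 6 * s\<^sup>2" by (simp only: mult_ac)
  qed
  finally show ?thesis .
qed

lemma
  assumes "s > 0"
  shows integrable_log_singularity: "integrable lborel (\<lambda>z. indicator (ball a s) z * ln (s / cmod (z - a)))" (is ?A)
    and integral_log_singularity: "(LBINT z. indicator (ball a s) z * ln (s / cmod (z - a))) \<le> 6 * s\<^sup>2" (is ?B)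
proof -
  let ?f = "\<lambda>z. indicator (ball a s) z * ln (s / cmod (z - a))"
  have nn: "?f z \<ge> 0" for z
    by (cases "z = a") (auto simp: indicator_def dist_norm norm_minus_commute)
  note b = nn_integral_log_singularity[OF assms, of a]
  have [measurable]: "ball a s \<in> sets borel" by simp
  show ?A
  proof (rule integrableI_nonneg)
    show "(\<integral>\<^sup>+z. ennreal (?f z) \<partial>lborel) < \<infinity>"
      using b by (rule le_less_trans) simp
  qed (use nn in auto)
  have "ennreal (integral\<^sup>L lborel ?f) \<le> ennreal (6 * s\<^sup>2)"
    using b nn_integral_eq_integral[OF \<open>?A\<close>] nn by simp
  then show ?B by (subst (asm) ennreal_le_iff) auto
qed

text \<open>Pointwise \<open>ln (\<rho> / |z - a|)\<close> is at most \<open>ln (\<rho> / s)\<close>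
  plus the positive part of \<open>ln (s / |z - a|)\<close>. The first summand sees
  \<open>\<psi>\<close> only through its integral, the second only through its maximum
  \<open>D\<close>.\<close>

lemma log_potential:
  fixes \<psi> :: "complex \<Rightarrow> real"
  assumes \<psi>: "integrable lborel \<psi>" "\<And>z. 0 \<le> \<psi> z" "\<And>z. \<psi> z \<le> D"
    and supp: "\<And>z. \<psi> z \<noteq> 0 \<Longrightarrow> cmod (z - a) \<le> \<rho>" and s: "0 < s" "s \<le> \<rho>"
  shows "integrable lborel (\<lambda>z. ln (\<rho> / cmod (z - a)) * \<psi> z)"
    and "(LBINT z. ln (\<rho> / cmod (z - a)) * \<psi> z) \<le> ln (\<rho> / s) * integral\<^sup>L lborel \<psi> + 6 * D * s\<^sup>2"
proof -
  let ?f = "\<lambda>z. ln (\<rho> / cmod (z - a)) * \<psi> z"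
  let ?g = "\<lambda>z. ln (\<rho> / s) * \<psi> z + D * (indicator (ball a s) z * ln (s / cmod (z - a)))"
  have [measurable]: "\<psi> \<in> borel_measurable borel" using \<psi>(1) by auto
  have D: "D \<ge> 0" using \<psi>(2,3) order_trans by blast
  have nn: "0 \<le> indicator (ball a s) z * ln (s / cmod (z - a))" for z
    by (cases "z = a") (auto simp: indicator_def dist_norm norm_minus_commute)
  have ig: "integrable lborel ?g"
    using \<psi>(1) integrable_log_singularity[OF s(1)] by auto
  have bd: "0 \<le> ?f z \<and> ?f z \<le> ?g z" for z
  proof (cases "\<psi> z = 0 \<or> z = a")
    case True
    then show ?thesis using s \<psi>(2)[of z] mult_nonneg_nonneg[OF D nn[of z]] by auto
  next
    case False
    then have d: "cmod (z - a) > 0" "cmod (z - a) \<le> \<rho>" using supp by auto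
    have 0: "ln (\<rho> / cmod (z - a)) \<ge> 0" using d by simp
    have "?f z \<le> ?g z"
    proof (cases "cmod (z - a) < s")
      case True
      have "ln (\<rho> / cmod (z - a)) = ln (\<rho> / s) + ln (s / cmod (z - a))"
        using d s by (simp add: ln_div)
      moreover have "ln (s / cmod (z - a)) * \<psi> z \<le> ln (s / cmod (z - a)) * D"
        using True d \<psi> by (intro mult_left_mono) auto
      ultimately show ?thesis
        using 0 \<psi>(2)[of z] True by (auto simp: algebra_simps dist_norm norm_minus_commute)
    next
      case False
      then have "ln (\<rho> / cmod (z - a)) \<le> ln (\<rho> / s)"
        using d s by (simp add: frac_le)
      then show ?thesis
        using 0 \<psi>(2)[of z] False by (auto simp: dist_norm norm_minus_commute intro: mult_right_mono)
    qed
    then show ?thesis using 0 \<psi>(2)[of z] by simp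
  qed
  show int_f: "integrable lborel ?f"
    by (rule Bochner_Integration.integrable_bound[OF ig]) (use bd in \<open>auto simp: abs_of_nonneg intro!: order_trans[OF _ abs_ge_self]\<close>)
  have "integral\<^sup>L lborel ?f \<le> integral\<^sup>L lborel ?g"
    using bd by (intro integral_mono int_f ig) auto
  also have "\<dots> = ln (\<rho> / s) * integral\<^sup>L lborel \<psi> + D * (LBINT z. indicator (ball a s) z * ln (s / cmod (z - a)))"
    using \<psi>(1) integrable_log_singularity[OF s(1)] by simp
  also have "\<dots> \<le> ln (\<rho> / s) * integral\<^sup>L lborel \<psi> + D * (6 * s\<^sup>2)"
    using D integral_log_singularity[OF s(1)] by (intro add_left_mono mult_left_mono) auto
  finally show "integral\<^sup>L lborel ?f \<le> ln (\<rho> / s) * integral\<^sup>L lborel \<psi> + 6 * D * s\<^sup>2" by simp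
qed

section \<open>The logarithm as fundamental solution of the Laplacian\<close>

lemma lborel_integral_affine_complex:
  fixes f :: "complex \<Rightarrow> complex"
  assumes [measurable]: "f \<in> borel_measurable borel" and "c > 0"
  shows "integral\<^sup>L lborel f = c\<^sup>2 *\<^sub>R (LBINT w. f (t + c *\<^sub>R w))"
proof -
  have "integral\<^sup>L lborel f = integral\<^sup>L (density (distr lborel borel (\<lambda>x. t + c *\<^sub>R x)) (\<lambda>_. \<bar>c\<bar>^DIM(complex))) f"
    using assms by (subst lborel_affine[of c t]) auto
  also have "\<dots> = integral\<^sup>L (distr lborel borel (\<lambda>x. t + c *\<^sub>R x)) (\<lambda>x. c\<^sup>2 *\<^sub>R f x)"
    using assms(2) by (subst integral_density[symmetric]) auto
  also have "\<dots> = (LBINT w. c\<^sup>2 *\<^sub>R f (t + c *\<^sub>R w))"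
    by (subst integral_distr) auto
  finally show ?thesis by simp
qed

text \<open>Adding \<open>e^2\<close> under the logarithm removes the singularity at
  \<open>a\<close>, so Green's identity applies on the whole plane. The second derivatives for
  \<open>v = 1\<close> and \<open>v = \<i>\<close> add up to a rescaled Fubini-Study
  density.\<close>

lemma dir_C2_log_regularised:
  assumes "e > 0" and v: "norm v = 1"
  shows "dir_C2 UNIV v (\<lambda>z. ln ((cmod (z - a))\<^sup>2 + e\<^sup>2) / 2)
     (\<lambda>z. 1 / ((cmod (z - a))\<^sup>2 + e\<^sup>2) - 2 * ((z - a) \<bullet> v)\<^sup>2 / ((cmod (z - a))\<^sup>2 + e\<^sup>2)\<^sup>2)"
  unfolding dir_C2_def
proof (intro conjI exI[of _ "\<lambda>z. ((z - a) \<bullet> v) / ((cmod (z - a))\<^sup>2 + e\<^sup>2)"] ballI)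
  let ?D = "\<lambda>z. (cmod (z - a))\<^sup>2 + e\<^sup>2"
  have pos: "?D z > 0" for z using assms by (simp add: add_nonneg_pos)
  then have nz: "?D z \<noteq> 0" for z by (metis less_irrefl)
  show "continuous_on UNIV (\<lambda>z. ln (?D z) / 2)"
    "continuous_on UNIV (\<lambda>z. ((z - a) \<bullet> v) / (?D z))"
    "continuous_on UNIV (\<lambda>z. 1 / (?D z) - 2 * ((z - a) \<bullet> v)\<^sup>2 / (?D z)\<^sup>2)"
    using nz by (auto intro!: continuous_intros)
  fix z
  have vv: "v \<bullet> v = 1" using v by (simp add: dot_square_norm)
  have D: "((\<lambda>t. ?D (z + t *\<^sub>R v)) has_real_derivative 2 * ((z - a) \<bullet> v)) (at 0)"
  proof -
    have "(\<lambda>t. ?D (z + t *\<^sub>R v)) = (\<lambda>t. (z - a) \<bullet> (z - a) + 2 * t * ((z - a) \<bullet> v) + t\<^sup>2 + e\<^sup>2)"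
    proof
      fix t
      have "z + t *\<^sub>R v - a = (z - a) + t *\<^sub>R v" by simp
      then show "?D (z + t *\<^sub>R v) = (z - a) \<bullet> (z - a) + 2 * t * ((z - a) \<bullet> v) + t\<^sup>2 + e\<^sup>2"
        by (simp only: power2_norm_eq_inner inner_add_left inner_add_right inner_scaleR_left inner_scaleR_right vv)
           (simp add: inner_commute power2_eq_square algebra_simps)
    qed
    then show ?thesis by (auto intro!: derivative_eq_intros)
  qed
  have N: "((\<lambda>t. (z + t *\<^sub>R v - a) \<bullet> v) has_real_derivative 1) (at 0)"
  proof -
    have "(\<lambda>t. (z + t *\<^sub>R v - a) \<bullet> v) = (\<lambda>t. (z - a) \<bullet> v + t)"
      by (simp add: inner_diff_left inner_add_left vv algebra_simps)
    then show ?thesis by (auto intro!: derivative_eq_intros)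
  qed
  have "?D (z + 0 *\<^sub>R v) > 0" using pos[of z] by simp
  note d = DERIV_cdivide[OF DERIV_chain2[OF DERIV_ln[OF this] D], of 2]
  have e: "inverse X * (2 * q) / 2 = q / X" for X q :: real by (simp add: field_simps)
  show "((\<lambda>t. ln (?D (z + t *\<^sub>R v)) / 2) has_real_derivative (z - a) \<bullet> v / (?D z)) (at 0)"
    using d unfolding scaleR_zero_left add_0_right e .
  have "?D (z + 0 *\<^sub>R v) \<noteq> 0" using nz[of z] by simp
  note d = DERIV_divide[OF N D this]
  have e: "(1 * X - y * (2 * y)) / (X * X) = 1 / X - 2 * y\<^sup>2 / X\<^sup>2" if "X \<noteq> 0" for X y :: real
    using that by (simp add: diff_divide_distrib power2_eq_square)
  show "((\<lambda>t. ((z + t *\<^sub>R v - a) \<bullet> v) / (?D (z + t *\<^sub>R v))) has_real_derivative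
    1 / (?D z) - 2 * ((z - a) \<bullet> v)\<^sup>2 / (?D z)\<^sup>2) (at 0)"
    using d unfolding scaleR_zero_left add_0_right e[OF nz] .
qed

text \<open>The substitution \<open>z = a + e w\<close> turns the concentrating density into a fixed
  one of mass \<open>2 * pi\<close> and moves the dependence on \<open>e\<close> into the argument
  of \<open>\<phi>\<close>, where continuity and boundedness give the limit.\<close>

lemma tendsto_fubini_study_smoothing:
  fixes \<phi> :: "complex \<Rightarrow> complex"
  assumes "continuous_on UNIV \<phi>" "\<And>z. norm (\<phi> z) \<le> B" "e \<longlonglongrightarrow> 0" "\<And>n. e n > 0"
  shows "(\<lambda>n. (LBINT z. (2 * (e n)\<^sup>2 / ((cmod (z - a))\<^sup>2 + (e n)\<^sup>2)\<^sup>2) *\<^sub>R \<phi> z)) \<longlonglongrightarrow> 2 * pi * \<phi> a"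
proof -
  have [measurable]: "\<phi> \<in> borel_measurable borel"
    using assms(1) by (rule borel_measurable_continuous_onI)
  have eq: "(LBINT z. (2 * (e n)\<^sup>2 / ((cmod (z - a))\<^sup>2 + (e n)\<^sup>2)\<^sup>2) *\<^sub>R \<phi> z) =
     (LBINT w. (2 / (1 + (cmod w)\<^sup>2)\<^sup>2) *\<^sub>R \<phi> (a + e n *\<^sub>R w))" for n
  proof -
    have "(e n)\<^sup>2 * (2 * (e n)\<^sup>2 / ((e n * cmod w)\<^sup>2 + (e n)\<^sup>2)\<^sup>2) = 2 / (1 + (cmod w)\<^sup>2)\<^sup>2" for w
    proof -
      have "(e n * cmod w)\<^sup>2 + (e n)\<^sup>2 = (e n)\<^sup>2 * (1 + (cmod w)\<^sup>2)" by (simp add: power_mult_distrib algebra_simps)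
      then show ?thesis using assms(4)[of n] by (simp add: power_mult_distrib power2_eq_square)
    qed
    then show ?thesis
      using assms(4)[of n]
      by (subst lborel_integral_affine_complex[of _ "e n" a])
         (auto simp flip: integral_scaleR_right simp: abs_mult)
  qed
  have "(\<lambda>n. (LBINT w. (2 / (1 + (cmod w)\<^sup>2)\<^sup>2) *\<^sub>R \<phi> (a + e n *\<^sub>R w))) \<longlonglongrightarrow>
     (LBINT w. (2 / (1 + (cmod w)\<^sup>2)\<^sup>2) *\<^sub>R \<phi> a)"
  proof (rule integral_dominated_convergence[where w = "\<lambda>w. (2 * B) * (1 / (1 + (cmod w)\<^sup>2)\<^sup>2)"])
    show "integrable lborel (\<lambda>w. (2 * B) * (1 / (1 + (cmod w)\<^sup>2)\<^sup>2))"
      by (intro integrable_mult_right integral_fubini_study)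
    show "AE w in lborel. (\<lambda>n. (2 / (1 + (cmod w)\<^sup>2)\<^sup>2) *\<^sub>R \<phi> (a + e n *\<^sub>R w)) \<longlonglongrightarrow> (2 / (1 + (cmod w)\<^sup>2)\<^sup>2) *\<^sub>R \<phi> a"
    proof (intro AE_I2 tendsto_scaleR tendsto_const)
      fix w
      have "(\<lambda>n. a + e n *\<^sub>R w) \<longlonglongrightarrow> a" using assms(3) by (auto intro!: tendsto_eq_intros)
      then show "(\<lambda>n. \<phi> (a + e n *\<^sub>R w)) \<longlonglongrightarrow> \<phi> a"
        using assms(1) continuous_on_tendsto_compose[of UNIV \<phi>] by auto
    qed
    fix n
    show "AE w in lborel. norm ((2 / (1 + (cmod w)\<^sup>2)\<^sup>2) *\<^sub>R \<phi> (a + e n *\<^sub>R w)) \<le> (2 * B) * (1 / (1 + (cmod w)\<^sup>2)\<^sup>2)"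
      using assms(2) by (intro AE_I2) (simp add: divide_right_mono)
  qed measurable
  also have "(LBINT w. (2 / (1 + (cmod w)\<^sup>2)\<^sup>2) *\<^sub>R \<phi> a) = 2 * pi * \<phi> a"
  proof -
    have "(LBINT w. (2 / (1 + (cmod w)\<^sup>2)\<^sup>2) *\<^sub>R \<phi> a) = (LBINT w. (1 / (1 + (cmod w)\<^sup>2)\<^sup>2) *\<^sub>R (2 * \<phi> a))"
      by (simp add: scaleR_conv_of_real)
    also have "\<dots> = pi *\<^sub>R (2 * \<phi> a)"
      using integral_fubini_study by (subst integral_scaleR_left) auto
    finally show ?thesis by (simp add: scaleR_conv_of_real)
  qed
  finally show ?thesis by (simp only: eq)
qed

lemma compact_support_bounded:
  fixes F :: "complex \<Rightarrow> complex"
  assumes "continuous_on UNIV F" "compact K" "\<And>z. z \<notin> K \<Longrightarrow> F z = 0"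
  shows "\<exists>D\<ge>0. \<forall>z. norm (F z) \<le> D"
proof -
  have "compact (F ` K)"
    using assms by (intro compact_continuous_image) (auto intro: continuous_on_subset)
  then obtain B where B: "\<And>z. z \<in> K \<Longrightarrow> norm (F z) \<le> B"
    by (metis bounded_iff compact_imp_bounded image_eqI)
  have "norm (F z) \<le> max B 0" for z
    using B[of z] assms(3)[of z] by (cases "z \<in> K") auto
  then show ?thesis by (intro exI[of _ "max B 0"]) auto
qed

text \<open>The kernel is singular at \<open>a\<close>, so Green's identity is applied to its
  regularisation. One side then converges by dominated convergence, the other by concentration at
  \<open>a\<close>.\<close>

lemma
  fixes \<phi> L :: "complex \<Rightarrow> complex"
  assumes t: "C2_test K \<phi> L"
  shows integrable_log_laplacian: "integrable lborel (\<lambda>z. ln (cmod (z - a)) *\<^sub>R L z)" (is ?A)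
    and integral_log_laplacian: "(LBINT z. ln (cmod (z - a)) *\<^sub>R L z) = 2 * pi * \<phi> a" (is ?B)
proof -
  note T = C2_testD[OF t]
  have [measurable]: "\<phi> \<in> borel_measurable borel" "L \<in> borel_measurable borel"
    using T by (auto intro: borel_measurable_continuous_onI)
  obtain D where D: "D \<ge> 0" "\<And>z. norm (L z) \<le> D"
    using compact_support_bounded[OF T(3,1,5)] by metis
  obtain B where B: "\<And>z. norm (\<phi> z) \<le> B"
    using compact_support_bounded[OF T(2,1,4)] by metis
  define e where "e = (\<lambda>n. 1 / real (Suc n))"
  have e: "e n > 0" "e n \<le> 1" for n by (auto simp: e_def)
  have e0: "e \<longlonglongrightarrow> 0" unfolding e_def using LIMSEQ_inverse_real_of_nat by (simp add: divide_inverse)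
  define u where "u = (\<lambda>n z. ln ((cmod (z - a))\<^sup>2 + (e n)\<^sup>2) / 2)"
  \<comment> \<open>This dominates all regularised logarithms at once. They lie between
    \<open>ln d\<close> and \<open>d^2 / 2\<close> with \<open>d = |z - a|\<close>, as
    \<open>e n <= 1\<close>; for \<open>d < 1\<close> the logarithm itself is integrable, and for
    \<open>d >= 1\<close> it is at most \<open>d\<close>.\<close>
  define w where "w = (\<lambda>z. D * (indicator (ball a 1) z * ln (1 / cmod (z - a))) + (cmod (z - a) + (cmod (z - a))\<^sup>2 / 2) * norm (L z))"
  have [measurable]: "u n \<in> borel_measurable borel" for n unfolding u_def by measurable
  have iw: "integrable lborel w"
    unfolding w_def
  proof (intro Bochner_Integration.integrable_add integrable_mult_right integrable_log_singularity)
    show "integrable lborel (\<lambda>z. (cmod (z - a) + (cmod (z - a))\<^sup>2 / 2) * norm (L z))"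
      by (rule integrable_continuous_compact_support[OF _ T(1)]) (auto intro!: continuous_intros T(3) simp: T(5))
  qed simp
  have b: "norm (u n z *\<^sub>R L z) \<le> w z \<and> norm (ln (cmod (z - a)) *\<^sub>R L z) \<le> w z" if "z \<noteq> a" for z n
  proof -
    define d where "d = cmod (z - a)"
    have d: "d > 0" using that by (simp add: d_def)
    have l: "\<bar>ln d\<bar> * norm (L z) \<le> D * (indicator (ball a 1) z * ln (1 / d)) + d * norm (L z)"
    proof (cases "d < 1")
      case True
      have "\<bar>ln d\<bar> = ln (1 / d)" using d True by (simp add: ln_div abs_if)
      moreover have "ln (1 / d) * norm (L z) \<le> ln (1 / d) * D"
        using d True D by (intro mult_left_mono) auto
      ultimately show ?thesis using True d
        by (simp add: d_def dist_norm norm_minus_commute mult.commute add_increasing2)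
    next
      case False
      then have "\<bar>ln d\<bar> \<le> d" using ln_le_minus_one[of d] d by simp
      then show ?thesis using False by (auto simp: d_def dist_norm norm_minus_commute intro: mult_right_mono)
    qed
    have "ln d = ln (d\<^sup>2) / 2" using d by (simp add: ln_realpow)
    also have "\<dots> \<le> u n z" using d e[of n] by (simp add: u_def d_def[symmetric] ln_mono add_pos_nonneg)
    finally have 1: "ln d \<le> u n z" .
    have "u n z \<le> ln (d\<^sup>2 + 1) / 2"
      using d e[of n] by (simp add: u_def d_def[symmetric] add_nonneg_pos power_le_one)
    also have "\<dots> \<le> d\<^sup>2 / 2" using ln_add_one_self_le_self[of "d\<^sup>2"] by (simp add: add.commute)
    finally have 2: "u n z \<le> d\<^sup>2 / 2" .
    have "\<bar>u n z\<bar> \<le> \<bar>ln d\<bar> + d\<^sup>2 / 2" using 1 2 zero_le_power2[of d] by linarith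
    then have "\<bar>u n z\<bar> * norm (L z) \<le> (\<bar>ln d\<bar> + d\<^sup>2 / 2) * norm (L z)" by (rule mult_right_mono) simp
    moreover have "0 \<le> d\<^sup>2 / 2 * norm (L z)" by simp
    moreover have "w z = D * (indicator (ball a 1) z * ln (1 / d)) + d * norm (L z) + d\<^sup>2 / 2 * norm (L z)"
      by (simp add: w_def d_def[symmetric] distrib_right)
    ultimately show ?thesis
      using l unfolding norm_scaleR d_def[symmetric] distrib_right by linarith
  qed
  have ae: "AE z in lborel. z \<noteq> a" by (rule AE_lborel_singleton)
  show ?A
    by (rule Bochner_Integration.integrable_bound[OF iw])
       (use ae b[where n = 0] in \<open>auto elim!: eventually_mono intro: order_trans[OF _ abs_ge_self]\<close>)
  have "(\<lambda>n. (LBINT z. u n z *\<^sub>R L z)) \<longlonglongrightarrow> (LBINT z. ln (cmod (z - a)) *\<^sub>R L z)"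
  proof (rule integral_dominated_convergence[OF _ _ iw])
    show "AE z in lborel. (\<lambda>n. u n z *\<^sub>R L z) \<longlonglongrightarrow> ln (cmod (z - a)) *\<^sub>R L z"
      using ae
    proof (rule eventually_mono)
      fix z assume za: "z \<noteq> a"
      have "(\<lambda>n. u n z) \<longlonglongrightarrow> ln ((cmod (z - a))\<^sup>2 + 0\<^sup>2) / 2"
        unfolding u_def using za by (intro tendsto_intros e0) auto
      also have "ln ((cmod (z - a))\<^sup>2 + 0\<^sup>2) / 2 = ln (cmod (z - a))"
        using za by (simp add: ln_realpow)
      finally show "(\<lambda>n. u n z *\<^sub>R L z) \<longlonglongrightarrow> ln (cmod (z - a)) *\<^sub>R L z"
        by (intro tendsto_intros)
    qed
    fix n show "AE z in lborel. norm (u n z *\<^sub>R L z) \<le> w z"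
      using ae by (rule eventually_mono) (use b in blast)
  qed measurable
  moreover have "(LBINT z. u n z *\<^sub>R L z) =
     (LBINT z. (2 * (e n)\<^sup>2 / ((cmod (z - a))\<^sup>2 + (e n)\<^sup>2)\<^sup>2) *\<^sub>R \<phi> z)" for n
    unfolding u_def
  proof (rule green(1)[OF open_UNIV subset_UNIV t dir_C2_log_regularised dir_C2_log_regularised])
    fix z
    have X: "(cmod (z - a))\<^sup>2 + (e n)\<^sup>2 > 0" using e[of n] by (simp add: add_nonneg_pos)
    have "((z - a) \<bullet> 1)\<^sup>2 + ((z - a) \<bullet> \<i>)\<^sup>2 = (cmod (z - a))\<^sup>2"
      by (simp add: inner_complex_def cmod_power2)
    moreover have "1 / X - 2 * p / X\<^sup>2 + (1 / X - 2 * q / X\<^sup>2) = 2 * (X - (p + q)) / X\<^sup>2" if "X > 0" for p q X :: real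
      using that by (simp add: field_simps power2_eq_square)
    ultimately show "1 / ((cmod (z - a))\<^sup>2 + (e n)\<^sup>2) - 2 * ((z - a) \<bullet> 1)\<^sup>2 / ((cmod (z - a))\<^sup>2 + (e n)\<^sup>2)\<^sup>2 +
       (1 / ((cmod (z - a))\<^sup>2 + (e n)\<^sup>2) - 2 * ((z - a) \<bullet> \<i>)\<^sup>2 / ((cmod (z - a))\<^sup>2 + (e n)\<^sup>2)\<^sup>2) =
       2 * (e n)\<^sup>2 / ((cmod (z - a))\<^sup>2 + (e n)\<^sup>2)\<^sup>2"
      using X by simp
  qed (use e in auto)
  ultimately show ?B
    using tendsto_fubini_study_smoothing[OF T(2) B e0 e(1), of a] LIMSEQ_unique by simp
qed

section \<open>Factorization and Harnack estimates\<close>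

text \<open>One point is divided out at a time; the value \<open>f w \<noteq> 0\<close> excludes
  infinite order. Points of \<open>Z\<close> at which the function does not vanish are allowed and
  receive the exponent 0.\<close>

lemma holomorphic_factor_finite:
  assumes "finite Z" "f holomorphic_on U" "open U" "connected U" "Z \<subseteq> U" "w \<in> U" "f w \<noteq> 0"
  shows "\<exists>H n. H holomorphic_on U \<and> (\<forall>a\<in>Z. H a \<noteq> 0) \<and>
     (\<forall>z\<in>U. f z = H z * (\<Prod>a\<in>Z. (z - a) ^ (n a :: nat)))"
  using assms
proof (induction Z rule: finite_induct)
  case empty
  then show ?case by (auto intro!: exI[of _ f])
next
  case (insert a Z)
  then have "\<exists>H n. H holomorphic_on U \<and> (\<forall>a\<in>Z. H a \<noteq> 0) \<and>
     (\<forall>z\<in>U. f z = H z * (\<Prod>a\<in>Z. (z - a) ^ (n a :: nat)))"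
    by simp
  then obtain H n where H: "H holomorphic_on U" "\<And>b. b \<in> Z \<Longrightarrow> H b \<noteq> 0"
    "\<And>z. z \<in> U \<Longrightarrow> f z = H z * (\<Prod>b\<in>Z. (z - b) ^ (n b :: nat))"
    by blast
  have aU: "a \<in> U" using insert by auto
  have "\<exists>g r m. 0 < r \<and> ball a r \<subseteq> U \<and> g holomorphic_on ball a r \<and>
     (\<forall>w\<in>ball a r. H w = (w - a) ^ m * g w \<and> g w \<noteq> 0)"
  proof (cases "H a = 0")
    case True
    have "\<not> H constant_on U"
    proof
      assume "H constant_on U"
      then have "H w = 0" using True aU insert.prems by (auto simp: constant_on_def)
      then show False using H(3)[of w] insert.prems by auto
    qed
    from holomorphic_factor_zero_nonconstant[OF H(1) insert.prems(2,3) aU True this]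
    show ?thesis by metis
  next
    case False
    have "isCont H a" using H(1) aU insert.prems(2)
      by (meson continuous_on_eq_continuous_at holomorphic_on_imp_continuous_on)
    then have "\<forall>\<^sub>F z in at a. H z \<noteq> 0"
      using False by (intro tendsto_imp_eventually_ne) (auto simp: isCont_def)
    then obtain d where d: "d > 0" "\<And>z. z \<noteq> a \<Longrightarrow> dist z a < d \<Longrightarrow> H z \<noteq> 0"
      by (auto simp: eventually_at)
    obtain r where r: "r > 0" "ball a r \<subseteq> U" using aU insert.prems(2) openE by blast
    have "ball a (min d r) \<subseteq> U" using r by auto
    moreover have "H z \<noteq> 0" if "z \<in> ball a (min d r)" for z
      using that d(2)[of z] False by (cases "z = a") (auto simp: dist_commute)
    ultimately show ?thesis
      using d r H(1) holomorphic_on_subset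
      by (intro exI[of _ H] exI[of _ "min d r"] exI[of _ 0]) auto
  qed
  then obtain g r m where g: "0 < r" "ball a r \<subseteq> U" "g holomorphic_on ball a r"
     "\<And>w. w \<in> ball a r \<Longrightarrow> H w = (w - a) ^ m * g w" "\<And>w. w \<in> ball a r \<Longrightarrow> g w \<noteq> 0"
    by blast
  define H' where "H' = (\<lambda>z. if z = a then g a else H z / (z - a) ^ m)"
  have "H' holomorphic_on ball a r"
    using g(3) by (rule holomorphic_transform) (use g in \<open>auto simp: H'_def\<close>)
  moreover have "H' holomorphic_on (U - {a})"
  proof (rule holomorphic_transform)
    show "(\<lambda>z. H z / (z - a) ^ m) holomorphic_on (U - {a})"
      using H(1) by (auto intro!: holomorphic_intros intro: holomorphic_on_subset)
  qed (auto simp: H'_def)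
  ultimately have "H' holomorphic_on (ball a r \<union> (U - {a}))"
    using insert.prems by (intro holomorphic_on_Un) (auto intro: open_Diff)
  moreover have "ball a r \<union> (U - {a}) = U" using g aU by auto
  ultimately have H': "H' holomorphic_on U" by simp
  have "\<forall>b\<in>insert a Z. H' b \<noteq> 0"
    using H(2) g(1,5) by (auto simp: H'_def)
  moreover have "f z = H' z * (\<Prod>b\<in>insert a Z. (z - b) ^ ((n(a := m)) b))" if "z \<in> U" for z
  proof -
    have "(\<Prod>b\<in>Z. (z - b) ^ ((n(a := m)) b)) = (\<Prod>b\<in>Z. (z - b) ^ n b)"
      using insert.hyps by (intro prod.cong) auto
    then have "(\<Prod>b\<in>insert a Z. (z - b) ^ ((n(a := m)) b)) = (z - a) ^ m * (\<Prod>b\<in>Z. (z - b) ^ n b)"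
      using insert.hyps by simp
    moreover have "H z = H' z * (z - a) ^ m"
      using g(1) g(4)[of a] by (auto simp: H'_def)
    ultimately show ?thesis using H(3)[OF that] by simp
  qed
  ultimately show ?case using H' by blast
qed

text \<open>The exponents are identified with \<open>zorder\<close> so that the weights in
  Jensen-type formulas are the multiplicities used by \<open>zero_sum\<close>.\<close>

lemma holomorphic_factor_zorder:
  assumes "finite Z" "f holomorphic_on U" "open U" "connected U" "Z \<subseteq> U" "w \<in> U" "f w \<noteq> 0"
  obtains H where "H holomorphic_on U" "\<And>a. a \<in> Z \<Longrightarrow> H a \<noteq> 0"
    "\<And>z. z \<in> U \<Longrightarrow> f z = H z * (\<Prod>a\<in>Z. (z - a) ^ nat (zorder f a))"
    "\<And>a. a \<in> Z \<Longrightarrow> zorder f a \<ge> 0"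
proof -
  from holomorphic_factor_finite[OF assms] obtain H n where H: "H holomorphic_on U"
    "\<And>a. a \<in> Z \<Longrightarrow> H a \<noteq> 0" "\<And>z. z \<in> U \<Longrightarrow> f z = H z * (\<Prod>a\<in>Z. (z - a) ^ (n a :: nat))"
    by blast
  have z: "zorder f a = int (n a)" if a: "a \<in> Z" for a
  proof (rule zorder_eqI)
    let ?g = "\<lambda>z. H z * (\<Prod>b\<in>Z - {a}. (z - b) ^ n b)"
    show "?g holomorphic_on U" by (intro holomorphic_intros H)
    show "?g a \<noteq> 0" using H(2)[OF a] assms(1) by (auto simp: prod_zero_iff)
    fix z assume "z \<in> U"
    then show "f z = ?g z * (z - a) powi int (n a)"
      using H(3) assms(1) a by (simp add: prod.remove[of Z a] mult_ac)
  qed (use assms a in auto)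
  show ?thesis
    using that[of H] H z by simp
qed

lemma finite_zeros_ball:
  fixes f :: "complex \<Rightarrow> complex"
  assumes f: "f holomorphic_on ball c R" and r: "r < R" and nz: "w \<in> ball c R" "f w \<noteq> 0"
  shows "finite {z \<in> ball c r. f z = 0}"
proof (cases "f constant_on ball c R")
  case True
  then have "{z \<in> ball c r. f z = 0} = {}" using nz r by (force simp: constant_on_def)
  then show ?thesis by (simp only: finite.emptyI)
next
  case False
  have "finite {z \<in> cball c r. f z = 0}"
    by (rule holomorphic_compact_finite_zeros[OF f _ _ _ _ False]) (use r in auto)
  then show ?thesis by (rule rev_finite_subset) auto
qed

section \<open>Harnack's inequality and Blaschke factors\<close>

lemma harnack_disc:
  assumes h: "h holomorphic_on ball 0 1" and pos: "\<And>z. z \<in> ball 0 1 \<Longrightarrow> Re (h z) > 0"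
    and z: "cmod z \<le> \<rho>" and \<rho>: "\<rho> < 1"
  shows "(1 - \<rho>) * Re (h z) \<le> (1 + \<rho>) * Re (h 0)" "(1 - \<rho>) * Re (h 0) \<le> (1 + \<rho>) * Re (h z)"
proof -
  let ?B = "h 0"
  have B: "Re ?B > 0" using pos[of 0] by simp
  have nz: "h w + cnj ?B \<noteq> 0" if "w \<in> ball 0 1" for w
  proof
    assume "h w + cnj ?B = 0"
    then have "Re (h w + cnj ?B) = 0" by simp
    then show False using pos[OF that] B by simp
  qed
  \<comment> \<open>This Moebius map sends the right half-plane to the unit disc and
    \<open>h 0\<close> to 0, so Schwarz's lemma applies to its composition with
    \<open>h\<close>.\<close>
  have lt: "cmod ((h w - ?B) / (h w + cnj ?B)) < 1" if "cmod w < 1" for w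
  proof -
    have w: "w \<in> ball 0 1" using that by simp
    have "(cmod (h w - ?B))\<^sup>2 = (cmod (h w + cnj ?B))\<^sup>2 - 4 * Re (h w) * Re ?B"
      by (simp only: cmod_power2) (simp add: power2_eq_square algebra_simps)
    also have "\<dots> < (cmod (h w + cnj ?B))\<^sup>2" using pos[OF w] B by simp
    finally have "cmod (h w - ?B) < cmod (h w + cnj ?B)" by (rule power2_less_imp_less) simp
    then show ?thesis using nz[OF w] by (simp add: norm_divide)
  qed
  have z1: "cmod z < 1" using z \<rho> by simp
  then have zb: "z \<in> ball 0 1" by simp
  have r0: "0 \<le> \<rho>" using z norm_ge_zero order_trans by blast
  have "cmod ((h z - ?B) / (h z + cnj ?B)) \<le> cmod z"
    by (rule Schwarz_Lemma(1)[OF _ _ lt z1]) (use nz in \<open>auto intro!: holomorphic_intros h\<close>)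
  then have "cmod ((h z - ?B) / (h z + cnj ?B)) \<le> \<rho>" using z by simp
  then have "cmod (h z - ?B) \<le> \<rho> * cmod (h z + cnj ?B)"
    using nz[OF zb] by (simp add: norm_divide divide_simps split: if_splits)
  then have "(cmod (h z - ?B))\<^sup>2 \<le> (\<rho> * cmod (h z + cnj ?B))\<^sup>2" by (rule power_mono) simp
  then have "(Re (h z) - Re ?B)\<^sup>2 + (Im (h z) - Im ?B)\<^sup>2 \<le> \<rho>\<^sup>2 * (Re (h z) + Re ?B)\<^sup>2 + \<rho>\<^sup>2 * (Im (h z) - Im ?B)\<^sup>2"
    by (simp add: cmod_power2 power_mult_distrib distrib_left)
  \<comment> \<open>With \<open>\<rho> < 1\<close> the imaginary parts on the right are at most
    those on the left, so they drop out and only the real parts are compared.\<close>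
  moreover have "\<rho>\<^sup>2 * (Im (h z) - Im ?B)\<^sup>2 \<le> 1 * (Im (h z) - Im ?B)\<^sup>2"
    using r0 \<rho> by (intro mult_right_mono) (auto simp: power_le_one)
  ultimately have "(Re (h z) - Re ?B)\<^sup>2 \<le> (\<rho> * (Re (h z) + Re ?B))\<^sup>2"
    by (simp add: power_mult_distrib)
  then have "\<bar>Re (h z) - Re ?B\<bar> \<le> \<rho> * (Re (h z) + Re ?B)"
    using r0 pos[OF zb] B by (auto simp: abs_le_square_iff[symmetric])
  then show "(1 - \<rho>) * Re (h z) \<le> (1 + \<rho>) * Re (h 0)" "(1 - \<rho>) * Re (h 0) \<le> (1 + \<rho>) * Re (h z)"
    by (auto simp: algebra_simps abs_le_iff)
qed

lemma harnack_disc_two_points: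
  assumes h: "h holomorphic_on ball 0 1" and pos: "\<And>z. z \<in> ball 0 1 \<Longrightarrow> Re (h z) > 0"
    and z: "cmod z \<le> \<rho>" "cmod w \<le> \<rho>" and \<rho>: "\<rho> < 1"
  shows "Re (h z) \<le> ((1 + \<rho>) / (1 - \<rho>))\<^sup>2 * Re (h w)"
proof -
  have r0: "0 \<le> \<rho>" using z norm_ge_zero order_trans by blast
  have "Re (h z) \<le> ((1 + \<rho>) / (1 - \<rho>)) * Re (h 0)"
    using harnack_disc(1)[OF h pos z(1) \<rho>] \<rho> by (simp add: field_simps)
  also have "\<dots> \<le> ((1 + \<rho>) / (1 - \<rho>)) * (((1 + \<rho>) / (1 - \<rho>)) * Re (h w))"
    using harnack_disc(2)[OF h pos z(2) \<rho>] r0 \<rho> by (intro mult_left_mono) (auto simp: field_simps)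
  finally show ?thesis by (simp add: power2_eq_square mult_ac)
qed

text \<open>
  With \<open>t = |b(z)|\<^sup>2\<close> for a Blaschke factor \<open>b\<close> at \<open>a\<close>, the gap \<open>1 - t\<close> is comparable to
  \<open>1 - \<bar>a\<bar>\<^sup>2\<close> uniformly for \<open>z\<close> in a smaller disc. This transfers information on the zeros from
  one point of that disc to all others, without counting zeros near and far separately.
\<close>

lemma ln_inverse_le_gap:
  assumes "0 < t" "t \<le> (1::real)"
  shows "ln (1 / t) \<le> (1 - t) * (1 + ln (1 / t))" "1 - t \<le> ln (1 / t)"
proof -
  have "ln (1 / t) \<le> 1 / t - 1" using assms by (intro ln_le_minus_one) auto
  then have "t * ln (1 / t) \<le> t * (1 / t - 1)" using assms by (intro mult_left_mono) auto
  then have "t * ln (1 / t) \<le> 1 - t" using assms by (simp add: algebra_simps)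
  then show "ln (1 / t) \<le> (1 - t) * (1 + ln (1 / t))" by (simp add: algebra_simps)
  show "1 - t \<le> ln (1 / t)" using ln_le_minus_one[of t] assms by (simp add: ln_div)
qed

lemma blaschke_gap:
  "(cmod (1 - cnj a * z))\<^sup>2 - (cmod (z - a))\<^sup>2 = (1 - (cmod a)\<^sup>2) * (1 - (cmod z)\<^sup>2)"
  by (simp only: cmod_power2) (simp add: power2_eq_square algebra_simps)

text \<open>Everything follows from the gap identity and
  \<open>1 - \<rho> <= |1 - cnj a * z| <= 2\<close>. The upper bound may blow up logarithmically at
  \<open>a\<close> and serves at every point; the lower one is used at a single point to bound the
  weights. The 8 is \<open>2^2\<close>, from the denominator, times 2, from passing from
  \<open>b^2\<close> to \<open>b\<close>.\<close>

lemma blaschke_factor_bounds: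
  assumes a: "cmod a < 1" and z: "cmod z \<le> \<rho>" and \<rho>: "\<rho> < 1" and "z \<noteq> a"
  defines "b \<equiv> cmod (z - a) / cmod (1 - cnj a * z)"
  shows "0 < b" "b \<le> 1"
    "ln (1 / b) \<le> (1 - (cmod a)\<^sup>2) / (1 - \<rho>)\<^sup>2 * (1 / 2 + ln (2 / cmod (z - a)))"
    "(1 - (cmod a)\<^sup>2) * (1 - \<rho>\<^sup>2) / 8 \<le> ln (1 / b)"
proof -
  define N where "N = cmod (1 - cnj a * z)"
  define t where "t = b\<^sup>2"
  have r0: "0 \<le> \<rho>" using z norm_ge_zero order_trans by blast
  have az: "cmod (cnj a * z) \<le> \<rho>"
    using mult_mono[of "cmod a" 1 "cmod z" \<rho>] a z by (simp add: norm_mult)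
  have N: "1 - \<rho> \<le> N" "N \<le> 2"
    using norm_triangle_ineq2[of 1 "cnj a * z"] norm_triangle_ineq4[of 1 "cnj a * z"] az \<rho>
    by (auto simp: N_def)
  then have N0: "N > 0" using \<rho> by simp
  have a2: "0 < 1 - (cmod a)\<^sup>2" using a by (simp add: power_less_one_iff abs_square_less_1)
  have z2: "1 - \<rho>\<^sup>2 \<le> 1 - (cmod z)\<^sup>2" "1 - (cmod z)\<^sup>2 \<le> 1" "0 < 1 - \<rho>\<^sup>2"
    using z r0 \<rho> by (auto simp: power_mono abs_square_less_1)
  show b0: "0 < b" using assms N0 by (simp add: b_def N_def)
  have t: "1 - t = (1 - (cmod a)\<^sup>2) * (1 - (cmod z)\<^sup>2) / N\<^sup>2"
  proof -
    have "b = cmod (z - a) / N" by (simp add: b_def N_def)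
    moreover have "(1 - (cmod a)\<^sup>2) * (1 - (cmod z)\<^sup>2) = N\<^sup>2 - (cmod (z - a))\<^sup>2"
      unfolding N_def by (rule blaschke_gap[symmetric])
    ultimately show ?thesis using N0 by (simp add: t_def power_divide diff_divide_distrib)
  qed
  have t01: "0 < t" "t \<le> 1"
  proof -
    show "0 < t" using b0 by (simp add: t_def)
    have "0 \<le> 1 - t" unfolding t using a2 z2 by simp
    then show "t \<le> 1" by simp
  qed
  then show "b \<le> 1" using b0 by (simp add: t_def abs_square_le_1)
  have lnt: "ln (1 / t) = 2 * ln (1 / b)" using b0 by (simp add: t_def ln_div ln_realpow)
  have bd: "ln (1 / b) \<le> ln (2 / cmod (z - a))"
  proof -
    have "1 / b = N / cmod (z - a)" by (simp add: b_def N_def)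
    also have "\<dots> \<le> 2 / cmod (z - a)" using N by (intro divide_right_mono) auto
    finally show ?thesis using b0 by (intro ln_mono) auto
  qed
  have l0: "0 \<le> ln (1 / b)" using b0 \<open>b \<le> 1\<close> by simp
  have up: "1 - t \<le> (1 - (cmod a)\<^sup>2) / (1 - \<rho>)\<^sup>2"
  proof -
    have "(1 - (cmod a)\<^sup>2) * (1 - (cmod z)\<^sup>2) / N\<^sup>2 \<le> (1 - (cmod a)\<^sup>2) * 1 / (1 - \<rho>)\<^sup>2"
      using a2 z2 N \<rho> by (intro frac_le mult_left_mono) (auto intro: power_mono)
    then show ?thesis using t by simp
  qed
  have "ln (1 / t) \<le> (1 - t) * (1 + ln (1 / t))" using ln_inverse_le_gap(1) t01 by blast
  then have "ln (1 / b) \<le> (1 - t) * (1 / 2 + ln (1 / b))" unfolding lnt by (simp add: algebra_simps)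
  also have "\<dots> \<le> (1 - (cmod a)\<^sup>2) / (1 - \<rho>)\<^sup>2 * (1 / 2 + ln (2 / cmod (z - a)))"
    using up bd l0 t01 order_trans[OF l0 bd] by (intro mult_mono) auto
  finally show "ln (1 / b) \<le> (1 - (cmod a)\<^sup>2) / (1 - \<rho>)\<^sup>2 * (1 / 2 + ln (2 / cmod (z - a)))" .
  have "(1 - (cmod a)\<^sup>2) * (1 - \<rho>\<^sup>2) / 2\<^sup>2 \<le> (1 - (cmod a)\<^sup>2) * (1 - (cmod z)\<^sup>2) / N\<^sup>2"
    using a2 z2 N N0 by (intro frac_le mult_left_mono mult_nonneg_nonneg power_mono) auto
  also have "\<dots> \<le> ln (1 / t)" using ln_inverse_le_gap(2)[OF t01] t by simp
  finally show "(1 - (cmod a)\<^sup>2) * (1 - \<rho>\<^sup>2) / 8 \<le> ln (1 / b)" using lnt by simp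
qed

section \<open>Pointwise bounds for the logarithm of a holomorphic function\<close>

text \<open>The first summand is the two-point Harnack constant times the bound \<open>3 L\<close>
  on the positive harmonic function at \<open>z1\<close>. The second is the ratio of the two bounds
  for a Blaschke factor, \<open>8 / ((1 - \<rho>^2) * (1 - \<rho>)^2)\<close>, times 2, because the
  logarithms at \<open>z1\<close> add up to at most \<open>2 L\<close>.\<close>

definition log_constant :: "real \<Rightarrow> real" where
  "log_constant \<rho> = 3 * ((1 + \<rho>) / (1 - \<rho>))\<^sup>2 + 16 / ((1 - \<rho>\<^sup>2) * (1 - \<rho>)\<^sup>2)"

lemma log_constant_pos: "0 < \<rho> \<Longrightarrow> \<rho> < 1 \<Longrightarrow> log_constant \<rho> > 0"
  unfolding log_constant_def by (intro add_pos_pos) (simp_all add: abs_square_less_1)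

text \<open>The weights are arbitrary nonnegative reals, and one number bounds both their sum and
  the regular part. At a zero of \<open>g\<close> the left side is the default
  \<open>ln 0 = 0\<close>, so the inequality can be required at every point of the disc.\<close>

definition log_majorised :: "(complex \<Rightarrow> complex) \<Rightarrow> complex \<Rightarrow> real \<Rightarrow> real \<Rightarrow> real \<Rightarrow> bool" where
  "log_majorised g c r \<rho> E \<longleftrightarrow>
     (\<exists>Z \<mu>. finite Z \<and> Z \<subseteq> ball c r \<and> (\<forall>a\<in>Z. \<mu> a \<ge> 0) \<and> (\<Sum>a\<in>Z. \<mu> a) \<le> E \<and>
        (\<forall>z\<in>cball c (\<rho> * r). \<bar>ln (cmod (g z))\<bar> \<le> E + (\<Sum>a\<in>Z. \<mu> a * ln (2 * r / cmod (z - a)))))"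

text \<open>Dividing \<open>g\<close> by its Blaschke product leaves a zero-free \<open>G\<close>
  with the same modulus on the circle, hence \<open>|G| <= exp L\<close> inside. Blaschke factors
  are at most 1 in modulus, so the lower bound at \<open>z1\<close> passes to \<open>G\<close> and
  Harnack spreads it. The same inequality at \<open>z1\<close> bounds the Blaschke logarithms there
  by \<open>2 L\<close>, which controls the weights.\<close>

lemma log_modulus_bound_unit_disc:
  assumes \<rho>: "0 < \<rho>" "\<rho> < 1" and g: "g holomorphic_on ball 0 R" and R: "R > 1" and L: "L > 0"
    and ub: "\<And>z. z \<in> cball 0 1 \<Longrightarrow> cmod (g z) \<le> exp L"
    and z1: "cmod z1 \<le> \<rho>" and lb: "cmod (g z1) \<ge> exp (- L)"
  shows "log_majorised g 0 1 \<rho> (log_constant \<rho> * L)"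
proof -
  define K where "K = ((1 + \<rho>) / (1 - \<rho>))\<^sup>2"
  define C1 where "C1 = 16 / ((1 - \<rho>\<^sup>2) * (1 - \<rho>)\<^sup>2)"
  have \<rho>2: "0 < 1 - \<rho>\<^sup>2" using \<rho> by (simp add: abs_square_less_1)
  have C1: "C1 > 0" using \<rho> \<rho>2 by (simp add: C1_def)
  have "1 \<le> (1 + \<rho>) / (1 - \<rho>)" using \<rho> by simp
  then have K1: "K \<ge> 1" unfolding K_def by simp
  define C where "C = 3 * K + C1"
  have C0: "C > 0" using K1 C1 by (simp add: C_def)
  have C: "log_constant \<rho> = C" by (simp add: log_constant_def C_def K_def C1_def)
  define Z where "Z = {z \<in> ball 0 1. g z = 0}"
  have gz1: "g z1 \<noteq> 0" using lb by auto
  have z1R: "z1 \<in> ball 0 R" using z1 \<rho> R by simp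
  have fin: "finite Z" unfolding Z_def by (rule finite_zeros_ball[OF g R z1R gz1])
  have ZR: "Z \<subseteq> ball 0 R" using R by (auto simp: Z_def)
  obtain H n where H: "H holomorphic_on ball 0 R" "\<And>a. a \<in> Z \<Longrightarrow> H a \<noteq> 0"
     "\<And>z. z \<in> ball 0 R \<Longrightarrow> g z = H z * (\<Prod>a\<in>Z. (z - a) ^ (n a :: nat))"
    using holomorphic_factor_finite[OF fin g open_ball connected_ball ZR z1R gz1] by blast
  \<comment> \<open>Replacing \<open>z - a\<close> by \<open>1 - cnj a * z\<close> divides
    \<open>g\<close> by its Blaschke product without introducing a quotient: the new factors have
    the same modulus on the circle and no zeros inside.\<close>
  define G where "G = (\<lambda>z. H z * (\<Prod>a\<in>Z. (1 - cnj a * z) ^ n a))"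
  have G: "G holomorphic_on ball 0 R" unfolding G_def by (intro holomorphic_intros H)
  have Za: "cmod a < 1" if "a \<in> Z" for a using that by (auto simp: Z_def)
  have nz: "1 - cnj a * z \<noteq> 0" if "a \<in> Z" "cmod z \<le> 1" for a z
  proof
    assume "1 - cnj a * z = 0"
    then have "cmod a * cmod z = 1" by (metis complex_mod_cnj eq_iff_diff_eq_0 norm_mult norm_one)
    then show False using Za[OF that(1)] that(2) mult_le_one[of "cmod z" "cmod a"]
      by (metis mult.right_neutral mult_left_mono norm_ge_zero not_less)
  qed
  have Gnz: "G z \<noteq> 0" if "z \<in> ball 0 1" for z
  proof -
    have "H z \<noteq> 0"
    proof
      assume "H z = 0"
      then have "g z = 0" using H(3)[of z] that R by simp
      then have "z \<in> Z" using that by (simp add: Z_def)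
      then show False using H(2) \<open>H z = 0\<close> by blast
    qed
    then show ?thesis using nz that fin by (auto simp: G_def prod_zero_iff)
  qed
  have Gle: "cmod (G z) \<le> exp L" if "z \<in> ball 0 1" for z
  proof (rule maximum_modulus_frontier[of G "ball 0 1"])
    show "G holomorphic_on interior (ball 0 1)" using G R by (auto intro: holomorphic_on_subset)
    have "cball 0 1 \<subseteq> ball (0::complex) R" using R by auto
    then show "continuous_on (closure (ball 0 1)) G"
      using holomorphic_on_imp_continuous_on[OF G] by (auto intro: continuous_on_subset)
    fix w :: complex assume "w \<in> frontier (ball 0 1)"
    then have w: "cmod w = 1" by simp
    have "cmod (1 - cnj a * w) = cmod (w - a)" for a
    proof -
      have "(cmod (1 - cnj a * w))\<^sup>2 = (cmod (w - a))\<^sup>2" using blaschke_gap[of a w] w by simp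
      then show ?thesis by simp
    qed
    then have "cmod (G w) = cmod (g w)"
      using H(3)[of w] w R by (simp add: G_def norm_mult prod_norm[symmetric] norm_power)
    then show "cmod (G w) \<le> exp L" using ub w by simp
  qed (use that in auto)
  define b where "b = (\<lambda>a z. cmod (z - a) / cmod (1 - cnj a * z))"
  have gG: "cmod (g z) = cmod (G z) * (\<Prod>a\<in>Z. b a z ^ n a)" if "cmod z < 1" for z
  proof -
    have "cmod (G z) * (\<Prod>a\<in>Z. b a z ^ n a) = cmod (H z) * (\<Prod>a\<in>Z. cmod (1 - cnj a * z) ^ n a * b a z ^ n a)"
      by (simp add: G_def norm_mult prod_norm[symmetric] norm_power prod.distrib)
    also have "(\<Prod>a\<in>Z. cmod (1 - cnj a * z) ^ n a * b a z ^ n a) = (\<Prod>a\<in>Z. cmod (z - a) ^ n a)"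
      using nz that by (intro prod.cong) (auto simp: b_def power_mult_distrib[symmetric])
    also have "cmod (H z) * (\<Prod>a\<in>Z. cmod (z - a) ^ n a) = cmod (g z)"
      using H(3)[of z] that R by (simp add: norm_mult prod_norm[symmetric] norm_power)
    finally show ?thesis by simp
  qed
  have G': "G holomorphic_on ball 0 1" using R by (intro holomorphic_on_subset[OF G]) auto
  obtain l where l: "l holomorphic_on ball 0 1" "\<And>z. z \<in> ball 0 1 \<Longrightarrow> exp (l z) = G z"
    by (rule holomorphic_logarithm_exists[OF convex_ball open_ball G' Gnz, of 0]) (assumption, simp, rule that)
  have Rl: "Re (l z) = ln (cmod (G z))" if "z \<in> ball 0 1" for z
    by (simp add: l(2)[OF that, symmetric])
  \<comment> \<open>With \<open>2 L\<close> in place of \<open>L\<close> the real part is at least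
    \<open>L\<close>, so it is strictly positive as Harnack's inequality demands; at
    \<open>z1\<close> it is still at most \<open>3 L\<close>.\<close>
  define h where "h = (\<lambda>z. of_real (2 * L) - l z)"
  have h: "h holomorphic_on ball 0 1" unfolding h_def by (intro holomorphic_intros l)
  have Glog: "ln (cmod (G z)) \<le> L" if "z \<in> ball 0 1" for z
    using ln_mono[OF Gle[OF that]] Gnz[OF that] by simp
  have hpos: "Re (h z) > 0" if "z \<in> ball 0 1" for z
    using Glog[OF that] Rl[OF that] L by (simp add: h_def)
  have z1b: "z1 \<in> ball 0 1" using z1 \<rho> by simp
  have z1Z: "z1 \<noteq> a" if "a \<in> Z" for a using that gz1 by (auto simp: Z_def)
  let ?T = "\<lambda>z. \<Sum>a\<in>Z. n a * ln (1 / b a z)"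
  have logg: "ln (cmod (g z)) = ln (cmod (G z)) - ?T z"
    if "cmod z \<le> \<rho>" "g z \<noteq> 0" for z
  proof -
    have zb: "z \<in> ball 0 1" using that \<rho> by simp
    have bp: "b a z > 0" if "a \<in> Z" for a
      using blaschke_factor_bounds(1)[OF Za[OF that] \<open>cmod z \<le> \<rho>\<close> \<rho>(2)] that \<open>g z \<noteq> 0\<close>
      unfolding b_def by (auto simp: Z_def)
    have "ln (cmod (g z)) = ln (cmod (G z)) + ln (\<Prod>a\<in>Z. b a z ^ n a)"
    proof -
      have "(\<Prod>a\<in>Z. b a z ^ n a) > 0" using bp by (intro prod_pos) simp
      then show ?thesis using gG[of z] zb Gnz[OF zb] by (simp add: ln_mult)
    qed
    also have "ln (\<Prod>a\<in>Z. b a z ^ n a) = (\<Sum>a\<in>Z. - (n a * ln (1 / b a z)))"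
      using bp fin less_imp_neq[OF bp] by (subst ln_prod) (auto simp: ln_realpow ln_div intro!: sum.cong)
    finally show ?thesis by (simp add: sum_negf)
  qed
  have b: "cmod (z - a) / cmod (1 - cnj a * z) = b a z" for a z by (simp add: b_def)
  note bb = blaschke_factor_bounds[OF Za _ \<rho>(2), unfolded b]
  have lnb: "0 \<le> ln (1 / b a z)" if "a \<in> Z" "cmod z \<le> \<rho>" "g z \<noteq> 0" for a z
  proof -
    have "z \<noteq> a" using that by (auto simp: Z_def)
    from bb(1,2)[OF that(1,2) this] show ?thesis by simp
  qed
  have "- L \<le> ln (cmod (g z1))" using ln_mono[OF lb] gz1 by simp
  then have e1: "- L \<le> ln (cmod (G z1)) - ?T z1"
    using logg[OF z1 gz1] by simp
  have s0: "0 \<le> ?T z1"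
    using lnb[OF _ z1 gz1] by (intro sum_nonneg) auto
  have hz1: "Re (h z1) \<le> 3 * L" using e1 s0 Rl[OF z1b] by (simp add: h_def)
  have S2: "?T z1 \<le> 2 * L" using e1 Glog[OF z1b] by simp
  have Gbd: "\<bar>ln (cmod (G z))\<bar> \<le> 3 * K * L" if "cmod z \<le> \<rho>" for z
  proof -
    have zb: "z \<in> ball 0 1" using that \<rho> by simp
    have "Re (h z) \<le> K * Re (h z1)"
      unfolding K_def by (rule harnack_disc_two_points[OF h hpos that z1 \<rho>(2)]) auto
    also have "\<dots> \<le> K * (3 * L)" using hz1 K1 by (intro mult_left_mono) auto
    finally have "- (3 * K * L) \<le> ln (cmod (G z))" using Rl[OF zb] L by (simp add: h_def)
    moreover have "1 * L \<le> K * L" using K1 L by (intro mult_right_mono) auto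
    ultimately show ?thesis using Glog[OF zb] L by linarith
  qed
  define \<mu> where "\<mu> = (\<lambda>a. n a * (1 - (cmod a)\<^sup>2) / (1 - \<rho>)\<^sup>2)"
  have a2: "0 \<le> 1 - (cmod a)\<^sup>2" if "a \<in> Z" for a
    using Za[OF that] by (simp add: power_le_one)
  have \<mu>0: "\<mu> a \<ge> 0" if "a \<in> Z" for a using a2[OF that] by (simp add: \<mu>_def)
  have "(\<Sum>a\<in>Z. \<mu> a) = (\<Sum>a\<in>Z. C1 / 2 * (n a * ((1 - (cmod a)\<^sup>2) * (1 - \<rho>\<^sup>2) / 8)))"
    using \<rho> \<rho>2 by (intro sum.cong) (auto simp: \<mu>_def C1_def field_simps)
  also have "\<dots> \<le> (\<Sum>a\<in>Z. C1 / 2 * (n a * ln (1 / b a z1)))"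
    using bb(4)[OF _ z1 z1Z] C1 by (intro sum_mono mult_left_mono) auto
  also have "\<dots> = C1 / 2 * ?T z1" by (simp add: sum_distrib_left)
  also have "\<dots> \<le> C1 / 2 * (2 * L)" using S2 C1 by (intro mult_left_mono) auto
  finally have \<mu>sum: "(\<Sum>a\<in>Z. \<mu> a) \<le> C1 * L" by simp
  let ?S = "\<lambda>z. \<Sum>a\<in>Z. \<mu> a * ln (2 / cmod (z - a))"
  have main: "\<bar>ln (cmod (g z))\<bar> \<le> C * L + ?S z" if "z \<in> cball 0 \<rho>" for z
  proof (cases "g z = 0")
    case True
    \<comment> \<open>Here the left side is \<open>ln 0 = 0\<close>, so nonnegative potentials
      suffice. The term of \<open>a = z\<close> is 0 as well, division by zero giving
      \<open>ln 0\<close>.\<close>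
    have "0 \<le> \<mu> a * ln (2 / cmod (z - a))" if "a \<in> Z" for a
    proof (cases "z = a")
      case False
      have "cmod (z - a) \<le> 2"
        using norm_triangle_ineq4[of z a] Za[OF that] \<open>z \<in> cball 0 \<rho>\<close> \<rho> by simp
      then show ?thesis using False \<mu>0[OF that] by simp
    qed auto
    then have "0 \<le> ?S z" by (rule sum_nonneg)
    then show ?thesis using True C0 L by simp
  next
    case False
    have z: "cmod z \<le> \<rho>" using that by simp
    have zZ: "z \<noteq> a" if "a \<in> Z" for a using that False by (auto simp: Z_def)
    have s: "0 \<le> ?T z" using lnb[OF _ z False] by (intro sum_nonneg) auto
    have "?T z \<le> (\<Sum>a\<in>Z. n a * ((1 - (cmod a)\<^sup>2) / (1 - \<rho>)\<^sup>2 * (1 / 2 + ln (2 / cmod (z - a)))))"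
      using bb(3)[OF _ z zZ] by (intro sum_mono mult_left_mono) auto
    also have "\<dots> = (\<Sum>a\<in>Z. \<mu> a / 2 + \<mu> a * ln (2 / cmod (z - a)))"
      by (intro sum.cong) (simp_all add: \<mu>_def distrib_left)
    also have "\<dots> = (\<Sum>a\<in>Z. \<mu> a) / 2 + ?S z"
      by (simp add: sum.distrib sum_divide_distrib)
    finally have "\<bar>ln (cmod (g z))\<bar> \<le> 3 * K * L + ((\<Sum>a\<in>Z. \<mu> a) / 2 + ?S z)"
      using Gbd[OF z] logg[OF z False] s by linarith
    moreover have "(\<Sum>a\<in>Z. \<mu> a) / 2 \<le> C1 * L" using \<mu>sum C1 L mult_pos_pos[OF C1 L] by linarith
    ultimately show ?thesis by (simp add: C_def algebra_simps)
  qed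
  have "C1 * L \<le> C * L" using K1 L by (simp add: C_def)
  then show ?thesis
    using fin \<mu>0 \<mu>sum main unfolding log_majorised_def C_def[symmetric] C
    by (intro exI[of _ Z] exI[of _ \<mu>]) (auto simp: Z_def)
qed

lemma log_modulus_bound_disc:
  assumes \<rho>: "0 < \<rho>" "\<rho> < 1" and g: "g holomorphic_on ball c R" and r: "0 < r" and R: "R > r" and L: "L > 0"
    and ub: "\<And>z. z \<in> cball c r \<Longrightarrow> cmod (g z) \<le> exp L"
    and z1: "cmod (z1 - c) \<le> \<rho> * r" and lb: "cmod (g z1) \<ge> exp (- L)"
  shows "log_majorised g c r \<rho> (log_constant \<rho> * L)"
proof -
  define C where "C = log_constant \<rho> * L"
  have e: "c + of_real r * ((z - c) / of_real r) = z" for z using r by simp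
  have "log_majorised (\<lambda>z. g (c + of_real r * z)) 0 1 \<rho> C"
    unfolding C_def
  proof (rule log_modulus_bound_unit_disc[OF \<rho>, of _ "R / r" L "(z1 - c) / of_real r"])
    have "(g \<circ> (\<lambda>z. c + of_real r * z)) holomorphic_on ball 0 (R / r)"
      by (rule holomorphic_on_compose_gen[OF _ g])
         (use r in \<open>auto intro!: holomorphic_intros simp: dist_norm norm_mult field_simps\<close>)
    then show "(\<lambda>z. g (c + of_real r * z)) holomorphic_on ball 0 (R / r)" by (simp add: o_def)
    fix z :: complex assume "z \<in> cball 0 1"
    then have "c + of_real r * z \<in> cball c r" using r by (simp add: dist_norm norm_mult)
    then show "cmod (g (c + of_real r * z)) \<le> exp L" using ub by blast
  qed (use r R L z1 lb e in \<open>auto simp: norm_divide field_simps\<close>)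
  then obtain Z \<mu> where Z: "finite Z" "Z \<subseteq> ball 0 1" "\<And>a. a \<in> Z \<Longrightarrow> \<mu> a \<ge> 0" "(\<Sum>a\<in>Z. \<mu> a) \<le> C"
    "\<And>z. z \<in> cball 0 \<rho> \<Longrightarrow> \<bar>ln (cmod (g (c + of_real r * z)))\<bar> \<le> C + (\<Sum>a\<in>Z. \<mu> a * ln (2 / cmod (z - a)))"
    unfolding log_majorised_def mult_1_right by blast
  define T where "T = (\<lambda>z. c + of_real r * z)"
  define T' where "T' = (\<lambda>z. (z - c) / of_real r)"
  have inj: "inj_on T Z" using r by (auto simp: T_def inj_on_def)
  have T'T: "T' (T z) = z" "T (T' z) = z" for z using r by (auto simp: T_def T'_def)
  have sm: "(\<Sum>a\<in>T ` Z. F (T' a) a) = (\<Sum>a\<in>Z. F a (T a))" for F :: "complex \<Rightarrow> complex \<Rightarrow> real"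
    by (subst sum.reindex[OF inj]) (simp add: T'T)
  show ?thesis
    unfolding log_majorised_def C_def[symmetric]
  proof (intro exI[of _ "T ` Z"] exI[of _ "\<lambda>a. \<mu> (T' a)"] conjI ballI)
    show "T ` Z \<subseteq> ball c r" using Z(2) r by (auto simp: T_def dist_norm norm_mult)
    show "(\<Sum>a\<in>T ` Z. \<mu> (T' a)) \<le> C" using sm[of "\<lambda>a b. \<mu> a"] Z(4) by simp
    fix z assume "z \<in> cball c (\<rho> * r)"
    then have "T' z \<in> cball 0 \<rho>" using r by (simp add: T'_def dist_norm norm_divide norm_minus_commute field_simps)
    from Z(5)[OF this]
    have "\<bar>ln (cmod (g z))\<bar> \<le> C + (\<Sum>a\<in>Z. \<mu> a * ln (2 / cmod (T' z - a)))"
      using T'T(2)[of z, unfolded T_def] by simp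
    also have "(\<Sum>a\<in>Z. \<mu> a * ln (2 / cmod (T' z - a))) = (\<Sum>a\<in>Z. \<mu> a * ln (2 * r / cmod (z - T a)))"
    proof (intro sum.cong refl)
      fix a
      have "z - T a = of_real r * (T' z - a)" using r by (simp add: T_def T'_def field_simps)
      then have "cmod (z - T a) = r * cmod (T' z - a)" using r by (simp add: norm_mult)
      then show "\<mu> a * ln (2 / cmod (T' z - a)) = \<mu> a * ln (2 * r / cmod (z - T a))" using r by simp
    qed
    also have "\<dots> = (\<Sum>a\<in>T ` Z. \<mu> (T' a) * ln (2 * r / cmod (z - a)))"
      using sm[of "\<lambda>a b. \<mu> a * ln (2 * r / cmod (z - b))"] by simp
    finally show "\<bar>ln (cmod (g z))\<bar> \<le> C + (\<Sum>a\<in>T ` Z. \<mu> (T' a) * ln (2 * r / cmod (z - a)))" .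
  qed (use Z T'T in auto)
qed

section \<open>Integral bounds and the Laplacian of the log modulus\<close>

text \<open>The conclusion offers an integrable majorant instead of an integral of the logarithm.
  Measurability of \<open>ln |g|\<close> outside the disc is then never in question, and majorants
  of several discs can be added.\<close>

lemma log_modulus_integral_bound:
  fixes \<psi> :: "complex \<Rightarrow> real"
  assumes \<rho>: "0 < \<rho>" "\<rho> < 1" and g: "g holomorphic_on ball c R" and r: "0 < r" and R: "R > r" and L: "L > 0"
    and ub: "\<And>z. z \<in> cball c r \<Longrightarrow> cmod (g z) \<le> exp L"
    and z1: "cmod (z1 - c) \<le> \<rho> * r" and lb: "cmod (g z1) \<ge> exp (- L)"
    and \<psi>: "integrable lborel \<psi>" "\<And>z. 0 \<le> \<psi> z \<and> \<psi> z \<le> D" "\<And>z. \<psi> z \<noteq> 0 \<Longrightarrow> z \<in> cball c (\<rho> * r)"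
    and s: "0 < s" "s \<le> 1"
  shows "\<exists>W. integrable lborel W \<and> (\<forall>z. \<bar>ln (cmod (g z))\<bar> * \<psi> z \<le> W z) \<and>
     integral\<^sup>L lborel W \<le> 6 * log_constant \<rho> * L * ((1 + ln (2 / s)) * integral\<^sup>L lborel \<psi> + D * s\<^sup>2 * r\<^sup>2)"
proof -
  define C where "C = log_constant \<rho>"
  have C: "C > 0" unfolding C_def by (rule log_constant_pos[OF \<rho>])
  obtain Z \<mu> where Z: "finite Z" "Z \<subseteq> ball c r" "\<And>a. a \<in> Z \<Longrightarrow> \<mu> a \<ge> 0" "(\<Sum>a\<in>Z. \<mu> a) \<le> C * L"
    "\<And>z. z \<in> cball c (\<rho> * r) \<Longrightarrow> \<bar>ln (cmod (g z))\<bar> \<le> C * L + (\<Sum>a\<in>Z. \<mu> a * ln (2 * r / cmod (z - a)))"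
    using log_modulus_bound_disc[OF \<rho> g r R L ub z1 lb] unfolding log_majorised_def C_def[symmetric] by blast
  define W where "W = (\<lambda>z. C * L * \<psi> z + (\<Sum>a\<in>Z. \<mu> a * (ln (2 * r / cmod (z - a)) * \<psi> z)))"
  have rr: "\<rho> * r \<le> r" using \<rho> r by simp
  have sup: "cmod (z - a) \<le> 2 * r" if "a \<in> Z" "\<psi> z \<noteq> 0" for a z
  proof -
    have "dist c z \<le> \<rho> * r" "dist c a < r" using \<psi>(3) that Z(2) by auto
    then show ?thesis using dist_triangle3[of z a c] rr by (simp add: dist_norm)
  qed
  \<comment> \<open>The potentials have outer radius \<open>2 * r\<close> and are cut off at
    \<open>s * r\<close>; the quotient \<open>2 / s\<close> no longer depends on the size of the
    disc.\<close>
  have sr: "0 < s * r" "s * r \<le> 2 * r" using s r by auto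
  have D0: "0 \<le> D" using \<psi>(2) order_trans by blast
  have lp: "integrable lborel (\<lambda>z. ln (2 * r / cmod (z - a)) * \<psi> z)"
    "(LBINT z. ln (2 * r / cmod (z - a)) * \<psi> z) \<le> ln (2 / s) * integral\<^sup>L lborel \<psi> + 6 * D * (s\<^sup>2 * r\<^sup>2)"
    if "a \<in> Z" for a
    using log_potential[of \<psi> D a "2 * r" "s * r", OF \<psi>(1) _ _ _ sr] \<psi>(2) sup[OF that] r
    by (auto simp: power_mult_distrib)
  let ?I = "integral\<^sup>L lborel \<psi>"
  have I0: "0 \<le> ?I" using \<psi>(2) by (intro integral_nonneg_AE) auto
  have l2: "0 \<le> ln (2 / s)" using s by simp
  have iW: "integrable lborel W" unfolding W_def using \<psi>(1) lp(1) by auto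
  have bW: "\<bar>ln (cmod (g z))\<bar> * \<psi> z \<le> W z" for z
  proof (cases "\<psi> z = 0")
    case True then show ?thesis by (simp add: W_def)
  next
    case False
    then have "\<bar>ln (cmod (g z))\<bar> * \<psi> z \<le> (C * L + (\<Sum>a\<in>Z. \<mu> a * ln (2 * r / cmod (z - a)))) * \<psi> z"
      using Z(5)[of z] \<psi>(2,3) by (intro mult_right_mono) auto
    also have "\<dots> = W z" by (simp add: W_def distrib_right sum_distrib_right mult.assoc)
    finally show ?thesis .
  qed
  have "integral\<^sup>L lborel W = C * L * ?I + (\<Sum>a\<in>Z. \<mu> a * (LBINT z. ln (2 * r / cmod (z - a)) * \<psi> z))"
    unfolding W_def using \<psi>(1) lp(1) by (subst Bochner_Integration.integral_add) auto
  also have "\<dots> \<le> C * L * ?I + (\<Sum>a\<in>Z. \<mu> a * (ln (2 / s) * ?I + 6 * D * (s\<^sup>2 * r\<^sup>2)))"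
    using lp(2) Z(3) by (intro add_left_mono sum_mono mult_left_mono) auto
  also have "\<dots> = C * L * ?I + (\<Sum>a\<in>Z. \<mu> a) * (ln (2 / s) * ?I + 6 * D * (s\<^sup>2 * r\<^sup>2))"
    by (simp add: sum_distrib_right)
  also have "\<dots> \<le> C * L * ?I + C * L * (ln (2 / s) * ?I + 6 * D * (s\<^sup>2 * r\<^sup>2))"
    using Z(4) l2 I0 D0 by (intro add_left_mono mult_right_mono) auto
  also have "\<dots> \<le> 6 * C * L * ((1 + ln (2 / s)) * ?I + D * s\<^sup>2 * r\<^sup>2)"
  proof -
    have "0 \<le> C * L * ((1 + ln (2 / s)) * ?I)" using C L l2 I0 by simp
    then show ?thesis by (simp add: algebra_simps)
  qed
  finally show ?thesis unfolding C_def[symmetric] using iW bW by blast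
qed

text \<open>The factor \<open>v * v\<close> is 1 for \<open>v = 1\<close> and -1 for
  \<open>v = \<i>\<close>, so the two second derivatives cancel: this is harmonicity in the form
  that \<open>green\<close> consumes.\<close>

lemma dir_C2_Re_holomorphic:
  assumes "l holomorphic_on U" "open U"
  shows "dir_C2 U v (\<lambda>z. Re (l z)) (\<lambda>z. Re (v * v * deriv (deriv l) z))"
proof -
  have l': "deriv l holomorphic_on U" by (rule holomorphic_deriv[OF assms])
  have l'': "deriv (deriv l) holomorphic_on U" by (rule holomorphic_deriv[OF l' assms(2)])
  have d: "((\<lambda>t. Re (w * h (z + t *\<^sub>R v))) has_real_derivative Re (w * v * deriv h z)) (at 0)"
    if "h holomorphic_on U" "z \<in> U" for h z w
  proof -
    have "(h has_field_derivative deriv h z) (at (z + 0 *\<^sub>R v))"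
      using holomorphic_derivI[OF that(1) assms(2) that(2)] by simp
    moreover have "((\<lambda>t::real. z + t *\<^sub>R v) has_vector_derivative v) (at 0)"
      by (auto intro!: derivative_eq_intros)
    ultimately have "((h \<circ> (\<lambda>t::real. z + t *\<^sub>R v)) has_vector_derivative v * deriv h z) (at 0)"
      by (intro field_vector_diff_chain_at) auto
    then have "((\<lambda>t::real. w * h (z + t *\<^sub>R v)) has_vector_derivative w * (v * deriv h z)) (at 0)"
      unfolding o_def by (rule has_vector_derivative_mult_right)
    then show ?thesis
      using has_vector_derivative_complex_iff by (auto simp: mult.assoc has_real_derivative_iff_has_vector_derivative)
  qed
  note c = holomorphic_on_imp_continuous_on
  show ?thesis
    unfolding dir_C2_def
  proof (intro conjI exI[of _ "\<lambda>z. Re (v * deriv l z)"] ballI)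
    show "continuous_on U (\<lambda>z. Re (l z))" "continuous_on U (\<lambda>z. Re (v * v * deriv (deriv l) z))"
      "continuous_on U (\<lambda>z. Re (v * deriv l z))"
      by (intro continuous_intros c assms l' l'')+
    fix z assume z: "z \<in> U"
    show "((\<lambda>t. Re (l (z + t *\<^sub>R v))) has_real_derivative Re (v * deriv l z)) (at 0)"
      using d[OF assms(1) z, of 1] by simp
    show "((\<lambda>t. Re (v * deriv l (z + t *\<^sub>R v))) has_real_derivative Re (v * v * deriv (deriv l) z)) (at 0)"
      using d[OF l' z, of v] .
  qed
qed

text \<open>Only the values of \<open>f\<close> on \<open>K\<close> matter, since \<open>L\<close>
  vanishes elsewhere; cutting \<open>f\<close> off by the indicator of the closed set
  \<open>K\<close> makes it measurable.\<close>

lemma borel_measurable_log_modulus_times: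
  assumes "continuous_on K f" "compact K" "L \<in> borel_measurable borel" "\<And>z. z \<notin> K \<Longrightarrow> L z = 0"
  shows "(\<lambda>z::complex. ln (cmod (f z)) *\<^sub>R (L z :: complex)) \<in> borel_measurable borel"
proof -
  have [measurable]: "(\<lambda>z. indicator K z *\<^sub>R f z) \<in> borel_measurable borel"
    using assms(1,2) by (intro borel_measurable_continuous_on_indicator) (auto simp: compact_imp_closed)
  note [measurable] = assms(3)
  have "(\<lambda>z. ln (cmod (indicator K z *\<^sub>R f z)) *\<^sub>R L z) \<in> borel_measurable borel" by measurable
  also have "(\<lambda>z. ln (cmod (indicator K z *\<^sub>R f z)) *\<^sub>R L z) = (\<lambda>z. ln (cmod (f z)) *\<^sub>R L z)"
  proof
    fix z show "ln (cmod (indicator K z *\<^sub>R f z)) *\<^sub>R L z = ln (cmod (f z)) *\<^sub>R L z"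
      using assms(4)[of z] by (cases "z \<in> K") auto
  qed
  finally show ?thesis .
qed

text \<open>On the disc \<open>f\<close> is \<open>exp l\<close> times a product of powers of
  \<open>z - a\<close>. The harmonic part \<open>Re l\<close> integrates to 0 by Green, and each
  factor contributes \<open>2 * pi * \<phi> a\<close> as often as the multiplicity says. The
  logarithms agree with this decomposition off the finite zero set.\<close>

lemma
  fixes f \<phi> L :: "complex \<Rightarrow> complex"
  assumes f: "f holomorphic_on ball c R" and r: "r < R" and nz: "w \<in> ball c R" "f w \<noteq> 0"
    and t: "C2_test K \<phi> L" and K: "K \<subseteq> ball c r"
  defines "Z \<equiv> {z \<in> ball c r. f z = 0}"
  shows integrable_log_modulus_laplacian: "integrable lborel (\<lambda>z. ln (cmod (f z)) *\<^sub>R L z)"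
    and integral_log_modulus_laplacian: "(LBINT z. ln (cmod (f z)) *\<^sub>R L z) = 2 * pi * (\<Sum>a\<in>Z. of_int (zorder f a) * \<phi> a)"
proof -
  note T = C2_testD[OF t]
  have fin: "finite Z" unfolding Z_def by (rule finite_zeros_ball[OF f r nz])
  have ZR: "Z \<subseteq> ball c R" using r by (auto simp: Z_def)
  obtain H where H: "H holomorphic_on ball c R" "\<And>a. a \<in> Z \<Longrightarrow> H a \<noteq> 0"
    "\<And>z. z \<in> ball c R \<Longrightarrow> f z = H z * (\<Prod>a\<in>Z. (z - a) ^ nat (zorder f a))"
    "\<And>a. a \<in> Z \<Longrightarrow> zorder f a \<ge> 0"
    by (rule holomorphic_factor_zorder[OF fin f open_ball connected_ball ZR nz]) (rule that)
  define n where "n = (\<lambda>a. nat (zorder f a))"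
  have sub: "ball c r \<subseteq> ball c R" using r by auto
  have Hnz: "H z \<noteq> 0" if "z \<in> ball c r" for z
  proof
    assume "H z = 0"
    then have "f z = 0" using H(3)[of z] that sub by auto
    then show False using H(2)[of z] that \<open>H z = 0\<close> by (auto simp: Z_def)
  qed
  obtain l where l: "l holomorphic_on ball c r" "\<And>z. z \<in> ball c r \<Longrightarrow> exp (l z) = H z"
  proof (cases "r > 0")
    case True
    have "H holomorphic_on ball c r" using H(1) sub by (rule holomorphic_on_subset)
    show ?thesis
      by (rule holomorphic_logarithm_exists[OF convex_ball open_ball \<open>H holomorphic_on ball c r\<close> Hnz, of c])
         (assumption, simp add: True, rule that)
  next
    case False
    then have "ball c r = {}" by auto
    then show ?thesis by (intro that[of "\<lambda>_. 0"]) (simp, metis empty_iff)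
  qed
  have ln_f: "ln (cmod (f z)) = Re (l z) + (\<Sum>a\<in>Z. n a * ln (cmod (z - a)))" if "z \<in> ball c r" "z \<notin> Z" for z
  proof -
    have zn: "z \<noteq> a" if "a \<in> Z" for a using that \<open>z \<notin> Z\<close> by auto
    have "cmod (f z) = exp (Re (l z)) * (\<Prod>a\<in>Z. cmod (z - a) ^ n a)"
      using H(3)[of z] that(1) sub l(2)[OF that(1), symmetric]
      by (auto simp: norm_mult prod_norm[symmetric] norm_power n_def)
    moreover have "(\<Prod>a\<in>Z. cmod (z - a) ^ n a) > 0" using zn by (intro prod_pos) auto
    moreover have "ln (\<Prod>a\<in>Z. cmod (z - a) ^ n a) = (\<Sum>a\<in>Z. n a * ln (cmod (z - a)))"
      using fin zn by (subst ln_prod) (auto simp: ln_realpow)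
    ultimately show ?thesis by (simp add: ln_mult)
  qed
  let ?G = "\<lambda>z. Re (l z) *\<^sub>R L z + (\<Sum>a\<in>Z. n a * (ln (cmod (z - a)) *\<^sub>R L z))"
  have gr: "(LBINT z. Re (l z) *\<^sub>R L z) = (LBINT z. 0 *\<^sub>R \<phi> z)"
    "integrable lborel (\<lambda>z. Re (l z) *\<^sub>R L z)"
    by (rule green[OF open_ball K t dir_C2_Re_holomorphic[OF l(1) open_ball] dir_C2_Re_holomorphic[OF l(1) open_ball]]; simp)+
  have iG: "integrable lborel ?G"
    by (intro Bochner_Integration.integrable_add Bochner_Integration.integrable_sum
        integrable_mult_right gr(2) integrable_log_laplacian[OF t])
  have intG: "integral\<^sup>L lborel ?G = 2 * pi * (\<Sum>a\<in>Z. of_int (zorder f a) * \<phi> a)"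
  proof -
    have i: "integrable lborel (\<lambda>z. of_nat (n a) * (ln (cmod (z - a)) *\<^sub>R L z))" for a
      by (intro integrable_mult_right integrable_log_laplacian[OF t])
    have "integral\<^sup>L lborel ?G = (LBINT z. Re (l z) *\<^sub>R L z) +
       (LBINT z. \<Sum>a\<in>Z. n a * (ln (cmod (z - a)) *\<^sub>R L z))"
      by (rule Bochner_Integration.integral_add[OF gr(2)]) (rule Bochner_Integration.integrable_sum[OF i])
    also have "\<dots> = (\<Sum>a\<in>Z. (LBINT z. n a * (ln (cmod (z - a)) *\<^sub>R L z)))"
      unfolding gr(1) Bochner_Integration.integral_sum[OF i] by simp
    also have "\<dots> = (\<Sum>a\<in>Z. of_nat (n a) * (2 * pi * \<phi> a))"
      unfolding integral_mult_right_zero integral_log_laplacian[OF t] ..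
    also have "\<dots> = 2 * pi * (\<Sum>a\<in>Z. of_int (zorder f a) * \<phi> a)"
      unfolding sum_distrib_left using H(4) by (intro sum.cong) (auto simp: n_def)
    finally show ?thesis .
  qed
  have cont: "continuous_on K f"
    using holomorphic_on_imp_continuous_on[OF f] K sub by (auto intro: continuous_on_subset)
  have [measurable]: "L \<in> borel_measurable borel" using T by (auto intro: borel_measurable_continuous_onI)
  have meas: "(\<lambda>z. ln (cmod (f z)) *\<^sub>R L z) \<in> borel_measurable borel"
    by (rule borel_measurable_log_modulus_times[OF cont T(1) _ T(5)]) auto
  have ae: "AE z in lborel. ln (cmod (f z)) *\<^sub>R L z = ?G z"
  proof -
    have "AE z in lborel. z \<notin> Z"
      using AE_not_in[OF finite_imp_null_set_lborel[OF fin]] .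
    then show ?thesis
    proof (rule eventually_mono)
      fix z assume zZ: "z \<notin> Z"
      show "ln (cmod (f z)) *\<^sub>R L z = ?G z"
      proof (cases "z \<in> K")
        case True
        then have "ln (cmod (f z)) = Re (l z) + (\<Sum>a\<in>Z. n a * ln (cmod (z - a)))" using ln_f zZ K by auto
        then show ?thesis by (simp add: scaleR_conv_of_real distrib_right sum_distrib_right mult.assoc)
      qed (use T in simp)
    qed
  qed
  show "integrable lborel (\<lambda>z. ln (cmod (f z)) *\<^sub>R L z)"
    using iG ae meas by (subst integrable_cong_AE[of _ _ ?G]) (auto dest: borel_measurable_integrable)
  show "(LBINT z. ln (cmod (f z)) *\<^sub>R L z) = 2 * pi * (\<Sum>a\<in>Z. of_int (zorder f a) * \<phi> a)"
    unfolding intG[symmetric] using iG ae meas by (intro integral_cong_AE) (auto dest: borel_measurable_integrable)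
qed

lemma dir_C2_log_Im:
  "dir_C2 {z. Im z > 0} 1 (\<lambda>z. ln (Im z)) (\<lambda>z. 0)"
  "dir_C2 {z. Im z > 0} \<i> (\<lambda>z. ln (Im z)) (\<lambda>z. - (1 / (Im z)\<^sup>2))"
proof -
  show "dir_C2 {z. Im z > 0} 1 (\<lambda>z. ln (Im z)) (\<lambda>z. 0)"
    unfolding dir_C2_def by (intro conjI exI[of _ "\<lambda>z. 0"]) (auto intro!: continuous_intros)
  show "dir_C2 {z. Im z > 0} \<i> (\<lambda>z. ln (Im z)) (\<lambda>z. - (1 / (Im z)\<^sup>2))"
    unfolding dir_C2_def
    by (intro conjI exI[of _ "\<lambda>z. 1 / Im z"])
       (auto intro!: continuous_intros derivative_eq_intros simp: power2_eq_square)
qed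

text \<open>The Laplacian of \<open>ln y\<close> is \<open>- 1 / y^2\<close>. Weighted by
  \<open>k / 2\<close> and divided by \<open>2 * pi\<close>, it is the source of the main
  term.\<close>

lemma
  fixes \<phi> L :: "complex \<Rightarrow> complex"
  assumes t: "C2_test K \<phi> L" and K: "K \<subseteq> {z. Im z > 0}"
  shows integral_log_Im_laplacian: "(LBINT z. ln (Im z) *\<^sub>R L z) = - (LBINT z. (1 / (Im z)\<^sup>2) *\<^sub>R \<phi> z)"
    and integrable_log_Im_laplacian: "integrable lborel (\<lambda>z. ln (Im z) *\<^sub>R L z)"
proof -
  have o: "open {z. Im z > 0}" by (intro open_Collect_less continuous_intros)
  have g: "(LBINT z. ln (Im z) *\<^sub>R L z) = (LBINT z. (- (1 / (Im z)\<^sup>2)) *\<^sub>R \<phi> z)"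
    "integrable lborel (\<lambda>z. ln (Im z) *\<^sub>R L z)"
    by (rule green[OF o K t dir_C2_log_Im]; simp)+
  then show "integrable lborel (\<lambda>z. ln (Im z) *\<^sub>R L z)" by blast
  show "(LBINT z. ln (Im z) *\<^sub>R L z) = - (LBINT z. (1 / (Im z)\<^sup>2) *\<^sub>R \<phi> z)"
    unfolding g(1) by simp
qed

section \<open>Smooth test functions\<close>

text \<open>Nothing is assumed of the test function off the upper half-plane, while Green's identity
  lives on the whole plane; arbitrary values there are replaced by 0.\<close>

definition extend_zero :: "complex set \<Rightarrow> (complex \<Rightarrow> complex) \<Rightarrow> complex \<Rightarrow> complex" where
  "extend_zero U g z = (if z \<in> U then g z else 0)"

lemma open_line_preimage:
  fixes z v :: complex
  assumes "open V"
  shows "open {t::real. z + t *\<^sub>R v \<in> V}"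
proof -
  have "open ((\<lambda>t::real. z + t *\<^sub>R v) -` V)"
    using assms by (intro open_vimage continuous_intros)
  then show ?thesis by (simp add: vimage_def)
qed

lemma has_vector_derivative_dir_deriv:
  assumes "g differentiable_on U" "open U" "z \<in> U"
  shows "((\<lambda>t::real. g (z + t *\<^sub>R v)) has_vector_derivative dir_deriv v g z) (at 0)"
proof -
  have "g differentiable at (z + 0 *\<^sub>R v)"
    using assms by (simp add: differentiable_on_eq_differentiable_at)
  moreover have "(\<lambda>t::real. z + t *\<^sub>R v) differentiable at 0"
    by (intro derivative_intros)
  ultimately have "(g \<circ> (\<lambda>t::real. z + t *\<^sub>R v)) differentiable at 0"
    by (intro differentiable_chain_at) auto
  then show ?thesis
    unfolding dir_deriv_def o_def by (simp add: vector_derivative_works)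
qed

lemma dir_deriv_eq_0:
  assumes "open V" "z \<in> V" "\<And>w. w \<in> V \<Longrightarrow> g w = 0"
  shows "dir_deriv v g z = 0"
proof -
  have "((\<lambda>t::real. g (z + t *\<^sub>R v)) has_vector_derivative 0) (at 0)"
  proof (rule has_vector_derivative_transform_within_open[OF _ open_line_preimage[OF assms(1)]])
    show "((\<lambda>t::real. 0::complex) has_vector_derivative 0) (at 0)" by (rule has_vector_derivative_const)
  qed (use assms in auto)
  then show ?thesis unfolding dir_deriv_def by (rule vector_derivative_at)
qed

lemma has_vector_derivative_extend_zero:
  assumes "g differentiable_on U" "open U" "compact K" "K \<subseteq> U" "\<And>z. z \<in> U - K \<Longrightarrow> g z = 0"
  shows "((\<lambda>t::real. extend_zero U g (z + t *\<^sub>R v)) has_vector_derivative extend_zero U (dir_deriv v g) z) (at 0)"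
proof (cases "z \<in> U")
  case True
  have "((\<lambda>t::real. g (z + t *\<^sub>R v)) has_vector_derivative extend_zero U (dir_deriv v g) z) (at 0)"
    using has_vector_derivative_dir_deriv[OF assms(1,2) True] True by (simp add: extend_zero_def)
  then show ?thesis
    by (rule has_vector_derivative_transform_within_open[OF _ open_line_preimage[OF assms(2)]])
       (use True in \<open>auto simp: extend_zero_def\<close>)
next
  case False
  have o: "open (- K)" using assms(3) by (auto simp: compact_imp_closed open_Compl)
  show ?thesis
  proof (rule has_vector_derivative_transform_within_open[OF _ open_line_preimage[OF o]])
    show "((\<lambda>t::real. 0::complex) has_vector_derivative extend_zero U (dir_deriv v g) z) (at 0)"
      using False by (simp add: extend_zero_def has_vector_derivative_const)
  qed (use False assms(4,5) in \<open>auto simp: extend_zero_def\<close>)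
qed

lemma continuous_on_extend_zero:
  assumes "g differentiable_on U" "open U" "compact K" "K \<subseteq> U" "\<And>z. z \<in> U - K \<Longrightarrow> g z = 0"
  shows "continuous_on UNIV (extend_zero U g)"
proof (rule continuous_on_zero_outside[OF _ assms(2-4)])
  have "continuous_on U g" using assms(1) by (rule differentiable_imp_continuous_on)
  then show "continuous_on U (extend_zero U g)"
    by (subst continuous_on_cong[of U U _ g]) (auto simp: extend_zero_def)
qed (use assms(5) in \<open>auto simp: extend_zero_def\<close>)

lemma dir_test_smooth:
  assumes "\<phi> differentiable_on U" "dir_deriv v \<phi> differentiable_on U" "dir_deriv v (dir_deriv v \<phi>) differentiable_on U"
    and U: "open U" "compact K" "K \<subseteq> U" and 0: "\<And>z. z \<in> U - K \<Longrightarrow> \<phi> z = 0"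
  shows "dir_test K v (extend_zero U \<phi>) (extend_zero U (dir_deriv v (dir_deriv v \<phi>)))"
proof -
  have o: "open (U - K)" using U by (auto simp: compact_imp_closed open_Diff)
  have 1: "dir_deriv v \<phi> z = 0" if "z \<in> U - K" for z
    using 0 by (rule dir_deriv_eq_0[OF o that])
  have 2: "dir_deriv v (dir_deriv v \<phi>) z = 0" if "z \<in> U - K" for z
    using 1 by (rule dir_deriv_eq_0[OF o that])
  show ?thesis
    unfolding dir_test_def
  proof (intro conjI exI[of _ "extend_zero U (dir_deriv v \<phi>)"] allI impI)
    show "continuous_on UNIV (extend_zero U \<phi>)" by (rule continuous_on_extend_zero[OF assms(1) U 0])
    show "continuous_on UNIV (extend_zero U (dir_deriv v \<phi>))" by (rule continuous_on_extend_zero[OF assms(2) U 1])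
    show "continuous_on UNIV (extend_zero U (dir_deriv v (dir_deriv v \<phi>)))" by (rule continuous_on_extend_zero[OF assms(3) U 2])
    fix z
    show "((\<lambda>t. extend_zero U \<phi> (z + t *\<^sub>R v)) has_vector_derivative extend_zero U (dir_deriv v \<phi>) z) (at 0)"
      by (rule has_vector_derivative_extend_zero[OF assms(1) U 0])
    show "((\<lambda>t. extend_zero U (dir_deriv v \<phi>) (z + t *\<^sub>R v)) has_vector_derivative
        extend_zero U (dir_deriv v (dir_deriv v \<phi>)) z) (at 0)"
      by (rule has_vector_derivative_extend_zero[OF assms(2) U 1])
  qed (use 0 1 2 in \<open>auto simp: extend_zero_def\<close>)
qed

lemma open_upper_half: "open upper_half"
  unfolding upper_half_def by (intro open_Collect_less continuous_intros)

text \<open>Dividing the hyperbolic Laplacian by \<open>- y^2\<close> gives the Euclidean one, so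
  the integral of its modulus against \<open>dx dy / y^2\<close> is the plain integral of
  \<open>|L|\<close>.\<close>

lemma C2_test_smooth:
  assumes "real_smooth_on upper_half \<phi>" "compactly_supported_in R \<phi>" "R \<subseteq> upper_half"
  defines "K \<equiv> closure (support_on upper_half \<phi>)"
  shows "C2_test K (extend_zero upper_half \<phi>) (extend_zero upper_half (\<lambda>z. - hyp_laplacian \<phi> z / of_real ((Im z)\<^sup>2)))"
    and "K \<subseteq> R" "\<And>z. z \<in> upper_half - K \<Longrightarrow> \<phi> z = 0"
proof -
  have K: "compact K" "K \<subseteq> R" "K \<subseteq> upper_half" using assms unfolding compactly_supported_in_def by auto
  show 0: "\<And>z. z \<in> upper_half - K \<Longrightarrow> \<phi> z = 0"
    using closure_subset[of "support_on upper_half \<phi>"] by (auto simp: K_def support_on_def)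
  show "K \<subseteq> R" by fact
  have d: "foldr dir_deriv vs \<phi> differentiable_on upper_half" if "set vs \<subseteq> {1, \<i>}" for vs
    using assms(1) that unfolding real_smooth_on_def by auto
  have t: "dir_test K v (extend_zero upper_half \<phi>) (extend_zero upper_half (dir_deriv v (dir_deriv v \<phi>)))" if "v \<in> {1, \<i>}" for v
    by (rule dir_test_smooth[OF _ _ _ open_upper_half K(1,3) 0])
       (use that d[of "[]"] d[of "[v]"] d[of "[v, v]"] in auto)
  have eq: "extend_zero upper_half (\<lambda>z. - hyp_laplacian \<phi> z / of_real ((Im z)\<^sup>2)) =
     (\<lambda>z. extend_zero upper_half (dir_deriv 1 (dir_deriv 1 \<phi>)) z + extend_zero upper_half (dir_deriv \<i> (dir_deriv \<i> \<phi>)) z)"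
    by (auto simp: fun_eq_iff extend_zero_def hyp_laplacian_def upper_half_def)
  show "C2_test K (extend_zero upper_half \<phi>) (extend_zero upper_half (\<lambda>z. - hyp_laplacian \<phi> z / of_real ((Im z)\<^sup>2)))"
    unfolding C2_test_def using K(1) t[of 1] t[of \<i>] eq by auto
qed

section \<open>Cusp forms\<close>

lemma connected_upper_half: "connected upper_half"
  unfolding upper_half_def by (intro convex_connected convex_halfspace_Im_gt)

lemma Im_neg_inverse: "Im (- 1 / z) = Im z / (cmod z)\<^sup>2"
  by (simp add: Im_divide cmod_power2)

lemma eventually_exp_decay_less:
  assumes "\<delta> > 0"
  obtains Y where "\<And>y. y \<ge> Y \<Longrightarrow> C * exp (- 2 * pi * y) < \<delta>"
proof -
  have "((\<lambda>y. C * exp (- 2 * pi * y)) \<longlongrightarrow> 0) at_top"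
    using pi_gt_zero by real_asymp
  then have "\<forall>\<^sub>F y in at_top. C * exp (- 2 * pi * y) < \<delta>"
    using assms by (rule order_tendstoD)
  then show ?thesis using that by (auto simp: eventually_at_top_linorder)
qed

text \<open>The sharp bound is half the square root of 3; the rational \<open>3/4\<close> keeps
  later arithmetic simple and works because \<open>(3/4)^2 <= 1 - 1/4\<close>.\<close>

lemma Im_ge_of_norm_ge_1:
  assumes "\<bar>Re z\<bar> \<le> 1 / 2" "1 \<le> cmod z" "Im z > 0"
  shows "3 / 4 \<le> Im z"
proof -
  have "1 \<le> (cmod z)\<^sup>2" using assms(2) by simp
  moreover have "(Re z)\<^sup>2 \<le> (1 / 2)\<^sup>2" using assms(1) by (simp add: abs_le_square_iff[symmetric])
  ultimately have "(3 / 4)\<^sup>2 \<le> (Im z)\<^sup>2" unfolding cmod_power2 by (simp add: power_divide)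
  then show ?thesis using assms(3) by (rule power2_le_imp_le[OF _ less_imp_le])
qed

lemma fund_domain_bounds:
  assumes "z \<in> fund_domain"
  shows "\<bar>Re z\<bar> \<le> 1 / 2" "3 / 4 \<le> Im z"
  using assms Im_ge_of_norm_ge_1[of z] by (auto simp: fund_domain_def upper_half_def)

lemma compact_strip: "compact {z. \<bar>Re z\<bar> \<le> a \<and> y1 \<le> Im z \<and> Im z \<le> y2}"
proof -
  have "{z. \<bar>Re z\<bar> \<le> a \<and> y1 \<le> Im z \<and> Im z \<le> y2} = cbox (Complex (- a) y1) (Complex a y2)"
    by (auto simp: cbox_def Basis_complex_def inner_complex_def abs_le_iff)
  then show ?thesis by (simp only: compact_cbox)
qed

lemma attains_sup_strip:
  fixes g :: "complex \<Rightarrow> real"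
  assumes "continuous_on upper_half g" "0 < y1" "y1 \<le> y2"
  obtains w where "\<bar>Re w\<bar> \<le> 1 / 2" "y1 \<le> Im w" "Im w \<le> y2"
    "\<And>z. \<bar>Re z\<bar> \<le> 1 / 2 \<Longrightarrow> y1 \<le> Im z \<Longrightarrow> Im z \<le> y2 \<Longrightarrow> g z \<le> g w"
proof -
  let ?Q = "{z. \<bar>Re z\<bar> \<le> 1/2 \<and> y1 \<le> Im z \<and> Im z \<le> y2}"
  have "\<exists>w\<in>?Q. \<forall>z\<in>?Q. g z \<le> g w"
  proof (rule continuous_attains_sup[OF compact_strip])
    show "?Q \<noteq> {}" using assms by (auto intro!: exI[of _ "Complex 0 y1"])
    show "continuous_on ?Q g"
      using assms by (intro continuous_on_subset[OF assms(1)]) (auto simp: upper_half_def)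
  qed
  then show ?thesis using that by blast
qed

section \<open>Modularity, behaviour at the cusp, maxima of the modulus\<close>

locale nonzero_cusp_form =
  fixes k :: nat and f :: "complex \<Rightarrow> complex"
  assumes cusp_form: "cusp_form k f" and nonzero: "\<exists>z\<in>upper_half. f z \<noteq> 0"
begin

lemma holo: "f holomorphic_on upper_half"
  using cusp_form by (simp add: cusp_form_def)

lemma modular: "a * d - b * c = (1::int) \<Longrightarrow> Im z > 0 \<Longrightarrow>
    f ((of_int a * z + of_int b) / (of_int c * z + of_int d)) = (of_int c * z + of_int d) ^ k * f z"
  using cusp_form unfolding cusp_form_def upper_half_def by blast

lemma periodic: "Im z > 0 \<Longrightarrow> f (z + of_int n) = f z"
  using modular[of 1 1 n 0 z] by simp

lemma inversion: "Im z > 0 \<Longrightarrow> f (- 1 / z) = z ^ k * f z"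
  using modular[of 0 0 "-1" 1 z] by simp

lemma cont: "continuous_on upper_half f"
  using holo by (rule holomorphic_on_imp_continuous_on)

lemma cont_norm: "continuous_on upper_half (\<lambda>z. cmod (f z))"
  by (intro continuous_intros cont)

lemma periodic_representative:
  assumes "Im z > 0"
  obtains w where "\<bar>Re w\<bar> \<le> 1 / 2" "Im w = Im z" "f w = f z" "\<exists>n. w = z + of_int n"
proof -
  have "\<bar>Re z - of_int (round (Re z))\<bar> \<le> 1 / 2"
    using of_int_round_abs_le[of "Re z"] by (simp add: abs_minus_commute)
  then show ?thesis
    using periodic[OF assms, of "- round (Re z)"]
    by (intro that[of "z + of_int (- round (Re z))"] exI[of _ "- round (Re z)"]) auto
qed

lemma even_weight: "even k"
proof (rule ccontr)
  assume "odd k"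
  obtain z where z: "Im z > 0" "f z \<noteq> 0" using nonzero by (auto simp: upper_half_def)
  have "f z = - f z" using modular[of "-1" "-1" 0 0 z] z \<open>odd k\<close> by simp
  then show False using z by simp
qed

text \<open>Convergence at \<open>\<i> / 2\<close> bounds the n-th coefficient by a constant times
  \<open>exp (pi * n)\<close>. For \<open>Im z >= 1\<close> each further term then gains a factor
  \<open>exp (pi - 2 * pi * Im z) <= 1/2\<close>, so the tail after the first nonzero coefficient is
  dominated by a geometric series.\<close>

lemma q_expansion_leading_term:
  obtains m q C where "q \<noteq> 0" "C \<ge> 0"
    "\<And>z. Im z \<ge> 1 \<Longrightarrow>
       cmod (f z - q * exp (2 * of_real pi * \<i> * z) ^ Suc m) \<le> C * exp (- 2 * pi * Im z) ^ Suc (Suc m)"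
proof -
  obtain q :: "nat \<Rightarrow> complex" where q: "\<And>z. Im z > 0 \<Longrightarrow>
        (\<lambda>n. q (Suc n) * exp (2 * of_real pi * \<i> * of_nat (Suc n) * z)) sums f z"
    using cusp_form unfolding cusp_form_def upper_half_def by auto
  define e where "e = (\<lambda>z. exp (2 * of_real pi * \<i> * z))"
  have e: "exp (2 * of_real pi * \<i> * of_nat (Suc n) * z) = e z ^ Suc n" for n z
    unfolding e_def exp_of_nat_mult[symmetric] by (simp only: mult_ac)
  have ne: "cmod (e z) = exp (- 2 * pi * Im z)" for z by (simp add: e_def)
  note q = q[unfolded e]
  have "\<exists>n. q (Suc n) \<noteq> 0"
  proof (rule ccontr)
    assume "\<nexists>n. q (Suc n) \<noteq> 0"
    then have "f z = 0" if "Im z > 0" for z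
      using q[OF that] sums_unique2[OF sums_zero] by fastforce
    then show False using nonzero by (auto simp: upper_half_def)
  qed
  define m where "m = (LEAST n. q (Suc n) \<noteq> 0)"
  have m: "q (Suc m) \<noteq> 0" using \<open>\<exists>n. q (Suc n) \<noteq> 0\<close> unfolding m_def by (rule LeastI_ex)
  have m0: "q (Suc n) = 0" if "n < m" for n using not_less_Least[of n] that unfolding m_def by blast
  have "summable (\<lambda>n. q (Suc n) * e (\<i> / 2) ^ Suc n)" using q[of "\<i> / 2"] by (auto simp: sums_iff)
  then have "Bseq (\<lambda>n. q (Suc n) * e (\<i> / 2) ^ Suc n)"
    by (intro convergent_imp_Bseq convergentI[of _ 0]) (rule summable_LIMSEQ_zero)
  then obtain M where M: "M > 0" "\<And>n. cmod (q (Suc n) * e (\<i> / 2) ^ Suc n) \<le> M"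
    by (auto simp: Bseq_def)
  have qM: "cmod (q (Suc n)) \<le> M * exp pi ^ Suc n" for n
  proof -
    have "cmod (q (Suc n)) * exp (- pi) ^ Suc n \<le> M"
      using M(2)[of n] by (simp add: norm_mult norm_power ne)
    then have "cmod (q (Suc n)) * exp (- pi) ^ Suc n * exp pi ^ Suc n \<le> M * exp pi ^ Suc n"
      by (rule mult_right_mono) simp
    moreover have "exp (- pi) ^ Suc n * exp pi ^ Suc n = (1::real)"
      unfolding power_mult_distrib[symmetric] by (simp add: exp_minus)
    ultimately show ?thesis by (simp only: mult.assoc mult_1_right)
  qed
  define C where "C = 2 * M * exp pi ^ Suc (Suc m)"
  have "cmod (f z - q (Suc m) * e z ^ Suc m) \<le> C * exp (- 2 * pi * Im z) ^ Suc (Suc m)" if z: "Im z \<ge> 1" for z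
  proof -
    define a where "a = (\<lambda>n. q (Suc n) * e z ^ Suc n)"
    define t where "t = exp pi * exp (- 2 * pi * Im z)"
    have t: "0 \<le> t" "t \<le> 1 / 2"
    proof -
      have "t = exp (pi - 2 * pi * Im z)" by (simp add: t_def exp_diff exp_minus field_simps)
      also have "\<dots> \<le> exp (- 1)" proof -
        have "2 * pi * 1 \<le> 2 * pi * Im z" using z by (intro mult_left_mono) auto
        then show ?thesis using pi_gt3 unfolding exp_le_cancel_iff by linarith
      qed
      also have "exp (- 1) \<le> 1 / (2::real)" using exp_ge_add_one_self[of 1] by (simp add: exp_minus field_simps)
      finally show "t \<le> 1 / 2" .
    qed (simp add: t_def)
    have "a sums f z" unfolding a_def using q[of z] z by simp
    from sums_split_initial_segment[OF this, of "Suc m"]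
    have "(\<lambda>n. a (n + Suc m)) sums (f z - (\<Sum>i<Suc m. a i))" .
    moreover have "(\<Sum>i<Suc m. a i) = q (Suc m) * e z ^ Suc m"
      using m0 by (simp add: a_def)
    ultimately have s: "(\<lambda>n. a (n + Suc m)) sums (f z - q (Suc m) * e z ^ Suc m)" by simp
    have b: "cmod (a (n + Suc m)) \<le> M * t ^ Suc (Suc m) * (1 / 2) ^ n" for n
    proof -
      have "cmod (a (n + Suc m)) \<le> M * exp pi ^ Suc (n + Suc m) * exp (- 2 * pi * Im z) ^ Suc (n + Suc m)"
        unfolding a_def norm_mult norm_power ne using qM by (rule mult_right_mono) simp
      also have "\<dots> = M * t ^ Suc (n + Suc m)"
        unfolding t_def power_mult_distrib by simp
      also have "Suc (n + Suc m) = Suc (Suc m) + n" by simp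
      also have "M * t ^ (Suc (Suc m) + n) = M * t ^ Suc (Suc m) * t ^ n"
        unfolding power_add by simp
      also have "\<dots> \<le> M * t ^ Suc (Suc m) * (1 / 2) ^ n"
        using t M(1) by (intro mult_left_mono power_mono) auto
      finally show ?thesis .
    qed
    have "cmod (suminf (\<lambda>n. a (n + Suc m))) \<le> (\<Sum>n. M * t ^ Suc (Suc m) * (1 / 2) ^ n)"
      by (rule norm_suminf_le[OF b]) (intro summable_mult summable_geometric, simp)
    also have "\<dots> = M * t ^ Suc (Suc m) * 2"
      by (subst suminf_mult) (auto simp: suminf_geometric intro!: summable_geometric)
    also have "\<dots> = C * exp (- 2 * pi * Im z) ^ Suc (Suc m)"
      by (simp add: C_def t_def power_mult_distrib)
    finally show ?thesis using sums_unique[OF s] by simp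
  qed
  moreover have "C \<ge> 0" using M(1) by (simp add: C_def)
  ultimately show ?thesis using that[of "q (Suc m)" C m] m unfolding e_def by blast
qed

lemma exponential_decay:
  obtains C where "C \<ge> 0" "\<And>z. Im z \<ge> 1 \<Longrightarrow> cmod (f z) \<le> C * exp (- 2 * pi * Im z)"
proof -
  obtain m q C where q: "C \<ge> 0" "\<And>z. Im z \<ge> 1 \<Longrightarrow>
       cmod (f z - q * exp (2 * of_real pi * \<i> * z) ^ Suc m) \<le> C * exp (- 2 * pi * Im z) ^ Suc (Suc m)"
    using q_expansion_leading_term by metis
  have "cmod (f z) \<le> (cmod q + C) * exp (- 2 * pi * Im z)" if z: "Im z \<ge> 1" for z
  proof -
    let ?w = "exp (- 2 * pi * Im z)"
    have w: "0 \<le> ?w" "?w \<le> 1" using z by auto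
    have pw: "?w ^ Suc n \<le> ?w" for n using w by (simp add: mult_left_le power_le_one del: exp_le_one_iff)
    have "cmod (f z) \<le> cmod (f z - q * exp (2 * of_real pi * \<i> * z) ^ Suc m) + cmod (q * exp (2 * of_real pi * \<i> * z) ^ Suc m)"
      using norm_triangle_ineq[of "f z - q * exp (2 * of_real pi * \<i> * z) ^ Suc m" "q * exp (2 * of_real pi * \<i> * z) ^ Suc m"] by simp
    also have "cmod (q * exp (2 * of_real pi * \<i> * z) ^ Suc m) = cmod q * ?w ^ Suc m"
      by (simp only: norm_mult norm_power) simp
    also have "cmod (f z - q * exp (2 * of_real pi * \<i> * z) ^ Suc m) + cmod q * ?w ^ Suc m \<le> C * ?w + cmod q * ?w"
      using q(2)[OF z] mult_left_mono[OF pw[of "Suc m"] q(1)] mult_left_mono[OF pw[of m] norm_ge_zero[of q]]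
      by linarith
    finally show ?thesis by (simp add: algebra_simps)
  qed
  then show ?thesis using that[of "cmod q + C"] q(1) by simp
qed

lemma no_zeros_near_cusp: obtains Y where "\<And>z. Im z \<ge> Y \<Longrightarrow> f z \<noteq> 0"
proof -
  obtain m q C where q: "q \<noteq> 0" "C \<ge> 0" "\<And>z. Im z \<ge> 1 \<Longrightarrow>
       cmod (f z - q * exp (2 * of_real pi * \<i> * z) ^ Suc m) \<le> C * exp (- 2 * pi * Im z) ^ Suc (Suc m)"
    using q_expansion_leading_term by metis
  from q(1) have "0 < cmod q" by simp
  then obtain Y where Y: "\<And>y. y \<ge> Y \<Longrightarrow> C * exp (- 2 * pi * y) < cmod q"
    by (rule eventually_exp_decay_less) (rule that)
  have "f z \<noteq> 0" if "Im z \<ge> max Y 1" for z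
  proof
    assume "f z = 0"
    let ?w = "exp (- 2 * pi * Im z)"
    have "cmod q * ?w ^ Suc m = cmod (q * exp (2 * of_real pi * \<i> * z) ^ Suc m)"
      by (simp only: norm_mult norm_power) simp
    also have "\<dots> \<le> C * ?w ^ Suc (Suc m)"
      using q(3)[of z] that \<open>f z = 0\<close> by simp
    also have "\<dots> = (C * ?w) * ?w ^ Suc m" by simp
    finally have "cmod q \<le> C * ?w" by (subst (asm) mult_le_cancel_right) auto
    then show False using Y[of "Im z"] that by simp
  qed
  then show ?thesis using that by blast
qed

lemma constant_imp_False: "\<not> f constant_on upper_half"
proof
  assume "f constant_on upper_half"
  then obtain c where c: "\<And>z. Im z > 0 \<Longrightarrow> f z = c" by (auto simp: constant_on_def upper_half_def)
  obtain C where C: "\<And>z. Im z \<ge> 1 \<Longrightarrow> cmod (f z) \<le> C * exp (- 2 * pi * Im z)"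
    using exponential_decay by metis
  have "0 < cmod c" using c nonzero by (auto simp: upper_half_def)
  then obtain Y where Y: "\<And>y. y \<ge> Y \<Longrightarrow> C * exp (- 2 * pi * y) < cmod c"
    by (rule eventually_exp_decay_less) (rule that)
  show False using Y[of "max Y 1"] C[of "Complex 0 (max Y 1)"] c[of "Complex 0 (max Y 1)"] by simp
qed

lemma no_interior_maximum:
  assumes "Y > 0" "Im w > Y" "\<And>z. Im z > Y \<Longrightarrow> cmod (f z) \<le> cmod (f w)"
  shows False
proof -
  have "f constant_on upper_half"
  proof (rule maximum_modulus_principle[OF holo open_upper_half connected_upper_half])
    show "open {z. Im z > Y}" by (intro open_Collect_less continuous_intros)
    show "{z. Im z > Y} \<subseteq> upper_half" using assms(1) by (auto simp: upper_half_def)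
    show "w \<in> {z. Im z > Y}" using assms(2) by simp
  qed (use assms(3) in auto)
  then show False using constant_imp_False by blast
qed

text \<open>This is the maximum principle on an unbounded region: periodicity makes the real
  direction compact and exponential decay controls the cusp.\<close>

lemma maximum_on_horizontal_line:
  assumes Y: "Y > 0"
  obtains w where "\<bar>Re w\<bar> \<le> 1 / 2" "Im w = Y" "\<And>z. Im z \<ge> Y \<Longrightarrow> cmod (f z) \<le> cmod (f w)"
proof -
  obtain w where w: "\<bar>Re w\<bar> \<le> 1 / 2" "Im w = Y"
    "\<And>z. \<bar>Re z\<bar> \<le> 1 / 2 \<Longrightarrow> Im z = Y \<Longrightarrow> cmod (f z) \<le> cmod (f w)"
    using attains_sup_strip[OF cont_norm Y order_refl] by (metis order_antisym order_refl)
  have "cmod (f z1) \<le> cmod (f w)" if z1: "Im z1 \<ge> Y" for z1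
  proof (rule ccontr)
    assume gt: "\<not> cmod (f z1) \<le> cmod (f w)"
    obtain C where C: "\<And>z. Im z \<ge> 1 \<Longrightarrow> cmod (f z) \<le> C * exp (- 2 * pi * Im z)" "C \<ge> 0"
      using exponential_decay by metis
    have pos: "0 < cmod (f z1)" using gt norm_ge_zero[of "f w"] by linarith
    then obtain Y0 where Y0: "\<And>y. y \<ge> Y0 \<Longrightarrow> C * exp (- 2 * pi * y) < cmod (f z1)"
      by (rule eventually_exp_decay_less) (rule that)
    \<comment> \<open>Above this height \<open>|f|\<close> stays below \<open>|f z1|\<close>, so the
      maximum over the compact strip is a maximum over all of \<open>Im z >= Y\<close>.\<close>
    define Y1 where "Y1 = max (max Y0 1) (Im z1)"
    have "Y \<le> Y1" using z1 by (simp add: Y1_def)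
    from Y this obtain z2 where z2: "\<bar>Re z2\<bar> \<le> 1 / 2" "Y \<le> Im z2" "Im z2 \<le> Y1"
      "\<And>z. \<bar>Re z\<bar> \<le> 1 / 2 \<Longrightarrow> Y \<le> Im z \<Longrightarrow> Im z \<le> Y1 \<Longrightarrow> cmod (f z) \<le> cmod (f z2)"
      by (rule attains_sup_strip[OF cont_norm]) (rule that)
    have le: "cmod (f z) \<le> cmod (f z2)" if "Y \<le> Im z" "Im z \<le> Y1" for z
    proof -
      have "Im z > 0" using that Y by simp
      then obtain v where "\<bar>Re v\<bar> \<le> 1 / 2" "Im v = Im z" "f v = f z" by (rule periodic_representative)
      then show ?thesis using z2(4)[of v] that by simp
    qed
    have z12: "cmod (f z1) \<le> cmod (f z2)" using le[of z1] z1 by (simp add: Y1_def)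
    have "cmod (f z) \<le> cmod (f z2)" if "Im z > Y" for z
    proof (cases "Im z \<le> Y1")
      case False
      then have "Im z \<ge> 1" "Im z \<ge> Y0" by (auto simp: Y1_def)
      then have "cmod (f z) < cmod (f z1)" using C(1)[of z] Y0[of "Im z"] by linarith
      then show ?thesis using z12 by simp
    qed (use le that in auto)
    moreover have "Im z2 \<noteq> Y" using w(3)[of z2] z2(1) z12 gt by auto
    ultimately show False using no_interior_maximum[OF Y, of z2] z2(2) by auto
  qed
  then show ?thesis using that w by blast
qed

lemma finite_zeros_fund_domain: "finite {w \<in> fund_domain. f w = 0}"
proof -
  obtain Y where Y: "\<And>z. Im z \<ge> Y \<Longrightarrow> f z \<noteq> 0" using no_zeros_near_cusp by metis
  let ?Q = "{z. \<bar>Re z\<bar> \<le> 1/2 \<and> 1/2 \<le> Im z \<and> Im z \<le> Y}"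
  have "finite {z \<in> ?Q. f z = 0}"
    by (rule holomorphic_compact_finite_zeros[OF holo open_upper_half connected_upper_half compact_strip _ constant_imp_False])
       (auto simp: upper_half_def)
  moreover have "{w \<in> fund_domain. f w = 0} \<subseteq> {z \<in> ?Q. f z = 0}"
  proof
    fix w assume "w \<in> {w \<in> fund_domain. f w = 0}"
    then show "w \<in> {z \<in> ?Q. f z = 0}" using fund_domain_bounds[of w] Y[of w] by force
  qed
  ultimately show ?thesis by (rule rev_finite_subset)
qed

text \<open>The maximum over \<open>Im z >= 1/2\<close> sits on the boundary line, too low for the
  large disc. There \<open>1/4 <= |w|^2 <= 1/2\<close>, so the inversion lifts the point to height
  between 1 and 2, and the automorphy factor \<open>|w|^k\<close> costs at most
  \<open>2^k\<close>.\<close>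

lemma crude_size_bounds:
  obtains w m where "m > 0" "\<bar>Re w\<bar> \<le> 1 / 2" "1 \<le> Im w" "Im w \<le> 2"
    "\<And>z. Im z \<ge> 1 / 2 \<Longrightarrow> cmod (f z) \<le> m" "cmod (f w) \<ge> m / 2 ^ k"
proof -
  obtain w where w: "\<bar>Re w\<bar> \<le> 1 / 2" "Im w = 1 / 2" "\<And>z. Im z \<ge> 1 / 2 \<Longrightarrow> cmod (f z) \<le> cmod (f w)"
    by (rule maximum_on_horizontal_line[of "1 / 2"]) auto
  have "(Re w)\<^sup>2 \<le> (1 / 2)\<^sup>2" using w(1) by (simp add: abs_le_square_iff[symmetric])
  then have w2: "(cmod w)\<^sup>2 \<le> 1 / 2" "1 / 4 \<le> (cmod w)\<^sup>2" unfolding cmod_power2 w(2) by (auto simp: power2_eq_square)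
  have w0: "w \<noteq> 0" using w(2) by auto
  then have I: "1 \<le> Im (- 1 / w)" "Im (- 1 / w) \<le> 2"
    using w2 w(2) unfolding Im_neg_inverse by (simp_all add: field_simps)
  have m0: "cmod (f w) > 0"
  proof (rule ccontr)
    assume "\<not> cmod (f w) > 0"
    then have z: "f z = 0" if "Im z \<ge> 1 / 2" for z using w(3)[OF that] by simp
    obtain z0 where z0: "z0 \<in> upper_half" "f z0 \<noteq> 0" using nonzero by blast
    have "f z0 = 0"
    proof (rule analytic_continuation_open[of "{z. Im z > 1 / 2}" upper_half f "\<lambda>_. 0"])
      show "open {z. Im z > 1 / 2}" by (intro open_Collect_less continuous_intros)
      show "{z. Im z > 1 / 2} \<noteq> {}" by (auto intro!: exI[of _ \<i>])
      show "{z. Im z > 1 / 2} \<subseteq> upper_half" by (auto simp: upper_half_def)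
    qed (use z z0 holo open_upper_half connected_upper_half in auto)
    then show False using z0 by simp
  qed
  have "1 / 2 \<le> cmod w" using abs_Im_le_cmod[of w] w(2) by simp
  then have "(1 / 2) ^ k * cmod (f w) \<le> cmod w ^ k * cmod (f w)"
    by (intro mult_right_mono power_mono) auto
  also have "\<dots> = cmod (f (- 1 / w))" using inversion[of w] w(2) by (simp add: norm_mult norm_power)
  finally have b: "cmod (f w) / 2 ^ k \<le> cmod (f (- 1 / w))" by (simp add: power_divide)
  have "Im (- 1 / w) > 0" using I by linarith
  then obtain v where "\<bar>Re v\<bar> \<le> 1 / 2" "Im v = Im (- 1 / w)" "f v = f (- 1 / w)" by (rule periodic_representative)
  then show ?thesis using that[of "cmod (f w)" v] m0 I b w(3) by simp
qed

text \<open>In weight 0 the loss \<open>2^k\<close> of \<open>crude_size_bounds\<close> is 1, so the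
  maximum over \<open>Im z >= 1/2\<close> would be attained at an interior point.\<close>

lemma weight_ge_2: "k \<ge> 2"
proof (rule ccontr)
  assume "\<not> k \<ge> 2"
  then have k0: "k = 0" using even_weight by (cases k) (auto, presburger)
  obtain w m where w: "m > 0" "\<bar>Re w\<bar> \<le> 1 / 2" "1 \<le> Im w" "Im w \<le> 2"
    "\<And>z. Im z \<ge> 1 / 2 \<Longrightarrow> cmod (f z) \<le> m" "cmod (f w) \<ge> m / 2 ^ k"
    by (rule crude_size_bounds) (rule that)
  have "cmod (f z) \<le> cmod (f w)" if "Im z > 1 / 2" for z
    using w(5)[of z] w(6) that k0 by simp
  then show False using no_interior_maximum[of "1 / 2" w] w(3) by simp
qed

end

section \<open>The sup norm bound that follows from the normalization\<close>

context nonzero_cusp_form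
begin

text \<open>
  Among the points where \<open>y\<^sup>k \<bar>f\<bar>\<^sup>2\<close> is maximal, the highest one lies in the closed fundamental
  domain, since an inversion would move it up otherwise. By Cauchy's estimate the function keeps a
  fixed proportion of its maximum on a square of side of order \<open>1/k\<close> inside the fundamental domain.
\<close>

lemma sup_bound:
  assumes norm: "hyp_integral fund_domain (\<lambda>z. (Im z) ^ k * (cmod (f z))\<^sup>2) = 1"
    and B: "B \<ge> 2" and z: "1 / 2 \<le> Im z" "Im z \<le> B"
  shows "(Im z) ^ k * (cmod (f z))\<^sup>2 \<le> (144 * (B + 1) * k)\<^sup>2"
proof -
  define V where "V = (\<lambda>z. (Im z) ^ k * (cmod (f z))\<^sup>2)"
  let ?Q = "{z. \<bar>Re z\<bar> \<le> 1/2 \<and> 1/2 \<le> Im z \<and> Im z \<le> B}"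
  have cV: "continuous_on ?Q V"
    unfolding V_def by (intro continuous_intros continuous_on_subset[OF cont]) (auto simp: upper_half_def)
  have "\<exists>w\<in>?Q. \<forall>z\<in>?Q. V z \<le> V w"
  proof (rule continuous_attains_sup[OF compact_strip _ cV])
    show "?Q \<noteq> {}" using B by (auto intro!: exI[of _ \<i>])
  qed
  then obtain zq where zq: "zq \<in> ?Q" "\<And>z. z \<in> ?Q \<Longrightarrow> V z \<le> V zq" by blast
  define N where "N = V zq"
  have VN: "V z \<le> N" if "1 / 2 \<le> Im z" "Im z \<le> B" for z
  proof -
    have "Im z > 0" using that by simp
    then obtain v where "\<bar>Re v\<bar> \<le> 1 / 2" "Im v = Im z" "f v = f z" by (rule periodic_representative)
    then show ?thesis using zq(2)[of v] that by (simp add: V_def N_def)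
  qed
  have "closed (?Q \<inter> V -` {N})"
    by (intro continuous_closed_preimage[OF cV] compact_imp_closed[OF compact_strip]) auto
  then have "compact (?Q \<inter> (?Q \<inter> V -` {N}))" by (rule compact_Int_closed[OF compact_strip])
  then have "compact (?Q \<inter> V -` {N})" by (simp add: Int_assoc[symmetric])
  moreover have "?Q \<inter> V -` {N} \<noteq> {}" using zq by (auto simp: N_def)
  moreover have "continuous_on (?Q \<inter> V -` {N}) Im" by (intro continuous_intros)
  ultimately have "\<exists>x\<in>?Q \<inter> V -` {N}. \<forall>y\<in>?Q \<inter> V -` {N}. Im y \<le> Im x"
    by (intro continuous_attains_sup)
  then obtain p where p: "\<bar>Re p\<bar> \<le> 1/2" "1/2 \<le> Im p" "Im p \<le> B" "V p = N"
    and pmax: "\<And>z. z \<in> ?Q \<Longrightarrow> V z = N \<Longrightarrow> Im z \<le> Im p"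
    by auto
  have p0: "Im p > 0" using p by simp
  have p1: "1 \<le> cmod p"
  proof (rule ccontr)
    assume lt: "\<not> 1 \<le> cmod p"
    have pp: "0 < cmod p" "Im p \<le> cmod p" using p0 abs_Im_le_cmod[of p] by auto
    have sq: "(cmod p)\<^sup>2 < 1" using lt pp by (simp add: abs_square_less_1)
    have I: "Im (- 1 / p) = Im p / (cmod p)\<^sup>2" by (rule Im_neg_inverse)
    have gt: "Im (- 1 / p) > Im p" unfolding I using sq pp p0 by (simp add: field_simps)
    \<comment> \<open>The inverted point must stay in the strip over which \<open>N\<close> is the
      maximum: \<open>|p| >= 1/2\<close> keeps it at height at most \<open>2 <= B\<close>.\<close>
    have "Im p / (cmod p)\<^sup>2 \<le> cmod p / (cmod p)\<^sup>2" using pp by (intro divide_right_mono) auto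
    also have "\<dots> = 1 / cmod p" using pp by (simp add: power2_eq_square)
    also have "\<dots> \<le> 1 / (1 / 2)" using pp p by (intro divide_left_mono) auto
    finally have le: "Im (- 1 / p) \<le> B" unfolding I using B by simp
    have "Im (- 1 / p) > 0" using gt p0 by linarith
    then obtain v where v: "\<bar>Re v\<bar> \<le> 1 / 2" "Im v = Im (- 1 / p)" "f v = f (- 1 / p)" by (rule periodic_representative)
    have "V v = V p"
    proof -
      have "V v = (Im p / (cmod p)\<^sup>2) ^ k * (cmod p ^ k * cmod (f p))\<^sup>2"
        unfolding V_def v(2,3) I inversion[OF p0] by (simp add: norm_mult norm_power)
      also have "\<dots> = V p"
        using pp by (simp add: V_def power_divide power_mult_distrib power_mult[symmetric] mult.commute[of 2 k])
      finally show ?thesis .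
    qed
    then have "Im v \<le> Im p" using pmax[of v] v gt le p by simp
    then show False using gt v by simp
  qed
  have "1 \<le> (cmod p)\<^sup>2" using p1 by simp
  have p34: "3 / 4 \<le> Im p" using p(1) p1 p0 by (rule Im_ge_of_norm_ge_1)
  \<comment> \<open>Over this distance the factor \<open>y^k\<close> drops by at most one half, by
    Bernoulli's inequality and \<open>Im p >= 3/4\<close>.\<close>
  define r where "r = 1 / (4 * real k)"
  have k2: "real k \<ge> 2" using weight_ge_2 by simp
  have r: "0 < r" "r \<le> 1 / 8" using k2 by (auto simp: r_def field_simps)
  have up: "cmod (f w) \<le> 3 / 2 * cmod (f p)" if w: "cmod (w - p) \<le> r" for w
  proof -
    have iw: "Im p - r \<le> Im w" using abs_Im_le_cmod[of "w - p"] w by simp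
    \<comment> \<open>The bound \<open>VN\<close> ends at height \<open>B\<close>, while
      \<open>w\<close> may lie higher. In that case \<open>w\<close> is traded for a point on the
      line at height \<open>B\<close> where \<open>|f|\<close> is at least as large.\<close>
    obtain v where v: "cmod (f w) \<le> cmod (f v)" "1/2 \<le> Im v" "Im v \<le> B" "Im p - r \<le> Im v"
    proof (cases "Im w \<le> B")
      case True
      then show ?thesis using that[of w] iw p34 r by simp
    next
      case False
      have "B > 0" using B by simp
      then obtain v where "\<bar>Re v\<bar> \<le> 1 / 2" "Im v = B" "\<And>z. Im z \<ge> B \<Longrightarrow> cmod (f z) \<le> cmod (f v)"
        by (rule maximum_on_horizontal_line) (rule that)
      then show ?thesis using that[of v] False B p(3) r by simp
    qed
    have "1 + real k * (- (r / Im p)) \<le> (1 + (- (r / Im p))) ^ k"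
      using r p34 by (intro Bernoulli_inequality) (simp add: field_simps)
    moreover have "real k * (r / Im p) \<le> 1 / 2" using k2 p34 by (simp add: r_def field_simps)
    ultimately have "1 / 2 \<le> (1 - r / Im p) ^ k" by simp
    then have "Im p ^ k * (1 / 2) \<le> Im p ^ k * (1 - r / Im p) ^ k" using p0 by (intro mult_left_mono) auto
    also have "\<dots> = (Im p - r) ^ k" using p0 by (simp add: power_mult_distrib[symmetric] field_simps)
    also have "\<dots> \<le> Im v ^ k" using v p34 r by (intro power_mono) auto
    finally have "Im p ^ k * (1 / 2) * (cmod (f v))\<^sup>2 \<le> Im v ^ k * (cmod (f v))\<^sup>2" by (rule mult_right_mono) simp
    also have "\<dots> \<le> Im p ^ k * (cmod (f p))\<^sup>2" using VN[OF v(2,3)] p(4) by (simp add: V_def)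
    finally have "Im p ^ k * ((cmod (f v))\<^sup>2 / 2) \<le> Im p ^ k * (cmod (f p))\<^sup>2" by simp
    then have "(cmod (f v))\<^sup>2 \<le> 2 * (cmod (f p))\<^sup>2" using p0 by (subst (asm) mult_le_cancel_left_pos) auto
    also have "\<dots> \<le> (3 / 2 * cmod (f p))\<^sup>2" by (simp add: power_mult_distrib power2_eq_square)
    finally have "cmod (f v) \<le> 3 / 2 * cmod (f p)" by (rule power2_le_imp_le) simp
    then show ?thesis using v(1) by simp
  qed
  have sub: "w \<in> upper_half" if "cmod (w - p) \<le> r" for w
    using abs_Im_le_cmod[of "w - p"] that p34 r by (simp add: upper_half_def)
  have der: "cmod (deriv f w) \<le> 3 * cmod (f p) / r" if w: "cmod (w - p) \<le> r / 2" for w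
  proof -
    have ss: "cmod (v - p) \<le> r" if "v \<in> cball w (r / 2)" for v
      using norm_triangle_ineq[of "v - w" "w - p"] that w by (simp add: dist_norm norm_minus_commute)
    have "cmod ((deriv ^^ 1) f w) \<le> fact 1 * (3 / 2 * cmod (f p)) / (r / 2) ^ 1"
    proof (rule Cauchy_inequality)
      show "f holomorphic_on ball w (r / 2)"
        by (rule holomorphic_on_subset[OF holo]) (use sub ss in force)
      show "continuous_on (cball w (r / 2)) f"
        by (rule continuous_on_subset[OF cont]) (use sub ss in blast)
      fix x assume "cmod (w - x) = r / 2"
      then show "cmod (f x) \<le> 3 / 2 * cmod (f p)" by (intro up ss) (simp add: dist_norm)
    qed (use r in simp)
    then show ?thesis by simp
  qed
  have low: "cmod (f p) / 2 \<le> cmod (f w)" if w: "cmod (w - p) \<le> r / 6" for w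
  proof -
    have "cmod (f w - f p) \<le> 3 * cmod (f p) / r * cmod (w - p)"
    proof (rule field_differentiable_bound[of "cball p (r / 2)" f "deriv f"])
      fix v assume "v \<in> cball p (r / 2)"
      then have v: "cmod (v - p) \<le> r / 2" by (simp add: dist_norm norm_minus_commute)
      then have "v \<in> upper_half" using sub[of v] r by simp
      then show "(f has_field_derivative deriv f v) (at v within cball p (r / 2))"
        using holomorphic_derivI[OF holo open_upper_half] has_field_derivative_at_within by blast
      show "cmod (deriv f v) \<le> 3 * cmod (f p) / r" using der[OF v] .
    qed (use w r in \<open>auto simp: dist_norm norm_minus_commute\<close>)
    also have "\<dots> \<le> 3 * cmod (f p) / r * (r / 6)" using w r by (intro mult_left_mono) auto
    also have "\<dots> = cmod (f p) / 2" using r by simp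
    finally show ?thesis using norm_triangle_ineq2[of "f p" "f w"] by (simp add: norm_minus_commute)
  qed
  \<comment> \<open>The square built from \<open>d\<close> reaches at most \<open>d\<close> sideways
    and \<open>2 * d\<close> upwards from \<open>p\<close>, hence stays within
    \<open>3 * d = r / 6\<close>, where \<open>low\<close> applies.\<close>
  define d where "d = r / 18"
  have d: "0 < d" "d \<le> 1 / 144" using r by (auto simp: d_def)
  \<comment> \<open>The square extends from \<open>p\<close> towards the imaginary axis, which keeps
    it in the strip \<open>- 1/2 <= Re w < 1/2\<close> even when \<open>p\<close> lies on the
    boundary.\<close>
  define a where "a = (if Re p \<le> 0 then Re p else Re p - d)"
  define X where "X = box (Complex a (Im p + d)) (Complex (a + d) (Im p + 2 * d))"
  have X: "a < Re w" "Re w < a + d" "Im p + d < Im w" "Im w < Im p + 2 * d" if "w \<in> X" for w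
    using that by (auto simp: X_def box_def Basis_complex_def inner_complex_def)
  have Xp: "cmod (w - p) \<le> r / 6" if "w \<in> X" for w
  proof -
    have "cmod (w - p) \<le> \<bar>Re (w - p)\<bar> + \<bar>Im (w - p)\<bar>" by (rule cmod_le)
    also have "\<dots> \<le> d + 2 * d" using X[OF that] d by (intro add_mono) (auto simp: a_def split: if_splits)
    finally show ?thesis by (simp add: d_def)
  qed
  have XF: "w \<in> fund_domain" if "w \<in> X" for w
  proof -
    define s where "s = Re w - Re p"
    define t where "t = Im w - Im p"
    have st: "d \<le> t" "\<bar>s\<bar> \<le> d" using X[OF that] by (auto simp: s_def t_def a_def split: if_splits)
    \<comment> \<open>The square is moved up by at least as much as it extends sideways, and
      \<open>Im p >= |Re p|\<close>; so moving from \<open>p\<close> into it does not decrease the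
      modulus below 1.\<close>
    have "\<bar>Re p\<bar> * \<bar>s\<bar> \<le> Im p * t" using st d p p34 by (intro mult_mono) auto
    moreover have "- (Re p * s) \<le> \<bar>Re p\<bar> * \<bar>s\<bar>" by (metis abs_ge_minus_self abs_mult)
    ultimately have "0 \<le> Re p * s + Im p * t" by linarith
    then have 0: "0 \<le> 2 * (Re p * s + Im p * t)" by (rule mult_nonneg_nonneg[rotated]) simp
    have "(cmod w)\<^sup>2 = (Re p + s)\<^sup>2 + (Im p + t)\<^sup>2" by (simp add: cmod_power2 s_def t_def)
    also have "\<dots> = (cmod p)\<^sup>2 + 2 * (Re p * s + Im p * t) + s\<^sup>2 + t\<^sup>2"
      unfolding cmod_power2 by (simp add: power2_eq_square algebra_simps)
    finally have "1 \<le> (cmod w)\<^sup>2"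
      by (intro order_trans[OF \<open>1 \<le> (cmod p)\<^sup>2\<close>]) (simp only: add.assoc le_add_same_cancel1, intro add_nonneg_nonneg 0 zero_le_power2)
    then have "1 \<le> cmod w" by (simp add: power2_nonneg_ge_1_iff)
    moreover have "- 1 / 2 \<le> Re w \<and> Re w < 1 / 2" using X[OF that] p(1) d by (auto simp: a_def split: if_splits)
    moreover have "0 < Im w" using X[OF that] p0 d by simp
    ultimately show ?thesis by (simp add: fund_domain_def upper_half_def)
  qed
  have low_V: "N / 4 / (B + 1)\<^sup>2 \<le> 1 / (Im w)\<^sup>2 * V w" if "w \<in> X" for w
  proof -
    have iw: "Im p \<le> Im w" "Im w \<le> B + 1" using X[OF that] d p(3) by auto
    have "N / 4 = Im p ^ k * (cmod (f p) / 2)\<^sup>2" using p(4) by (simp add: V_def power_divide)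
    also have "\<dots> \<le> V w" unfolding V_def using low[OF Xp[OF that]] iw p0
      by (intro mult_mono power_mono) auto
    finally have 1: "N / 4 \<le> V w" .
    have "0 \<le> V w" using iw p0 by (simp add: V_def)
    then have "V w / (B + 1)\<^sup>2 \<le> V w / (Im w)\<^sup>2"
      using iw p0 by (intro divide_left_mono power_mono mult_pos_pos) auto
    moreover have "N / 4 / (B + 1)\<^sup>2 \<le> V w / (B + 1)\<^sup>2" using 1 by (rule divide_right_mono) simp
    ultimately show ?thesis by simp
  qed
  let ?F = "\<lambda>z. indicator fund_domain z *\<^sub>R ((1 / (Im z)\<^sup>2) *\<^sub>R V z)"
  have int: "integral\<^sup>L lborel ?F = 1"
    using norm by (simp add: hyp_integral_def set_lebesgue_integral_def V_def)
  \<comment> \<open>A function that is not integrable has the default integral 0, so the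
    normalization to 1 forces integrability.\<close>
  then have iF: "integrable lborel ?F" using not_integrable_integral_eq by force
  have emX: "emeasure lborel X = ennreal (d * d)"
    unfolding X_def using d by (subst emeasure_lborel_box) (auto simp: Basis_complex_def inner_complex_def)
  have "(LBINT w. indicator X w * (N / 4 / (B + 1)\<^sup>2)) \<le> integral\<^sup>L lborel ?F"
  proof (rule integral_mono[OF _ iF])
    have "integrable lborel (indicator X :: complex \<Rightarrow> real)"
      using emX by (intro integrable_real_indicator) (auto simp: X_def)
    then show "integrable lborel (\<lambda>w. indicator X w * (N / 4 / (B + 1)\<^sup>2))"
      by (intro integrable_mult_left) auto
    fix w
    show "indicator X w * (N / 4 / (B + 1)\<^sup>2) \<le> ?F w"
    proof (cases "w \<in> X")
      case True
      then show ?thesis using low_V[OF True] XF[OF True] by simp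
    next
      case False
      have "0 \<le> V w" if "w \<in> fund_domain" using that by (simp add: V_def fund_domain_def upper_half_def)
      then show ?thesis using False by (simp add: indicator_def)
    qed
  qed
  moreover have "(LBINT w. indicator X w * (N / 4 / (B + 1)\<^sup>2)) = d * d * (N / 4 / (B + 1)\<^sup>2)"
  proof -
    have "measure lborel X = d * d" using emX d by (simp add: measure_def)
    moreover have "integral\<^sup>L lborel (indicator X :: complex \<Rightarrow> real) = measure lborel X" by simp
    ultimately show ?thesis by (simp only: integral_mult_left_zero)
  qed
  ultimately have "d * d * (N / 4 / (B + 1)\<^sup>2) \<le> 1" by (simp only: int)
  \<comment> \<open>Here \<open>72 = 4 * 18\<close>. The quarter lost in passing from
    \<open>|f p|^2\<close> to \<open>(|f p| / 2)^2\<close> turns \<open>d^2\<close> into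
    \<open>1 / (144 * k)^2\<close>.\<close>
  moreover have dk: "d = 1 / (72 * real k)" by (simp add: d_def r_def)
  moreover have "d * d * (N / 4 / (B + 1)\<^sup>2) = N / (144 * (B + 1) * k)\<^sup>2"
  proof -
    have "1 / (72 * real k) * (1 / (72 * real k)) * (N / 4 / b\<^sup>2) = N / (144 * b * k)\<^sup>2" for b
      by (simp add: power_mult_distrib power2_eq_square)
    then show ?thesis unfolding dk .
  qed
  ultimately have "N / (144 * (B + 1) * k)\<^sup>2 \<le> 1" by argo
  moreover have "0 < (144 * (B + 1) * real k)\<^sup>2" using B k2 by simp
  ultimately have "N \<le> 1 * (144 * (B + 1) * k)\<^sup>2" by (simp only: pos_divide_le_eq)
  then have "N \<le> (144 * (B + 1) * k)\<^sup>2" unfolding mult_1 .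
  then show ?thesis using VN[OF z] by (simp add: V_def)
qed

end

section \<open>The error term as an integral\<close>

definition discrepancy :: "nat \<Rightarrow> (complex \<Rightarrow> complex) \<Rightarrow> (complex \<Rightarrow> complex) \<Rightarrow> real" where
  "discrepancy k f \<phi> =
     cmod (zero_sum f \<phi> - of_real (real k / 12 * (3 / pi)) * hyp_integral fund_domain \<phi>)"

locale zero_statistics = nonzero_cusp_form +
  fixes B :: real and R :: "complex set" and \<phi> :: "complex \<Rightarrow> complex"
  assumes B: "B > 1" and R: "R \<subseteq> {z \<in> fund_domain. Im z \<le> B}"
    and smooth: "real_smooth_on upper_half \<phi>" and supp: "compactly_supported_in R \<phi>"
begin

definition K where "K = closure (support_on upper_half \<phi>)"

definition L where "L = extend_zero upper_half (\<lambda>z. - hyp_laplacian \<phi> z / of_real ((Im z)\<^sup>2))"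

lemma R_upper: "R \<subseteq> upper_half" using R by (auto simp: fund_domain_def)

lemma test: "C2_test K (extend_zero upper_half \<phi>) L"
  unfolding K_def L_def by (rule C2_test_smooth(1)[OF smooth supp R_upper])

lemma K_R: "K \<subseteq> R"
  unfolding K_def by (rule C2_test_smooth(2)[OF smooth supp R_upper])

lemma phi_zero: "z \<in> upper_half \<Longrightarrow> z \<notin> K \<Longrightarrow> \<phi> z = 0"
  using C2_test_smooth(3)[OF smooth supp R_upper, of z] by (auto simp: K_def)

lemmas test_facts = C2_testD[OF test]

lemma K_bounds: "z \<in> K \<Longrightarrow> \<bar>Re z\<bar> \<le> 1 / 2 \<and> 3 / 4 \<le> Im z \<and> Im z \<le> B \<and> z \<in> fund_domain"
  using K_R R fund_domain_bounds by blast

text \<open>A disc about this point of radius \<open>B + 2 - y\<close> has its lowest point at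
  height \<open>y\<close>. The heights 5/8, 9/16 and 1/2 give nested discs in the upper half-plane:
  the smallest contains the rectangle up to height \<open>B + 1\<close>, the middle one carries the
  modulus bound, the largest gives holomorphy with room to spare.\<close>

definition centre where "centre = Complex 0 (B + 2)"

lemma in_disc:
  assumes "\<bar>Re z\<bar> \<le> 1 / 2" "3 / 4 \<le> Im z" "Im z \<le> B + 1"
  shows "cmod (z - centre) < B + 2 - 5 / 8"
proof -
  have "(cmod (z - centre))\<^sup>2 = (Re z)\<^sup>2 + (B + 2 - Im z)\<^sup>2"
    unfolding cmod_power2 by (simp add: centre_def power2_commute)
  also have "\<dots> \<le> (1 / 2)\<^sup>2 + (B + 2 - 3 / 4)\<^sup>2"
  proof (rule add_mono)
    show "(Re z)\<^sup>2 \<le> (1 / 2)\<^sup>2" using assms(1) by (simp add: abs_le_square_iff[symmetric])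
    show "(B + 2 - Im z)\<^sup>2 \<le> (B + 2 - 3 / 4)\<^sup>2" using assms by (intro power_mono) auto
  qed
  also have "\<dots> < (B + 2 - 5 / 8)\<^sup>2" using B by (simp add: power2_eq_square algebra_simps)
  finally show ?thesis by (rule power2_less_imp_less) (use B in simp)
qed

lemma disc_upper: "cmod (z - centre) \<le> B + 2 - y \<Longrightarrow> y \<le> Im z"
  using abs_Im_le_cmod[of "z - centre"] by (simp add: centre_def)

lemma holo_disc: "f holomorphic_on ball centre (B + 2 - 1 / 2)"
proof (rule holomorphic_on_subset[OF holo])
  show "ball centre (B + 2 - 1 / 2) \<subseteq> upper_half"
  proof
    fix z assume "z \<in> ball centre (B + 2 - 1 / 2)"
    then have "1 / 2 \<le> Im z" by (intro disc_upper) (simp add: dist_norm norm_minus_commute)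
    then show "z \<in> upper_half" by (simp add: upper_half_def)
  qed
qed

lemma nonzero_in_disc: "\<exists>w\<in>ball centre (B + 2 - 1 / 2). f w \<noteq> 0"
proof -
  obtain w m where w: "m > 0" "\<bar>Re w\<bar> \<le> 1 / 2" "1 \<le> Im w" "Im w \<le> 2"
    "\<And>z. Im z \<ge> 1 / 2 \<Longrightarrow> cmod (f z) \<le> m" "cmod (f w) \<ge> m / 2 ^ k"
    by (rule crude_size_bounds) (rule that)
  have "cmod (w - centre) < B + 2 - 5 / 8" using w B by (intro in_disc) auto
  moreover have "f w \<noteq> 0"
  proof
    assume "f w = 0"
    then have "m / 2 ^ k \<le> 0" using w(6) by simp
    moreover have "0 < m / 2 ^ k" using w(1) by simp
    ultimately show False by linarith
  qed
  ultimately show ?thesis by (intro bexI[of _ w]) (auto simp: dist_norm norm_minus_commute)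
qed

lemma K_disc: "K \<subseteq> ball centre (B + 2 - 5 / 8)"
proof
  fix z assume "z \<in> K"
  from K_bounds[OF this] have "cmod (z - centre) < B + 2 - 5 / 8" using B by (intro in_disc) auto
  then show "z \<in> ball centre (B + 2 - 5 / 8)" by (simp add: dist_norm norm_minus_commute)
qed

definition u where "u z = real k / 2 * ln (Im z) + ln (cmod (f z))"

lemma hyp_integral_phi: "hyp_integral fund_domain \<phi> = (LBINT z. (1 / (Im z)\<^sup>2) *\<^sub>R extend_zero upper_half \<phi> z)"
  unfolding hyp_integral_def set_lebesgue_integral_def
proof (rule Bochner_Integration.integral_cong[OF refl])
  fix z
  show "indicat_real fund_domain z *\<^sub>R (1 / (Im z)\<^sup>2) *\<^sub>R \<phi> z = (1 / (Im z)\<^sup>2) *\<^sub>R extend_zero upper_half \<phi> z"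
  proof (cases "z \<in> fund_domain")
    case True then show ?thesis by (simp add: extend_zero_def fund_domain_def)
  next
    case False
    then have "extend_zero upper_half \<phi> z = 0" using test_facts(4)[of z] K_bounds[of z] by blast
    then show ?thesis using False by simp
  qed
qed

lemma hyp_integral_laplacian: "hyp_integral fund_domain (\<lambda>z. cmod (hyp_laplacian \<phi> z)) = (LBINT z. cmod (L z))"
  unfolding hyp_integral_def set_lebesgue_integral_def
proof (rule Bochner_Integration.integral_cong[OF refl])
  fix z
  show "indicat_real fund_domain z *\<^sub>R (1 / (Im z)\<^sup>2) *\<^sub>R cmod (hyp_laplacian \<phi> z) = cmod (L z)"
  proof (cases "z \<in> fund_domain")
    case True then show ?thesis by (simp add: L_def extend_zero_def fund_domain_def norm_divide norm_power)
  next
    case False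
    then have "L z = 0" using test_facts(5)[of z] K_bounds[of z] by blast
    then show ?thesis using False by simp
  qed
qed

lemma
  shows integrable_u: "integrable lborel (\<lambda>z. u z *\<^sub>R L z)"
    and zero_sum_identity: "zero_sum f \<phi> - of_real (real k / 12 * (3 / pi)) * hyp_integral fund_domain \<phi> =
       of_real (1 / (2 * pi)) * (LBINT z. u z *\<^sub>R L z)"
    and AE_f_nonzero: "AE z in lborel. z \<in> K \<longrightarrow> f z \<noteq> 0"
proof -
  obtain w where w: "w \<in> ball centre (B + 2 - 1 / 2)" "f w \<noteq> 0" using nonzero_in_disc by blast
  define Z where "Z = {z \<in> ball centre (B + 2 - 5 / 8). f z = 0}"
  have r: "B + 2 - 5 / 8 < B + 2 - 1 / 2" by simp
  note F = integrable_log_modulus_laplacian[OF holo_disc r w test K_disc]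
    integral_log_modulus_laplacian[OF holo_disc r w test K_disc, folded Z_def]
    finite_zeros_ball[OF holo_disc r w, folded Z_def]
  have Ku: "K \<subseteq> {z. 0 < Im z}" using K_bounds by force
  note I = integral_log_Im_laplacian[OF test Ku] integrable_log_Im_laplacian[OF test Ku]
  have eq: "(\<lambda>z. u z *\<^sub>R L z) = (\<lambda>z. (real k / 2) *\<^sub>R (ln (Im z) *\<^sub>R L z) + ln (cmod (f z)) *\<^sub>R L z)"
    by (simp add: u_def scaleR_add_left)
  show "integrable lborel (\<lambda>z. u z *\<^sub>R L z)"
    unfolding eq by (intro Bochner_Integration.integrable_add integrable_scaleR_right I(2) F(1))
  have AEZ: "AE z in lborel. z \<notin> Z" using AE_not_in[OF finite_imp_null_set_lborel[OF F(3)]] .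
  show "AE z in lborel. z \<in> K \<longrightarrow> f z \<noteq> 0"
    using AEZ by (rule eventually_mono) (use K_disc in \<open>auto simp: Z_def\<close>)
  \<comment> \<open>The zeros in the disc and those in the fundamental domain are different sets.
    Since \<open>\<phi>\<close> vanishes off \<open>K\<close>, both sums reduce to the zeros in
    \<open>K\<close>.\<close>
  have "(\<Sum>a\<in>Z. of_int (zorder f a) * extend_zero upper_half \<phi> a) = (\<Sum>a\<in>Z \<inter> K. of_int (zorder f a) * \<phi> a)"
    using test_facts(4) K_bounds F(3)
    by (intro sum.mono_neutral_cong_right) (auto simp: extend_zero_def fund_domain_def)
  also have "Z \<inter> K = {w \<in> fund_domain. f w = 0} \<inter> K"
    using K_disc K_bounds by (auto simp: Z_def)
  also have "(\<Sum>a\<in>{w \<in> fund_domain. f w = 0} \<inter> K. of_int (zorder f a) * \<phi> a) = zero_sum f \<phi>"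
    unfolding zero_sum_def using finite_zeros_fund_domain phi_zero
    by (intro sum.mono_neutral_left) (auto simp: fund_domain_def)
  finally have Zs: "(\<Sum>a\<in>Z. of_int (zorder f a) * extend_zero upper_half \<phi> a) = zero_sum f \<phi>" .
  have "(LBINT z. u z *\<^sub>R L z) =
      (real k / 2) *\<^sub>R (LBINT z. ln (Im z) *\<^sub>R L z) + (LBINT z. ln (cmod (f z)) *\<^sub>R L z)"
    unfolding eq by (subst Bochner_Integration.integral_add) (auto intro!: integrable_scaleR_right I(2) F(1) simp del: scaleR_scaleR)
  also have "\<dots> = 2 * pi * zero_sum f \<phi> - (real k / 2) *\<^sub>R hyp_integral fund_domain \<phi>"
    unfolding I(1) F(2) Zs hyp_integral_phi by simp
  finally have "of_real (1 / (2 * pi)) * (LBINT z. u z *\<^sub>R L z) =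
      of_real (1 / (2 * pi)) * (of_real (2 * pi) * zero_sum f \<phi>) - of_real (1 / (2 * pi) * (real k / 2)) * hyp_integral fund_domain \<phi>"
    by (simp add: scaleR_conv_of_real right_diff_distrib)
  also have "1 / (2 * pi) * (real k / 2) = real k / 12 * (3 / pi)" by simp
  also have "of_real (1 / (2 * pi)) * (of_real (2 * pi) * zero_sum f \<phi>) = zero_sum f \<phi>" by simp
  finally show "zero_sum f \<phi> - of_real (real k / 12 * (3 / pi)) * hyp_integral fund_domain \<phi> =
       of_real (1 / (2 * pi)) * (LBINT z. u z *\<^sub>R L z)" ..
qed

text \<open>Green's identity against the constant 1. Adding a constant to \<open>u\<close> therefore
  leaves its integral against \<open>L\<close> unchanged, which allows \<open>f\<close> to be
  rescaled.\<close>

lemma integral_laplacian_zero: "integral\<^sup>L lborel L = 0"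
proof -
  have d: "dir_C2 UNIV v (\<lambda>_. 1) (\<lambda>_. 0)" for v
    unfolding dir_C2_def by (intro conjI exI[of _ "\<lambda>_. 0"]) auto
  have "(LBINT z. 1 *\<^sub>R L z) = (LBINT z. 0 *\<^sub>R extend_zero upper_half \<phi> z)"
    by (rule green(1)[OF open_UNIV subset_UNIV test d d]) simp
  then show ?thesis by simp
qed

lemma integrable_L: "integrable lborel L" "integrable lborel (\<lambda>z. cmod (L z))"
  by (auto intro!: integrable_continuous_compact_support[OF test_facts(3,1,5)])

lemma zero_sum_bound:
  assumes W: "integrable lborel W" and le: "AE z in lborel. \<bar>u z + a\<bar> * cmod (L z) \<le> W z"
  shows "discrepancy k f \<phi> \<le> integral\<^sup>L lborel W"
proof -
  have i: "integrable lborel (\<lambda>z. (u z + a) *\<^sub>R L z)"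
    unfolding scaleR_add_left using integrable_u integrable_L by auto
  have "(LBINT z. (u z + a) *\<^sub>R L z) = (LBINT z. u z *\<^sub>R L z) + a *\<^sub>R integral\<^sup>L lborel L"
    unfolding scaleR_add_left using integrable_u integrable_L by simp
  then have e: "(LBINT z. u z *\<^sub>R L z) = (LBINT z. (u z + a) *\<^sub>R L z)"
    using integral_laplacian_zero by simp
  have "cmod ((LBINT z. u z *\<^sub>R L z)) \<le> (LBINT z. cmod ((u z + a) *\<^sub>R L z))"
    unfolding e by (rule integral_norm_bound)
  also have "\<dots> \<le> integral\<^sup>L lborel W"
    using le by (intro integral_mono_AE integrable_norm[OF i] W) simp
  finally have b: "cmod ((LBINT z. u z *\<^sub>R L z)) \<le> integral\<^sup>L lborel W" .
  have "cmod (of_real (1 / (2 * pi)) * (LBINT z. u z *\<^sub>R L z)) \<le> 1 * cmod ((LBINT z. u z *\<^sub>R L z))"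
    unfolding norm_mult norm_of_real using pi_gt3 by (intro mult_right_mono) auto
  then show ?thesis unfolding discrepancy_def zero_sum_identity using b by simp
qed

lemma norm_L_le:
  assumes "\<And>z. z \<in> upper_half \<Longrightarrow> cmod (hyp_laplacian \<phi> z) \<le> X" "X \<ge> 0"
  shows "cmod (L z) \<le> 2 * X"
proof (cases "z \<in> K")
  case False then show ?thesis using test_facts(5)[of z] assms(2) by simp
next
  case True
  then have z: "3 / 4 \<le> Im z" "z \<in> upper_half" using K_bounds[of z] by (auto simp: upper_half_def)
  have "(3 / 4)\<^sup>2 \<le> (Im z)\<^sup>2" using z by (intro power_mono) auto
  then have i: "1 / 2 \<le> (Im z)\<^sup>2" by (simp add: power_divide)
  have "cmod (L z) = cmod (hyp_laplacian \<phi> z) / (Im z)\<^sup>2"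
    using z by (simp add: L_def extend_zero_def norm_divide norm_power)
  also have "\<dots> \<le> X / (1 / 2)"
    using i assms z(2) by (intro frac_le) auto
  finally show ?thesis by simp
qed

lemma integral_L_le:
  assumes "\<And>z. cmod (L z) \<le> D" "D \<ge> 0"
  shows "(LBINT z. cmod (L z)) \<le> D * B"
proof -
  define X where "X = cbox (Complex (- 1/2) 0) (Complex (1/2) B)"
  have em: "emeasure lborel X = ennreal B"
    unfolding X_def using B by (subst emeasure_lborel_cbox) (auto simp: Basis_complex_def inner_complex_def)
  have "(LBINT z. cmod (L z)) \<le> (LBINT z. D * indicator X z)"
  proof (rule integral_mono[OF integrable_L(2)])
    show "integrable lborel (\<lambda>z. D * indicator X z)"
      using em by (intro integrable_mult_right integrable_real_indicator) (auto simp: X_def)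
    fix z
    show "cmod (L z) \<le> D * indicator X z"
    proof (cases "z \<in> K")
      case True
      then have "z \<in> X" using K_bounds[OF True] by (auto simp: X_def cbox_def Basis_complex_def inner_complex_def)
      then show ?thesis using assms by simp
    qed (use test_facts(5) assms in \<open>simp add: indicator_def\<close>)
  qed
  also have "\<dots> = D * measure lborel X" by (simp add: X_def)
  also have "measure lborel X = B" using em B by (simp add: measure_def)
  finally show ?thesis .
qed

end

section \<open>Bounds for the error term\<close>

text \<open>The quotient compares the disc containing the support with the one on which
  \<open>f\<close> is bounded by its maximum. The factor with the square absorbs the radius from the
  near-pole term, and the last \<open>B\<close> pays for \<open>k / 2 * ln y\<close>.\<close>

definition crude_constant :: "real \<Rightarrow> real" where
  "crude_constant B =
     6 * log_constant ((B + 2 - 5 / 8) / (B + 2 - 9 / 16)) * (1 + (B + 2 - 9 / 16)\<^sup>2) + B"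

lemma crude_constant_pos: "B > 1 \<Longrightarrow> crude_constant B > 0"
  unfolding crude_constant_def by (intro add_nonneg_pos mult_nonneg_nonneg less_imp_le[OF log_constant_pos]) auto

context zero_statistics
begin

text \<open>Measured against its maximum \<open>m\<close> over \<open>Im z >= 1/2\<close>,
  \<open>f\<close> is at most 1 on the disc and at least \<open>2^(-k) >= exp (-k)\<close> at one
  point, so the pointwise theory applies with \<open>k\<close> as logarithmic bound. Dividing by
  \<open>m\<close> only shifts \<open>u\<close> by a constant.\<close>

lemma crude_bound:
  assumes D: "\<And>z. cmod (L z) \<le> D" and s: "0 < s" "s \<le> 1"
  shows "discrepancy k f \<phi> \<le> crude_constant B * real k * ((1 + ln (2 / s)) * (LBINT z. cmod (L z)) + D * s\<^sup>2)"
proof -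
  define r where "r = B + 2 - 9 / 16"
  define \<rho> where "\<rho> = (B + 2 - 5 / 8) / r"
  have r: "r > 0" using B by (simp add: r_def)
  have \<rho>: "0 < \<rho>" "\<rho> < 1" using B by (auto simp: \<rho>_def r_def)
  have \<rho>r: "\<rho> * r = B + 2 - 5 / 8" using r by (simp add: \<rho>_def)
  define C where "C = 6 * log_constant \<rho>"
  have C: "C > 0" unfolding C_def using log_constant_pos[OF \<rho>] by simp
  define C' where "C' = C * (1 + r\<^sup>2) + B"
  have C': "crude_constant B = C'" by (simp add: crude_constant_def C'_def C_def \<rho>_def r_def)
  obtain w m where w: "m > 0" "\<bar>Re w\<bar> \<le> 1 / 2" "1 \<le> Im w" "Im w \<le> 2"
    "\<And>z. Im z \<ge> 1 / 2 \<Longrightarrow> cmod (f z) \<le> m" "cmod (f w) \<ge> m / 2 ^ k"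
    by (rule crude_size_bounds) (rule that)
  have k: "real k > 0" using weight_ge_2 by simp
  let ?I = "(LBINT z. cmod (L z))"
  have "\<exists>W. integrable lborel W \<and> (\<forall>z. \<bar>ln (cmod (f z / of_real m))\<bar> * cmod (L z) \<le> W z) \<and>
      integral\<^sup>L lborel W \<le> C * k * ((1 + ln (2 / s)) * ?I + D * s\<^sup>2 * r\<^sup>2)"
  unfolding C_def
  proof (rule log_modulus_integral_bound[OF \<rho>, of _ centre "B + 2 - 1 / 2" r "real k" w])
    show "(\<lambda>z. f z / of_real m) holomorphic_on ball centre (B + 2 - 1 / 2)"
      using w(1) by (intro holomorphic_intros holo_disc) auto
    fix z assume "z \<in> cball centre r"
    then have "9 / 16 \<le> Im z" by (intro disc_upper) (simp add: dist_norm norm_minus_commute r_def)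
    then have "cmod (f z) / m \<le> 1" using w(1) w(5)[of z] by simp
    also have "1 \<le> exp (real k)" by simp
    finally show "cmod (f z / of_real m) \<le> exp (real k)" using w(1) by (simp add: norm_divide)
  next
    show "cmod (w - centre) \<le> \<rho> * r" unfolding \<rho>r by (rule less_imp_le, rule in_disc) (use B w in auto)
    have "2 ^ k \<le> exp (1::real) ^ k" using exp_ge_add_one_self[of 1] by (intro power_mono) auto
    also have "\<dots> = exp (real k)" by (simp add: exp_of_nat_mult[symmetric])
    finally have "1 / exp (real k) \<le> 1 / 2 ^ k" by (intro divide_left_mono) auto
    also have "\<dots> \<le> cmod (f w) / m" using w(1,6) by (simp add: field_simps)
    finally show "exp (- real k) \<le> cmod (f w / of_real m)"
      using w(1) by (simp add: norm_divide exp_minus inverse_eq_divide)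
    fix z
    show "0 \<le> cmod (L z) \<and> cmod (L z) \<le> D" using D by simp
    assume "cmod (L z) \<noteq> 0"
    then have "z \<in> K" using test_facts(5) by auto
    then show "z \<in> cball centre (\<rho> * r)" using K_disc unfolding \<rho>r by auto
  qed (use r k s integrable_L in \<open>auto simp: r_def\<close>)
  then obtain W where W: "integrable lborel W" "\<And>z. \<bar>ln (cmod (f z / of_real m))\<bar> * cmod (L z) \<le> W z"
    "integral\<^sup>L lborel W \<le> C * k * ((1 + ln (2 / s)) * ?I + D * s\<^sup>2 * r\<^sup>2)"
    by blast
  have bd: "AE z in lborel. \<bar>u z + (- ln m)\<bar> * cmod (L z) \<le> W z + real k * B * cmod (L z)"
    using AE_f_nonzero
  proof (rule eventually_mono)
    fix z assume fz: "z \<in> K \<longrightarrow> f z \<noteq> 0"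
    show "\<bar>u z + (- ln m)\<bar> * cmod (L z) \<le> W z + real k * B * cmod (L z)"
    proof (cases "z \<in> K")
      case False
      then show ?thesis using W(2)[of z] test_facts(5)[of z] by simp
    next
      case True
      note Kb = K_bounds[OF True]
      have "ln (Im z) \<le> B" "- ln (Im z) \<le> B"
      proof -
        show "ln (Im z) \<le> B" using ln_le_minus_one[of "Im z"] Kb by linarith
        have "1 / Im z \<le> 1 / (3 / 4)" using Kb by (intro divide_left_mono) auto
        then show "- ln (Im z) \<le> B" using ln_le_minus_one[of "1 / Im z"] Kb B by (simp add: ln_div)
      qed
      then have "\<bar>ln (Im z)\<bar> \<le> B" by linarith
      then have "\<bar>real k / 2 * ln (Im z)\<bar> \<le> real k * B"
        unfolding abs_mult using k by (intro mult_mono) auto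
      moreover have "ln (cmod (f z / of_real m)) = ln (cmod (f z)) - ln m"
        using fz True w(1) by (simp add: norm_divide ln_div)
      ultimately have "\<bar>u z + (- ln m)\<bar> \<le> \<bar>ln (cmod (f z / of_real m))\<bar> + real k * B"
        unfolding u_def by linarith
      then have "\<bar>u z + (- ln m)\<bar> * cmod (L z) \<le> (\<bar>ln (cmod (f z / of_real m))\<bar> + real k * B) * cmod (L z)"
        by (rule mult_right_mono) simp
      then show ?thesis using W(2)[of z] unfolding distrib_right by linarith
    qed
  qed
  have I0: "0 \<le> ?I" by simp
  have D0: "0 \<le> D" using D norm_ge_zero order_trans by blast
  have l0: "0 \<le> ln (2 / s)" using s by simp
  have "discrepancy k f \<phi> \<le>
    (LBINT z. W z + real k * B * cmod (L z))"
    by (rule zero_sum_bound[OF _ bd]) (intro Bochner_Integration.integrable_add W integrable_mult_right integrable_L)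
  also have "\<dots> = integral\<^sup>L lborel W + real k * B * ?I"
    using W(1) integrable_L(2) by simp
  also have "\<dots> \<le> C * k * ((1 + ln (2 / s)) * ?I + D * s\<^sup>2 * r\<^sup>2) + real k * B * ?I"
    using W(3) by simp
  also have "\<dots> \<le> C' * real k * ((1 + ln (2 / s)) * ?I + D * s\<^sup>2)"
  proof -
    define X where "X = (1 + ln (2 / s)) * ?I"
    define Y where "Y = D * s\<^sup>2"
    have X: "?I \<le> X" "0 \<le> X" using I0 l0 by (auto simp: X_def distrib_right)
    have Y: "0 \<le> Y" using D0 by (simp add: Y_def)
    have "B * ?I \<le> B * X" using X B by (intro mult_left_mono) auto
    moreover have "0 \<le> C * r\<^sup>2 * X" "0 \<le> C * Y" "0 \<le> B * Y" using C X Y B by auto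
    ultimately have "C * (X + Y * r\<^sup>2) + B * ?I \<le> C' * (X + Y)"
      by (simp add: C'_def algebra_simps)
    then have "real k * (C * (X + Y * r\<^sup>2) + B * ?I) \<le> real k * (C' * (X + Y))"
      by (rule mult_left_mono) simp
    then show ?thesis unfolding X_def[symmetric] Y_def[symmetric] by (simp add: algebra_simps)
  qed
  finally show ?thesis unfolding C' .
qed

end

section \<open>Linearization of log y on small discs\<close>

lemma log_tangent_gap:
  fixes y y0 h :: real
  assumes "3 / 4 \<le> y0" "\<bar>y - y0\<bar> \<le> 5 * h" "h \<le> 1 / 64"
  shows "0 \<le> ln y0 + (y - y0) / y0 - ln y" "ln y0 + (y - y0) / y0 - ln y \<le> 2 * h"
proof -
  define x where "x = (y - y0) / y0"
  have h: "0 \<le> h" using assms by linarith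
  have "\<bar>x\<bar> = \<bar>y - y0\<bar> / y0" using assms by (simp add: x_def)
  also have "\<dots> \<le> 5 * h / (3 / 4)" using assms h by (intro frac_le) auto
  finally have x: "\<bar>x\<bar> \<le> 7 * h" using h by simp
  have x2: "\<bar>x\<bar> \<le> 1 / 2" using x assms by simp
  have "y = y0 * (1 + x)" using assms by (simp add: x_def field_simps)
  then have "ln y = ln y0 + ln (1 + x)" using x2 assms by (simp add: ln_mult)
  then have e: "ln y0 + (y - y0) / y0 - ln y = x - ln (1 + x)" by (simp add: x_def)
  show "0 \<le> ln y0 + (y - y0) / y0 - ln y" unfolding e using ln_add_one_self_le_self2[of x] x2 by simp
  \<comment> \<open>The gap is quadratic in \<open>h\<close>, at most \<open>98 * h^2\<close>. The
    restriction \<open>h <= 1/64\<close> brings it below \<open>2 * h\<close>, which matches the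
    other errors of size \<open>k * h\<close>.\<close>
  have "x - ln (1 + x) \<le> 2 * x\<^sup>2" using abs_ln_one_plus_x_minus_x_bound[of x] x2 by linarith
  also have "2 * x\<^sup>2 \<le> 2 * (7 * h)\<^sup>2" using power_mono[OF x, of 2] by simp
  also have "2 * (7 * h)\<^sup>2 = 98 * h * h" by (simp add: power2_eq_square)
  also have "\<dots> \<le> 2 * h" using assms(3) h mult_right_mono[of "98 * h" 2 h] by simp
  finally show "ln y0 + (y - y0) / y0 - ln y \<le> 2 * h" unfolding e by simp
qed

context nonzero_cusp_form
begin

text \<open>
  The exponent is the holomorphic function whose real part linearizes \<open>(k/2) log y\<close> at \<open>z0\<close>, so
  that \<open>log \<bar>flattened z0\<bar>\<close> agrees with \<open>(k/2) log y + log \<bar>f\<bar>\<close> up to \<open>O(k h\<^sup>2)\<close>.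
\<close>

definition flattened :: "complex \<Rightarrow> complex \<Rightarrow> complex" where
  "flattened z0 z = f z * exp (of_real (real k / 2) * (of_real (ln (Im z0)) - \<i> * (z - z0) / of_real (Im z0)))"

lemma norm_flattened:
  "cmod (flattened z0 z) = cmod (f z) * exp (real k / 2 * (ln (Im z0) + (Im z - Im z0) / Im z0))"
  by (simp add: flattened_def norm_mult diff_divide_distrib)

lemma norm_flattened_square:
  assumes "Im z > 0"
  shows "(cmod (flattened z0 z))\<^sup>2 = Im z ^ k * (cmod (f z))\<^sup>2 * exp (real k * (ln (Im z0) + (Im z - Im z0) / Im z0 - ln (Im z)))"
proof -
  have "Im z ^ k = exp (real k * ln (Im z))" using assms by (simp add: exp_of_nat_mult)
  moreover have "(exp (real k / 2 * a))\<^sup>2 = exp (real k * ln (Im z)) * exp (real k * (a - ln (Im z)))" for a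
    by (simp add: exp_double[symmetric] exp_add[symmetric] algebra_simps)
  ultimately show ?thesis
    unfolding norm_flattened power_mult_distrib by simp
qed

lemma holomorphic_flattened: "flattened z0 holomorphic_on upper_half"
  unfolding flattened_def[abs_def] by (intro holomorphic_intros holo) (auto intro!: holomorphic_intros)

end

context zero_statistics
begin

lemma log_flattened:
  assumes "z0 \<in> K" "cmod (z - z0) \<le> 5 * h" "h \<le> 1 / 64" "f z \<noteq> 0"
  shows "\<bar>u z\<bar> \<le> \<bar>ln (cmod (flattened z0 z))\<bar> + real k * h"
proof -
  define t where "t = ln (Im z0) + (Im z - Im z0) / Im z0 - ln (Im z)"
  have t: "0 \<le> t" "t \<le> 2 * h"
  proof -
    have "\<bar>Im z - Im z0\<bar> \<le> 5 * h" using abs_Im_le_cmod[of "z - z0"] assms(2) by simp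
    from log_tangent_gap[OF _ this assms(3)] K_bounds[OF assms(1)]
    show "0 \<le> t" "t \<le> 2 * h" unfolding t_def by blast+
  qed
  have "ln (cmod (flattened z0 z)) = u z + real k / 2 * t"
    using assms(4) by (simp add: norm_flattened ln_mult u_def t_def algebra_simps)
  moreover have "real k / 2 * t \<le> real k / 2 * (2 * h)" using t by (intro mult_left_mono) auto
  moreover have "0 \<le> real k / 2 * t" using t by simp
  ultimately show ?thesis by simp
qed

text \<open>From \<open>ln k < k * h\<close> the polynomial factor of \<open>sup_bound\<close> is at
  most \<open>exp (k * h)\<close>. Moreover \<open>ln k >= 1/2\<close> gives
  \<open>2 * k * h >= 1\<close>, so the constants \<open>ln (144 * (B + 2))\<close> and
  \<open>|ln c|\<close> are absorbed as multiples of \<open>k * h\<close>.\<close>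

lemma flattened_bounds:
  assumes norm: "hyp_integral fund_domain (\<lambda>z. (Im z) ^ k * (cmod (f z))\<^sup>2) = 1"
    and z0: "z0 \<in> K" and h: "h \<le> 1 / 64" "ln (real k) / real k < h"
    and z1: "z1 \<in> ball z0 h" "c * exp (- (real k * h)) \<le> (Im z1) ^ k * (cmod (f z1))\<^sup>2" and c: "c > 0"
  defines "l \<equiv> (2 + 2 * ln (144 * (B + 2)) + \<bar>ln c\<bar>) * (real k * h)"
  shows "0 < h" "0 < l" "exp (- l) \<le> cmod (flattened z0 z1)" "\<And>z. z \<in> cball z0 (4 * h) \<Longrightarrow> cmod (flattened z0 z) \<le> exp l"
proof -
  have k2: "real k \<ge> 2" using weight_ge_2 by simp
  have "ln 2 \<le> ln (real k)" using k2 by simp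
  moreover have "1 / 2 \<le> ln (2::real)" using ln_le_minus_one[of "1 / 2"] by (simp add: ln_div)
  ultimately have lnk: "1 / 2 \<le> ln (real k)" by simp
  have kh: "ln (real k) < real k * h" using h(2) k2 by (simp add: field_simps)
  then have kh2: "1 / 2 < real k * h" using lnk by simp
  show h0: "0 < h"
  proof (rule ccontr)
    assume "\<not> 0 < h"
    then have "real k * h \<le> 0" by (intro mult_nonneg_nonpos) auto
    then show False using kh2 by simp
  qed
  have Q: "0 \<le> ln (144 * (B + 2))" using B by simp
  have l: "(2 + 2 * ln (144 * (B + 2))) * (real k * h) + \<bar>ln c\<bar> * (real k * h) = l"
    by (simp add: l_def algebra_simps)
  have "0 < real k * h" using kh2 by linarith
  then show "0 < l" unfolding l_def using Q by (intro mult_pos_pos[of _ "real k * h"]) linarith+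
  note Kb = K_bounds[OF z0]
  have gap: "0 \<le> real k * (ln (Im z0) + (Im z - Im z0) / Im z0 - ln (Im z))"
     "real k * (ln (Im z0) + (Im z - Im z0) / Im z0 - ln (Im z)) \<le> 2 * (real k * h)"
     "1 / 2 \<le> Im z" "Im z \<le> B + 1" if "cmod (z - z0) \<le> 5 * h" for z
  proof -
    have I: "\<bar>Im z - Im z0\<bar> \<le> 5 * h" using abs_Im_le_cmod[of "z - z0"] that by simp
    then show "1 / 2 \<le> Im z" "Im z \<le> B + 1" using Kb h(1) by linarith+
    note g = log_tangent_gap[OF _ I h(1)]
    show "0 \<le> real k * (ln (Im z0) + (Im z - Im z0) / Im z0 - ln (Im z))"
      using g(1) Kb by (intro mult_nonneg_nonneg) auto
    have "real k * (ln (Im z0) + (Im z - Im z0) / Im z0 - ln (Im z)) \<le> real k * (2 * h)"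
      using g(2) Kb by (intro mult_left_mono) auto
    then show "real k * (ln (Im z0) + (Im z - Im z0) / Im z0 - ln (Im z)) \<le> 2 * (real k * h)" by simp
  qed
  show "exp (- l) \<le> cmod (flattened z0 z1)"
  proof -
    have z1': "cmod (z1 - z0) \<le> 5 * h" using z1(1) h0 by (simp add: dist_norm norm_minus_commute)
    note g = gap[OF z1']
    have "- (2 * l) \<le> ln c - real k * h"
    proof -
      have "\<bar>ln c\<bar> * 1 \<le> \<bar>ln c\<bar> * (2 * (real k * h))" using kh2 by (intro mult_left_mono) auto
      moreover have "2 * (real k * h) \<le> (2 + 2 * ln (144 * (B + 2))) * (real k * h)"
        using Q kh2 by (intro mult_right_mono) auto
      ultimately show ?thesis using l kh2 by linarith
    qed
    then have "exp (- (2 * l)) \<le> exp (ln c - real k * h)" by simp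
    also have "\<dots> = c * exp (- (real k * h))" using c by (simp add: exp_diff exp_minus field_simps)
    also have "\<dots> \<le> Im z1 ^ k * (cmod (f z1))\<^sup>2" by (rule z1(2))
    also have "\<dots> * 1 \<le> Im z1 ^ k * (cmod (f z1))\<^sup>2 * exp (real k * (ln (Im z0) + (Im z1 - Im z0) / Im z0 - ln (Im z1)))"
      using g by (intro mult_left_mono) auto
    also have "\<dots> = (cmod (flattened z0 z1))\<^sup>2" using g by (subst norm_flattened_square) auto
    finally have "(exp (- l))\<^sup>2 \<le> (cmod (flattened z0 z1))\<^sup>2" by (simp add: exp_double[symmetric])
    then show ?thesis by (rule power2_le_imp_le) simp
  qed
  fix z assume "z \<in> cball z0 (4 * h)"
  then have "cmod (z - z0) \<le> 5 * h" using h0 by (simp add: dist_norm norm_minus_commute)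
  note g = gap[OF this]
  have "(cmod (flattened z0 z))\<^sup>2 \<le> (144 * (B + 1 + 1) * k)\<^sup>2 * exp (2 * (real k * h))"
  proof -
    \<comment> \<open>The disc may reach above height \<open>B\<close>, so the sup norm bound is
      taken at \<open>B + 1\<close>; this also supplies its requirement of a height of at least
      2.\<close>
    have "Im z ^ k * (cmod (f z))\<^sup>2 \<le> (144 * (B + 1 + 1) * k)\<^sup>2"
      using g B by (intro sup_bound[OF norm]) auto
    then show ?thesis
      using g by (subst norm_flattened_square) (auto intro!: mult_mono)
  qed
  also have "\<dots> = (144 * (B + 2) * k * exp (real k * h))\<^sup>2"
    by (simp add: power_mult_distrib exp_double[symmetric] add.commute)
  finally have "cmod (flattened z0 z) \<le> 144 * (B + 2) * k * exp (real k * h)"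
    by (rule power2_le_imp_le) (use B in simp)
  also have "\<dots> = exp (ln (144 * (B + 2)) + ln (real k) + real k * h)"
    using B k2 by (simp add: exp_add)
  also have "\<dots> \<le> exp l"
  proof -
    have "ln (144 * (B + 2)) * 1 \<le> ln (144 * (B + 2)) * (2 * (real k * h))" using kh2 Q by (intro mult_left_mono) auto
    moreover have "0 \<le> \<bar>ln c\<bar> * (real k * h)" using kh2 by simp
    moreover have "(2 + 2 * ln (144 * (B + 2))) * (real k * h) = 2 * (real k * h) + ln (144 * (B + 2)) * (2 * (real k * h))"
      by (simp add: algebra_simps)
    ultimately show ?thesis unfolding exp_le_cancel_iff using l kh by linarith
  qed
  finally show "cmod (flattened z0 z) \<le> exp l" .
qed

end

section \<open>Squares of side h and summation over the grid\<close>

definition grid_index :: "real \<Rightarrow> complex \<Rightarrow> int \<times> int" where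
  "grid_index h z = (\<lfloor>Re z / h\<rfloor>, \<lfloor>Im z / h\<rfloor>)"

lemma grid_index_measurable: "{z. grid_index h z = j} \<in> sets borel"
proof -
  have "{z. grid_index h z = j} = {z. of_int (fst j) \<le> Re z / h \<and> Re z / h < of_int (fst j) + 1 \<and>
      of_int (snd j) \<le> Im z / h \<and> Im z / h < of_int (snd j) + 1}"
    by (auto simp: grid_index_def floor_eq_iff prod_eq_iff)
  also have "\<dots> \<in> sets borel" by measurable
  finally show ?thesis .
qed

lemma grid_index_dist:
  assumes "grid_index h z = grid_index h w" "h > 0"
  shows "cmod (z - w) \<le> 2 * h"
proof -
  have "\<lfloor>Re z / h\<rfloor> = \<lfloor>Re w / h\<rfloor>" "\<lfloor>Im z / h\<rfloor> = \<lfloor>Im w / h\<rfloor>"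
    using assms(1) by (auto simp: grid_index_def)
  then have "\<bar>Re z / h - Re w / h\<bar> \<le> 1" "\<bar>Im z / h - Im w / h\<bar> \<le> 1" by linarith+
  then have "\<bar>Re (z - w)\<bar> \<le> h" "\<bar>Im (z - w)\<bar> \<le> h"
    using assms(2) by (auto simp: diff_divide_distrib[symmetric] abs_divide divide_le_eq)
  then show ?thesis using cmod_le[of "z - w"] by linarith
qed

lemma card_grid_index:
  assumes S: "\<And>z. z \<in> S \<Longrightarrow> \<bar>Re z\<bar> \<le> B + 1 \<and> \<bar>Im z\<bar> \<le> B + 1" and B: "B > 0" and h: "0 < h" "h \<le> 1"
  shows "finite (grid_index h ` S)" "real (card (grid_index h ` S)) * h\<^sup>2 \<le> (2 * B + 5)\<^sup>2"
proof -
  define N where "N = \<lceil>(B + 1) / h\<rceil>"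
  have N: "(B + 1) / h \<le> of_int N" "of_int N < (B + 1) / h + 1" unfolding N_def by linarith+
  have fl: "\<lfloor>x / h\<rfloor> \<in> {- N..N}" if "\<bar>x\<bar> \<le> B + 1" for x
  proof -
    have "\<bar>x / h\<bar> \<le> (B + 1) / h" using that h by (simp add: divide_right_mono)
    then have "x / h \<le> of_int N" "- of_int N \<le> x / h" using N by linarith+
    then show ?thesis by (auto simp: floor_le_iff le_floor_iff)
  qed
  have sub: "grid_index h ` S \<subseteq> {- N..N} \<times> {- N..N}"
    using S fl by (auto simp: grid_index_def)
  then show fin: "finite (grid_index h ` S)" by (rule finite_subset) simp
  have N0: "0 \<le> N"
  proof -
    have "0 < (B + 1) / h" using B h by simp
    then have "0 < real_of_int N" using N by linarith
    then show ?thesis by simp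
  qed
  have "card (grid_index h ` S) \<le> card ({- N..N} \<times> {- N..N})" using sub by (intro card_mono) auto
  also have "\<dots> = (nat (2 * N + 1))\<^sup>2" by (simp add: card_cartesian_product power2_eq_square)
  finally have "real (card (grid_index h ` S)) \<le> (real (nat (2 * N + 1)))\<^sup>2"
    by (metis of_nat_le_iff of_nat_power)
  also have "real (nat (2 * N + 1)) = 2 * of_int N + 1" using N0 by simp
  finally have "real (card (grid_index h ` S)) * h\<^sup>2 \<le> (2 * of_int N + 1)\<^sup>2 * h\<^sup>2" by (rule mult_right_mono) simp
  also have "\<dots> = ((2 * of_int N + 1) * h)\<^sup>2" by (simp only: power_mult_distrib)
  \<comment> \<open>There are at most \<open>2 * N + 1\<close> cells per axis and
    \<open>N < (B + 1) / h + 1\<close>, so they span a length of at most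
    \<open>2 * (B + 1) + 3 * h\<close>.\<close>
  also have "\<dots> \<le> (2 * B + 5)\<^sup>2"
  proof (rule power_mono)
    have "(2 * of_int N + 1) * h \<le> (2 * ((B + 1) / h + 1) + 1) * h"
    proof (rule mult_right_mono)
      define q where "q = (B + 1) / h"
      have "of_int N < q + 1" using N(2) by (simp only: q_def)
      then show "2 * real_of_int N + 1 \<le> 2 * ((B + 1) / h + 1) + 1" unfolding q_def[symmetric] by simp
    qed (use h in simp)
    also have "\<dots> = 2 * B + 2 + 3 * h" using h by (simp add: field_simps)
    finally show "(2 * of_int N + 1) * h \<le> 2 * B + 5" using h by simp
    show "0 \<le> (2 * of_int N + 1) * h" using N0 h by simp
  qed
  finally show "real (card (grid_index h ` S)) * h\<^sup>2 \<le> (2 * B + 5)\<^sup>2" .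
qed

text \<open>The argument \<open>1/2\<close> is the ratio of a disc of radius \<open>2 * h\<close>,
  which contains the square, to the working disc of radius \<open>4 * h\<close>. The next factor is
  the logarithmic bound in units of \<open>k * h\<close>. The 16 is \<open>4^2\<close>, multiplied
  by the area bound of the grid, and the final 1 pays for the linearization.\<close>

definition fine_constant :: "real \<Rightarrow> real \<Rightarrow> real" where
  "fine_constant B c = 6 * log_constant (1 / 2) * (2 + 2 * ln (144 * (B + 2)) + \<bar>ln c\<bar>) * (1 + 16 * (2 * B + 5)\<^sup>2) + 1"

lemma fine_constant_pos: "B > 1 \<Longrightarrow> fine_constant B c > 0"
  unfolding fine_constant_def by (intro add_nonneg_pos mult_nonneg_nonneg less_imp_le[OF log_constant_pos]) auto

context zero_statistics
begin

text \<open>\<open>|L|\<close> is cut into its restrictions to the squares, each treated on its own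
  disc. Their integrals add up to the full one, while the loss \<open>D * s^2 * (4 * h)^2\<close>
  occurs once per square; the \<open>O(h^(-2))\<close> squares make its total independent of
  \<open>h\<close>.\<close>

lemma fine_bound:
  assumes c: "c > 0" and D: "\<And>z. cmod (L z) \<le> D" and s: "0 < s" "s \<le> 1"
    and norm: "hyp_integral fund_domain (\<lambda>z. (Im z) ^ k * (cmod (f z))\<^sup>2) = 1"
    and h: "ln (real k) / real k < h" "h \<le> 1 / 64"
    and low: "\<forall>z0\<in>R. \<exists>z1\<in>ball z0 h \<inter> upper_half. (Im z1) ^ k * (cmod (f z1))\<^sup>2 \<ge> c * exp (- (real k * h))"
  shows "discrepancy k f \<phi> \<le>
     fine_constant B c * (real k * h) * ((1 + ln (2 / s)) * (LBINT z. cmod (L z)) + D * s\<^sup>2)"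
proof -
  have half: "0 < 1 / (2::real)" "1 / 2 < (1::real)" by simp_all
  define C where "C = 6 * log_constant (1 / 2)"
  have C: "C > 0" unfolding C_def using log_constant_pos[OF half] by simp
  define Cl where "Cl = 2 + 2 * ln (144 * (B + 2)) + \<bar>ln c\<bar>"
  define E where "E = 16 * (2 * B + 5)\<^sup>2"
  define C' where "C' = C * Cl * (1 + E) + 1"
  have C': "fine_constant B c = C'" by (simp add: fine_constant_def C'_def C_def Cl_def E_def)
  have Cl: "Cl > 0" using B by (simp add: Cl_def add_pos_nonneg)
  have E: "E \<ge> 0" by (simp add: E_def)
  let ?I = "(LBINT z. cmod (L z))"
  have k2: "real k \<ge> 2" using weight_ge_2 by simp
  have "0 < ln (real k) / real k" using k2 by simp
  then have h0: "h > 0" using h(1) by linarith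
  define l where "l = Cl * (real k * h)"
  define J where "J = grid_index h ` K"
  have fin: "finite J" and card: "real (card J) * h\<^sup>2 \<le> (2 * B + 5)\<^sup>2"
    unfolding J_def using card_grid_index[of K B h] K_bounds B h0 h(2) by force+
  define \<psi> where "\<psi> = (\<lambda>j z. indicator {z. grid_index h z = j} z * cmod (L z))"
  \<comment> \<open>The discs are centred at points of \<open>K\<close>, not at the middle of the
    squares, because the lower bound is supplied only around points of \<open>R\<close>.\<close>
  have "\<exists>zz. \<forall>j\<in>J. zz j \<in> K \<and> grid_index h (zz j) = j"
    by (rule bchoice) (auto simp: J_def)
  then obtain zz where zz: "\<And>j. j \<in> J \<Longrightarrow> zz j \<in> K" "\<And>j. j \<in> J \<Longrightarrow> grid_index h (zz j) = j" by blast
  have i\<psi>: "integrable lborel (\<psi> j)" for j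
    using integrable_mult_indicator[OF _ integrable_L(2), of "{z. grid_index h z = j}"] grid_index_measurable
    by (simp add: \<psi>_def)
  have "\<exists>W. integrable lborel W \<and> (\<forall>z. \<bar>ln (cmod (flattened (zz j) z))\<bar> * \<psi> j z \<le> W z) \<and>
      integral\<^sup>L lborel W \<le> C * l * ((1 + ln (2 / s)) * integral\<^sup>L lborel (\<psi> j) + D * s\<^sup>2 * (4 * h)\<^sup>2)"
    if j: "j \<in> J" for j
  proof -
    note z0 = zz(1)[OF j]
    obtain z1 where z1: "z1 \<in> ball (zz j) h" "c * exp (- (real k * h)) \<le> (Im z1) ^ k * (cmod (f z1))\<^sup>2"
      using low z0 K_R by blast
    note fb = flattened_bounds[OF norm z0 h(2) h(1) z1 c, folded Cl_def, folded l_def]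
    show ?thesis
      unfolding C_def
    proof (rule log_modulus_integral_bound[OF half, of _ "zz j" "5 * h" "4 * h" l z1])
      show "flattened (zz j) holomorphic_on ball (zz j) (5 * h)"
      proof (rule holomorphic_on_subset[OF holomorphic_flattened])
        show "ball (zz j) (5 * h) \<subseteq> upper_half"
        proof
          fix z assume "z \<in> ball (zz j) (5 * h)"
          then have "cmod (z - zz j) < 5 * h" by (simp add: dist_norm norm_minus_commute)
          then have "\<bar>Im z - Im (zz j)\<bar> < 5 * h" using abs_Im_le_cmod[of "z - zz j"] by simp
          then show "z \<in> upper_half" using K_bounds[OF z0] h(2) by (simp add: upper_half_def abs_less_iff)
        qed
      qed
      show "cmod (z1 - zz j) \<le> 1 / 2 * (4 * h)" using z1(1) h0 by (simp add: dist_norm norm_minus_commute)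
      fix z
      show "0 \<le> \<psi> j z \<and> \<psi> j z \<le> D" using D[of z] order_trans[OF norm_ge_zero D[of z]]
        by (simp add: \<psi>_def indicator_def)
      assume "\<psi> j z \<noteq> 0"
      then have "grid_index h z = grid_index h (zz j)" using zz(2)[OF j] by (simp add: \<psi>_def indicator_def split: if_splits)
      from grid_index_dist[OF this h0] show "z \<in> cball (zz j) (1 / 2 * (4 * h))"
        by (simp add: dist_norm norm_minus_commute)
    qed (use fb h0 s i\<psi> in auto)
  qed
  then have "\<exists>W. \<forall>j\<in>J. integrable lborel (W j) \<and> (\<forall>z. \<bar>ln (cmod (flattened (zz j) z))\<bar> * \<psi> j z \<le> W j z) \<and>
      integral\<^sup>L lborel (W j) \<le> C * l * ((1 + ln (2 / s)) * integral\<^sup>L lborel (\<psi> j) + D * s\<^sup>2 * (4 * h)\<^sup>2)"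
    by (intro bchoice) blast
  then obtain W where W: "\<And>j. j \<in> J \<Longrightarrow> integrable lborel (W j)"
    "\<And>j z. j \<in> J \<Longrightarrow> \<bar>ln (cmod (flattened (zz j) z))\<bar> * \<psi> j z \<le> W j z"
    "\<And>j. j \<in> J \<Longrightarrow> integral\<^sup>L lborel (W j) \<le> C * l * ((1 + ln (2 / s)) * integral\<^sup>L lborel (\<psi> j) + D * s\<^sup>2 * (4 * h)\<^sup>2)"
    by blast
  have \<psi>0: "0 \<le> \<psi> j z" for j z by (simp add: \<psi>_def)
  have W0: "0 \<le> W j z" if "j \<in> J" for j z
    using W(2)[OF that, of z] mult_nonneg_nonneg[OF abs_ge_zero \<psi>0[of j z]] order_trans by blast
  have bd: "AE z in lborel. \<bar>u z + 0\<bar> * cmod (L z) \<le> (\<Sum>j\<in>J. W j z) + real k * h * cmod (L z)"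
    using AE_f_nonzero
  proof (rule eventually_mono)
    fix z assume fz: "z \<in> K \<longrightarrow> f z \<noteq> 0"
    have S0: "0 \<le> (\<Sum>j\<in>J. W j z)" using W0 by (rule sum_nonneg)
    show "\<bar>u z + 0\<bar> * cmod (L z) \<le> (\<Sum>j\<in>J. W j z) + real k * h * cmod (L z)"
    proof (cases "z \<in> K")
      case False
      then show ?thesis using S0 test_facts(5)[of z] by simp
    next
      case True
      define j where "j = grid_index h z"
      have j: "j \<in> J" using True by (simp add: J_def j_def)
      have "cmod (z - zz j) \<le> 5 * h"
        using grid_index_dist[of h z "zz j"] zz(2)[OF j] h0 by (simp add: j_def)
      from log_flattened[OF zz(1)[OF j] this h(2)] fz True
      have "\<bar>u z\<bar> * cmod (L z) \<le> (\<bar>ln (cmod (flattened (zz j) z))\<bar> + real k * h) * cmod (L z)"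
        by (intro mult_right_mono) auto
      also have "\<dots> = \<bar>ln (cmod (flattened (zz j) z))\<bar> * \<psi> j z + real k * h * cmod (L z)"
        by (simp add: \<psi>_def j_def distrib_right)
      also have "\<dots> \<le> (\<Sum>j\<in>J. W j z) + real k * h * cmod (L z)"
        using W(2)[OF j, of z] member_le_sum[of j J "\<lambda>j. W j z"] j fin W0 by force
      finally show ?thesis by simp
    qed
  qed
  have \<psi>sum: "(\<Sum>j\<in>J. integral\<^sup>L lborel (\<psi> j)) = ?I"
  proof -
    have "(\<Sum>j\<in>J. \<psi> j z) = cmod (L z)" for z
    proof (cases "z \<in> K")
      case False
      then show ?thesis using test_facts(5)[of z] by (simp add: \<psi>_def)
    next
      case True
      then have "grid_index h z \<in> J" by (simp add: J_def)
      then show ?thesis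
        using fin by (simp add: \<psi>_def indicator_def if_distrib[of "\<lambda>x. x * _"] sum.delta' cong: if_cong)
    qed
    then show ?thesis using i\<psi> by (simp flip: Bochner_Integration.integral_sum)
  qed
  have I0: "0 \<le> ?I" by simp
  have D0: "0 \<le> D" using D norm_ge_zero order_trans by blast
  have l0: "0 \<le> ln (2 / s)" using s by simp
  have kh: "0 < real k * h" using k2 h0 by simp
  have lp: "0 < l" using Cl kh by (simp add: l_def)
  have "discrepancy k f \<phi> \<le>
    (LBINT z. (\<Sum>j\<in>J. W j z) + real k * h * cmod (L z))"
    by (rule zero_sum_bound[OF _ bd])
       (intro Bochner_Integration.integrable_add Bochner_Integration.integrable_sum W integrable_mult_right integrable_L)
  also have "\<dots> = (\<Sum>j\<in>J. integral\<^sup>L lborel (W j)) + real k * h * ?I"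
    using W(1) integrable_L(2) by (subst Bochner_Integration.integral_add) auto
  also have "\<dots> \<le> (\<Sum>j\<in>J. C * l * ((1 + ln (2 / s)) * integral\<^sup>L lborel (\<psi> j) + D * s\<^sup>2 * (4 * h)\<^sup>2)) + real k * h * ?I"
    by (intro add_right_mono sum_mono W(3))
  also have "(\<Sum>j\<in>J. C * l * ((1 + ln (2 / s)) * integral\<^sup>L lborel (\<psi> j) + D * s\<^sup>2 * (4 * h)\<^sup>2)) =
     C * l * ((1 + ln (2 / s)) * ?I + D * s\<^sup>2 * (16 * (real (card J) * h\<^sup>2)))"
    unfolding sum_distrib_left[symmetric] sum.distrib \<psi>sum by (simp add: power_mult_distrib mult_ac)
  also have "\<dots> \<le> C * l * ((1 + ln (2 / s)) * ?I + D * s\<^sup>2 * E)"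
    unfolding E_def using card C lp D0 by (intro mult_left_mono add_left_mono) auto
  also have "C * l * ((1 + ln (2 / s)) * ?I + D * s\<^sup>2 * E) + real k * h * ?I \<le>
     C' * (real k * h) * ((1 + ln (2 / s)) * ?I + D * s\<^sup>2)"
  proof -
    define X where "X = (1 + ln (2 / s)) * ?I"
    define Y where "Y = D * s\<^sup>2"
    have X: "?I \<le> X" "0 \<le> X" using I0 l0 by (auto simp: X_def distrib_right)
    have Y: "0 \<le> Y" using D0 by (simp add: Y_def)
    have "0 \<le> C * Cl * (E * X)" "0 \<le> C * Cl * Y" using C Cl X Y E by simp_all
    then have "C * Cl * (X + Y * E) + ?I \<le> C' * (X + Y)"
      using X Y by (simp add: C'_def algebra_simps)
    then have "(real k * h) * (C * Cl * (X + Y * E) + ?I) \<le> (real k * h) * (C' * (X + Y))"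
      using kh by (intro mult_left_mono) auto
    then show ?thesis unfolding X_def[symmetric] Y_def[symmetric] l_def by (simp add: algebra_simps)
  qed
  finally show ?thesis by (simp add: C')
qed

end

section \<open>Choice of the cutoff radius\<close>

text \<open>The exponent makes \<open>h^(-A) * s^2 = h^(A + 2)\<close>, which is at most
  \<open>h^2\<close>; the price is the factor \<open>A + 1\<close> in the logarithm.\<close>

lemma cutoff_radius:
  fixes h A :: real
  assumes "0 < h" "h < 1" "A \<ge> 0"
  defines "s \<equiv> h powr (A + 1)"
  shows "0 < s" "s \<le> 1" "h powr (- A) * s\<^sup>2 \<le> h\<^sup>2" "1 + ln (2 / s) \<le> 2 + (A + 1) * ln (1 / h)"
proof -
  show s: "0 < s" using assms by (simp add: s_def)
  show "s \<le> 1" using assms by (simp add: s_def powr_le1)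
  have "h powr (- A) * s\<^sup>2 = h powr A * h\<^sup>2"
    using assms by (simp add: s_def power2_eq_square powr_add[symmetric] powr_minus powr_mult_base field_simps)
  also have "\<dots> \<le> 1 * h\<^sup>2" using assms by (intro mult_right_mono powr_le1) auto
  finally show "h powr (- A) * s\<^sup>2 \<le> h\<^sup>2" by simp
  have "ln (2::real) \<le> 1" using ln_le_minus_one[of 2] by simp
  moreover have "ln (2 / s) = ln 2 - (A + 1) * ln h" using s assms by (simp add: ln_div s_def ln_powr)
  moreover have "ln (1 / h) = - ln h" using assms by (simp add: ln_div)
  ultimately show "1 + ln (2 / s) \<le> 2 + (A + 1) * ln (1 / h)" by simp
qed

theorem theorem2p1:
  fixes B :: real and K :: "real \<Rightarrow> real" and c M :: real
  assumes "B > 1" and "c > 0" and "M > 0"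
  shows "\<exists>C1::real. \<forall>A::real. A \<ge> 0 \<longrightarrow> (\<exists>C2::real.
    \<forall>(k::nat) (f::complex \<Rightarrow> complex) (h::nat \<Rightarrow> real) (R::complex set) (\<phi>::complex \<Rightarrow> complex).
      hecke_cusp_form k f \<longrightarrow>
      hyp_integral fund_domain (\<lambda>z. (Im z) ^ k * (cmod (f z))\<^sup>2) = 1 \<longrightarrow>
      R \<subseteq> {z \<in> fund_domain. Im z \<le> B} \<longrightarrow>
      h k > ln (real k) / real k \<longrightarrow>
      real_smooth_on upper_half \<phi> \<longrightarrow>
      compactly_supported_in R \<phi> \<longrightarrow>
      (\<forall>z\<in>upper_half. cmod (hyp_laplacian \<phi> z) \<le> M * h k powr (- A)) \<longrightarrow>
      (real k \<ge> K B \<longrightarrow>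
        (\<forall>z0\<in>R. \<exists>z1\<in>ball z0 (h k) \<inter> upper_half.
           (Im z1) ^ k * (cmod (f z1))\<^sup>2 \<ge> c * exp (- (real k * h k)))) \<longrightarrow>
      cmod (zero_sum f \<phi>
          - of_real (real k / 12 * (3 / pi)) * hyp_integral fund_domain \<phi>)
        \<le> C1 * (real k * (h k)\<^sup>2)
          + C2 * \<bar>real k * h k * ln (1 / h k) * hyp_integral fund_domain (\<lambda>z. cmod (hyp_laplacian \<phi> z))\<bar>)"
proof -
  let "\<exists>C1. \<forall>A. _ A \<longrightarrow> (\<exists>C2. ?P C1 A C2)" = ?thesis
  define Cc where "Cc = crude_constant B"
  define Cf where "Cf = fine_constant B c"
  have Cc: "Cc > 0" unfolding Cc_def by (rule crude_constant_pos[OF assms(1)])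
  have Cf: "Cf > 0" unfolding Cf_def by (rule fine_constant_pos[OF assms(1)])
  define h0 where "h0 = min (1 / 64) (ln 2 / max (K B) 1)"
  have h0: "0 < h0" by (simp add: h0_def)
  \<comment> \<open>This is the crude bound with cutoff \<open>s = 1\<close> and
    \<open>D <= 4 * M\<close>; the division by \<open>h0^2\<close> turns \<open>k\<close> into
    \<open>k * h^2\<close>.\<close>
  define C0 where "C0 = Cc * (4 * M * (2 * B + 1)) / h0\<^sup>2"
  define C1 where "C1 = C0 + Cc * (2 * M) + Cf * (2 * M)"
  have C0: "C0 \<ge> 0" using Cc assms by (simp add: C0_def)
  have l2: "1 / 2 \<le> ln (2::real)" "ln (2::real) \<le> 1"
    using ln_le_minus_one[of "1 / 2"] ln_le_minus_one[of 2] by (auto simp: ln_div)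
  show ?thesis
  proof (rule exI[of _ C1], intro allI impI)
    fix A :: real assume A: "A \<ge> 0"
    \<comment> \<open>The two summands are the coefficients of the logarithmic term in the
      small-disc and large-disc cases. Dividing by \<open>h0\<close> recovers the factor
      \<open>h\<close> that the crude bound lacks.\<close>
    define C2 where "C2 = Cf * (A + 3) + Cc * (5 * A + 1) / h0"
    have C2: "C2 \<ge> 0" using Cc Cf A h0 by (simp add: C2_def)
    show "\<exists>C2. ?P C1 A C2"
    proof (intro exI[of _ C2] allI impI)
      fix k :: nat and f :: "complex \<Rightarrow> complex" and hh :: "nat \<Rightarrow> real" and R :: "complex set" and \<phi> :: "complex \<Rightarrow> complex"
      assume hecke: "hecke_cusp_form k f"
        and norm: "hyp_integral fund_domain (\<lambda>z. (Im z) ^ k * (cmod (f z))\<^sup>2) = 1"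
        and R: "R \<subseteq> {z \<in> fund_domain. Im z \<le> B}"
        and hk: "hh k > ln (real k) / real k"
        and smooth: "real_smooth_on upper_half \<phi>" and supp: "compactly_supported_in R \<phi>"
        and lap: "\<forall>z\<in>upper_half. cmod (hyp_laplacian \<phi> z) \<le> M * hh k powr (- A)"
        and low: "real k \<ge> K B \<longrightarrow> (\<forall>z0\<in>R. \<exists>z1\<in>ball z0 (hh k) \<inter> upper_half.
           (Im z1) ^ k * (cmod (f z1))\<^sup>2 \<ge> c * exp (- (real k * hh k)))"
      define h where "h = hh k"
      note hk = hk[folded h_def] and lap = lap[folded h_def] and low = low[folded h_def]
      have zs: "zero_statistics k f B R \<phi>"
        using hecke R smooth supp assms(1) by unfold_locales (auto simp: hecke_cusp_form_def)
      interpret zero_statistics k f B R \<phi> by (rule zs)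
      define I where "I = (LBINT z. cmod (L z))"
      define D where "D = 2 * M * h powr (- A)"
      have k2: "real k \<ge> 2" using weight_ge_2 by simp
      have "0 < ln (real k) / real k" using k2 by simp
      then have hpos: "h > 0" using hk by linarith
      have D0: "0 \<le> D" using assms(3) by (simp add: D_def)
      have DL: "cmod (L z) \<le> D" for z
        unfolding D_def using norm_L_le[of "M * h powr (- A)" z] lap assms(3) by simp
      have I: "0 \<le> I" "I \<le> D * B" unfolding I_def using integral_L_le[OF DL D0] by auto
      define T where "T = real k * h * ln (1 / h) * I"
      have "discrepancy k f \<phi> \<le> C1 * (real k * h\<^sup>2) + C2 * \<bar>T\<bar>"
      proof (cases "h \<le> 1 / 64 \<and> real k \<ge> K B")
        case True
        then have h1: "h < 1" by simp
        note s = cutoff_radius[OF hpos h1 A]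
        \<comment> \<open>In this range \<open>ln (1 / h) >= 1\<close>, so the additive 2 left by
          the cutoff is at most \<open>2 * ln (1 / h)\<close>, whence \<open>A + 3\<close>.\<close>
        have "exp 1 \<le> (64::real)" using exp_le by simp
        also have "64 \<le> 1 / h" using True hpos by (simp add: field_simps)
        finally have l1: "1 \<le> ln (1 / h)" using hpos by (simp add: ln_ge_iff)
        have T0: "0 \<le> T" unfolding T_def by (intro mult_nonneg_nonneg) (use I l1 hpos k2 in linarith)+
        have "discrepancy k f \<phi> \<le> Cf * (real k * h) * ((1 + ln (2 / h powr (A + 1))) * I + D * (h powr (A + 1))\<^sup>2)"
          using fine_bound[OF assms(2) DL s(1,2) norm hk] True low unfolding I_def Cf_def by blast
        also have "\<dots> \<le> Cf * (real k * h) * ((A + 3) * ln (1 / h) * I + 2 * M * h)"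
        proof (intro mult_left_mono add_mono mult_right_mono)
          have "2 + (A + 1) * ln (1 / h) \<le> (A + 3) * ln (1 / h)" using l1 by (simp add: distrib_right)
          then show "1 + ln (2 / h powr (A + 1)) \<le> (A + 3) * ln (1 / h)" using s(4) by linarith
          have "D * (h powr (A + 1))\<^sup>2 = 2 * M * (h powr (- A) * (h powr (A + 1))\<^sup>2)" by (simp add: D_def)
          also have "\<dots> \<le> 2 * M * h\<^sup>2" using s(3) assms(3) by (intro mult_left_mono) auto
          also have "\<dots> \<le> 2 * M * h" using h1 hpos assms(3) by (intro mult_left_mono) (auto simp: power2_eq_square mult_left_le)
          finally show "D * (h powr (A + 1))\<^sup>2 \<le> 2 * M * h" .
        qed (use Cf hpos I in auto)
        also have "\<dots> = Cf * (2 * M) * (real k * h\<^sup>2) + Cf * (A + 3) * T"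
          by (simp add: T_def power2_eq_square algebra_simps)
        also have "\<dots> \<le> C1 * (real k * h\<^sup>2) + C2 * \<bar>T\<bar>"
        proof (intro add_mono mult_mono)
          show "Cf * (2 * M) \<le> C1" using C0 Cc assms(3) by (simp add: C1_def)
          show "Cf * (A + 3) \<le> C2" using Cc A h0 by (simp add: C2_def)
        qed (use Cf T0 C2 C0 Cc assms(3) in \<open>auto simp: C1_def\<close>)
        finally show ?thesis .
      next
        case False
        have hh0: "h0 \<le> h"
        proof (cases "h \<le> 1 / 64")
          case True
          then have "real k \<le> max (K B) 1" using False by simp
          then have "ln 2 / max (K B) 1 \<le> ln (real k) / real k" using k2 by (intro frac_le) auto
          then show ?thesis using hk by (simp add: h0_def)
        qed (simp add: h0_def)
        \<comment> \<open>The split is at \<open>h powr (- A) = 2\<close>. Below it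
          \<open>ln (1 / h)\<close> may be zero or negative, so the whole error is charged to
          \<open>k * h^2\<close>, with a constant independent of \<open>A\<close>. Above it
          \<open>A * ln (1 / h) > ln 2\<close>, which forces \<open>h < 1\<close> and makes the
          logarithmic term large enough.\<close>
        show ?thesis
        proof (cases "D \<le> 4 * M")
          case True
          have "discrepancy k f \<phi> \<le> Cc * real k * ((1 + ln (2 / 1)) * I + D * 1\<^sup>2)"
            using crude_bound[OF DL, of 1] unfolding I_def Cc_def by simp
          also have "\<dots> \<le> Cc * real k * (2 * (4 * M * B) + 4 * M)"
          proof (intro mult_left_mono add_mono)
            have "D * B \<le> 4 * M * B" using True assms(1) by (intro mult_right_mono) auto
            then have "I \<le> 4 * M * B" using I by linarith
            then show "(1 + ln (2 / 1)) * I \<le> 2 * (4 * M * B)" using l2 I by (intro mult_mono) auto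
            show "D * 1\<^sup>2 \<le> 4 * M" using True by simp
          qed (use Cc in auto)
          also have "\<dots> = real k * (Cc * (4 * M * (2 * B + 1)))" by (simp add: algebra_simps)
          also have "\<dots> = real k * (C0 * h0\<^sup>2)" using h0 by (simp add: C0_def)
          also have "\<dots> = C0 * (real k * h0\<^sup>2)" by (simp only: mult_ac)
          also have "\<dots> \<le> C0 * (real k * h\<^sup>2)" using C0 hh0 h0 by (intro mult_left_mono power_mono) auto
          also have "\<dots> \<le> C1 * (real k * h\<^sup>2)" using Cc Cf assms(3) by (intro mult_right_mono) (auto simp: C1_def)
          finally show ?thesis using C2 mult_nonneg_nonneg[OF C2 abs_ge_zero[of T]] by linarith
        next
          case False
          then have "2 < h powr (- A)" using assms(3) by (simp add: D_def)
          then have hA: "ln 2 < A * ln (1 / h)"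
            using hpos ln_less_cancel_iff[of 2 "h powr (- A)"] by (simp add: ln_powr ln_div)
          have h1: "h < 1"
          proof (rule ccontr)
            assume "\<not> h < 1"
            then have "ln (1 / h) \<le> 0" by (simp add: ln_div)
            then have "A * ln (1 / h) \<le> 0" using A by (rule mult_nonneg_nonpos[rotated])
            then show False using hA l2 by linarith
          qed
          note s = cutoff_radius[OF hpos h1 A]
          have l1: "0 \<le> ln (1 / h)" using hpos h1 by simp
          have T0: "0 \<le> T" unfolding T_def by (intro mult_nonneg_nonneg) (use I l1 hpos k2 in linarith)+
          have "discrepancy k f \<phi> \<le> Cc * real k * ((1 + ln (2 / h powr (A + 1))) * I + D * (h powr (A + 1))\<^sup>2)"
            using crude_bound[OF DL s(1,2)] unfolding I_def Cc_def .
          also have "\<dots> \<le> Cc * real k * ((5 * A + 1) * ln (1 / h) * I + 2 * M * h\<^sup>2)"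
          proof (intro mult_left_mono add_mono mult_right_mono)
            \<comment> \<open>Since \<open>A * ln (1 / h) > ln 2 >= 1/2\<close>, the additive 2 is
              at most \<open>4 * (A * ln (1 / h))\<close>.\<close>
            have "(5 * A + 1) * ln (1 / h) = 4 * (A * ln (1 / h)) + (A + 1) * ln (1 / h)" by (simp add: algebra_simps)
            then show "1 + ln (2 / h powr (A + 1)) \<le> (5 * A + 1) * ln (1 / h)" using s(4) hA l2 by linarith
            have "D * (h powr (A + 1))\<^sup>2 = 2 * M * (h powr (- A) * (h powr (A + 1))\<^sup>2)" by (simp add: D_def)
            also have "\<dots> \<le> 2 * M * h\<^sup>2" using s(3) assms(3) by (intro mult_left_mono) auto
            finally show "D * (h powr (A + 1))\<^sup>2 \<le> 2 * M * h\<^sup>2" .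
          qed (use Cc I in auto)
          also have "\<dots> = Cc * (2 * M) * (real k * h\<^sup>2) + Cc * (5 * A + 1) / h0 * (h0 / h * T)"
          proof -
            have "Cc * (5 * A + 1) / h0 * (h0 / h * T) = Cc * (5 * A + 1) * (T / h)" using h0 by simp
            also have "T / h = real k * ln (1 / h) * I" using hpos by (simp add: T_def)
            finally show ?thesis by (simp add: algebra_simps)
          qed
          also have "\<dots> \<le> C1 * (real k * h\<^sup>2) + C2 * \<bar>T\<bar>"
          proof (intro add_mono mult_mono)
            show "Cc * (2 * M) \<le> C1" using C0 Cf assms(3) by (simp add: C1_def)
            show "Cc * (5 * A + 1) / h0 \<le> C2" using Cf A by (simp add: C2_def)
            have "h0 / h * T \<le> 1 * T" using hh0 hpos T0 by (intro mult_right_mono) auto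
            then show "h0 / h * T \<le> \<bar>T\<bar>" by simp
            show "0 \<le> h0 / h * T" using T0 hpos h0 by simp
          qed (use Cf C2 C0 Cc assms(3) in \<open>auto simp: C1_def\<close>)
          finally show ?thesis .
        qed
      qed
      then show "cmod (zero_sum f \<phi> - of_real (real k / 12 * (3 / pi)) * hyp_integral fund_domain \<phi>)
        \<le> C1 * (real k * (hh k)\<^sup>2)
          + C2 * \<bar>real k * hh k * ln (1 / hh k) * hyp_integral fund_domain (\<lambda>z. cmod (hyp_laplacian \<phi> z))\<bar>"
        unfolding T_def I_def h_def hyp_integral_laplacian discrepancy_def .
    qed
  qed
qed

end
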